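(* Let $n\ge1$, $Q=2n+2$, and let $\tilde{\mathcal E}$ denote the class of sets of the form $\delta_\lambda L_g(E)$ for some $E\in\mathcal E$, $\lambda>0$ and $g\in\mathbb H^n$. Then $$|E|^{\frac{Q-1}{Q}}\le C_Q\,P_H(E;\mathbb H^n)\qquad\text{for all }E\in\tilde{\mathcal E},$$ where $$C_Q=\frac{(Q-1)\,\Gamma\left(\frac Q2\right)^{\frac2Q}}{Q^{\frac{Q-1}{Q}}\,(Q-2)\,\Gamma\left(\frac{Q+1}{2}\right)^{\frac1Q}\,\pi^{\frac{Q-1}{2Q}}},$$ with equality if and only if $E=L_g\delta_\lambda(E_o)$ for some $\lambda>0$ and $g\in\mathbb H^n$, where $E_o=\{(z,t)\in\mathbb H^n: |z|<1,\ |t|<u_o(z)\}$ and $$u_o(z)=\frac{\pi}{8}+\frac{|z|}{4}\sqrt{1-|z|^2}-\frac14\sin^{-1}(|z|),\qquad|z|\le1.$$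
   Context: Heisenberg group: $\mathbb H^n=\mathbb R^{2n+1}$ with points $g=(z,t)=(x,y,t)$, $x,y\in\mathbb R^n$, $t\in\mathbb R$, and group law $(x,y,t)(x',y',t')=(x+x',y+y',t+t'+\frac12(\langle x,y'\rangle-\langle x',y\rangle))$. $L_g(g')=gg'$ is left-translation and $\delta_\lambda(z,t)=(\lambda z,\lambda^2t)$. Left-invariant horizontal vector fields: $X_i=\partial_{x_i}-\frac{y_i}{2}\partial_t$, $X_{n+i}=\partial_{y_i}+\frac{x_i}{2}\partial_t$, $i=1,\dots,n$. $|E|$ is Lebesgue measure. $\mathbb H^n_{+}=\{t>0\}$, $\mathbb H^n_-=\{t<0\}$. $B(0,R)$ is the Euclidean ball in $\mathbb R^{2n}$. $H$-perimeter: for a measurable set $E$ and an open set $\Omega$, $P_H(E;\Omega)=\sup\int_E\sum_{i=1}^{2n}X_i\zeta_i\,dg$, the supremum over $\zeta=(\zeta_1,\dots,\zeta_{2n})$ with $\zeta_i$ and $X_j\zeta_i$ continuous and compactly supported in $\Omega$ for all $i,j$, and $\sup_\Omega(\sum_i\zeta_i^2)^{1/2}\le1$. Class $\mathcal E$: the collection of sets $E\subset\mathbb H^n$ satisfying: (i) $|E\cap\mathbb H^n_+|=|E\cap\mathbb H^n_-|$; (ii) there exist $R>0$ (depending on $E$) and functions $u,v:\overline B(0,R)\to[0,\infty)$ with $u,v\in C^2(B(0,R))\cap C(\overline B(0,R))$, $u=v=0$ on $\partial B(0,R)$, such that $\partial E\cap\mathbb H^n_+=\{(z,t)\in\mathbb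 H^n_+: |z|<R,\ t=u(z)\}$ and $\partial E\cap\mathbb H^n_-=\{(z,t)\in\mathbb H^n_-: |z|<R,\ t=-v(z)\}$; (iii) $\{z\in B(0,R):u(z)=0\}\cap\{z\in B(0,R):v(z)=0\}=\varnothing$. Members of $\mathcal E$ are understood as the bounded open sets between the two graphs, $E=\{(z,t):|z|<R,\ -v(z)<t<u(z)\}$. *)

theory Defs
  imports "HOL-Analysis.Analysis"
begin

text \<open>
  A point \<open>((x, y), t)\<close> of the Heisenberg group of dimension \<open>2n+1\<close>, where \<open>n = CARD('n)\<close>.
  The product norm on the first component \<open>z = (x, y)\<close> is the Euclidean norm of \<open>\<real>\<^sup>2\<^sup>n\<close>.
\<close>
type_synonym 'n hplane = "(real ^ 'n) \<times> (real ^ 'n)"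
type_synonym 'n heis = "'n hplane \<times> real"

definition heis_mult :: "'n::finite heis \<Rightarrow> 'n heis \<Rightarrow> 'n heis" where
  "heis_mult = (\<lambda>((x, y), t) ((x', y'), t').
     ((x + x', y + y'), t + t' + (1 / 2) * (x \<bullet> y' - x' \<bullet> y)))"

definition heis_dil :: "real \<Rightarrow> 'n::finite heis \<Rightarrow> 'n heis" where
  "heis_dil l = (\<lambda>(z, t). (l *\<^sub>R z, l\<^sup>2 * t))"

definition heis_upper :: "'n::finite heis set" where
  "heis_upper = {(z, t). t > 0}"

definition heis_lower :: "'n::finite heis set" where
  "heis_lower = {(z, t). t < 0}"


text \<open>
  The horizontal frame is indexed by \<open>'n + 'n\<close>: \<open>Inl i\<close> stands for the field
  \<open>\<partial>\<^sub>x\<^sub>i - (y\<^sub>i / 2) \<partial>\<^sub>t\<close> and \<open>Inr i\<close> for \<open>\<partial>\<^sub>y\<^sub>i + (x\<^sub>i / 2) \<partial>\<^sub>t\<close>.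
\<close>
definition X_field :: "'n + 'n \<Rightarrow> 'n::finite heis \<Rightarrow> 'n heis" where
  "X_field j = (\<lambda>((x, y), t). case j of
       Inl i \<Rightarrow> ((axis i 1, 0), - (y $ i) / 2)
     | Inr i \<Rightarrow> ((0, axis i 1), (x $ i) / 2))"

text \<open>
  The integral curve of \<open>X_field j\<close> through \<open>g\<close> is the straight line
  \<open>s \<mapsto> g + s *\<^sub>R X_field j g\<close> (the field is constant along it), so the derivative of \<open>f\<close>
  along the field is the derivative along this line.  It may exist for functions \<open>f\<close>
  that have no partial derivative in \<open>t\<close>.
\<close>
definition X_differentiable :: "'n + 'n \<Rightarrow> ('n::finite heis \<Rightarrow> real) \<Rightarrow> bool" where
  "X_differentiable j f \<longleftrightarrow> (\<forall>g. (\<lambda>s. f (g + s *\<^sub>R X_field j g)) differentiable (at 0))"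

definition X_deriv :: "'n + 'n \<Rightarrow> ('n::finite heis \<Rightarrow> real) \<Rightarrow> 'n heis \<Rightarrow> real" where
  "X_deriv j f g = deriv (\<lambda>s. f (g + s *\<^sub>R X_field j g)) 0"

definition compactly_supported_in :: "'a::topological_space set \<Rightarrow> ('a \<Rightarrow> real) \<Rightarrow> bool" where
  "compactly_supported_in S f \<longleftrightarrow>
     compact (closure {x. f x \<noteq> 0}) \<and> closure {x. f x \<noteq> 0} \<subseteq> S"

text \<open>Test fields on an open set, extended by zero to the whole group.\<close>
definition horizontal_test_fields ::
    "'n::finite heis set \<Rightarrow> ('n + 'n \<Rightarrow> 'n heis \<Rightarrow> real) set" where
  "horizontal_test_fields \<Omega> = {\<zeta>.
     (\<forall>i. continuous_on UNIV (\<zeta> i) \<and> compactly_supported_in \<Omega> (\<zeta> i)) \<and>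
     (\<forall>i j. X_differentiable j (\<zeta> i) \<and> continuous_on UNIV (X_deriv j (\<zeta> i)) \<and>
            compactly_supported_in \<Omega> (X_deriv j (\<zeta> i))) \<and>
     (\<forall>g\<in>\<Omega>. sqrt (\<Sum>i\<in>UNIV. (\<zeta> i g)\<^sup>2) \<le> 1)}"

definition H_perimeter :: "'n::finite heis set \<Rightarrow> 'n heis set \<Rightarrow> ereal" where
  "H_perimeter E \<Omega> =
     (SUP \<zeta>\<in>horizontal_test_fields \<Omega>.
        ereal (set_lebesgue_integral lebesgue E (\<lambda>g. \<Sum>i\<in>UNIV. X_deriv i (\<zeta> i) g)))"


text \<open>Twice continuously differentiable on an open set (total derivatives).\<close>
definition C2_on :: "'a::euclidean_space set \<Rightarrow> ('a \<Rightarrow> real) \<Rightarrow> bool" where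
  "C2_on S f \<longleftrightarrow>
     (\<exists>(f' :: 'a \<Rightarrow> 'a \<Rightarrow>\<^sub>L real) (f'' :: 'a \<Rightarrow> 'a \<Rightarrow>\<^sub>L 'a \<Rightarrow>\<^sub>L real).
        (\<forall>x\<in>S. (f has_derivative blinfun_apply (f' x)) (at x)) \<and>
        (\<forall>x\<in>S. (f' has_derivative blinfun_apply (f'' x)) (at x)) \<and>
        continuous_on S f'')"

text \<open>
  The last clause expresses that a member of the class is the open region between the two graphs.
\<close>
definition isop_class :: "'n::finite heis set set" where
  "isop_class = {E.
     measure lebesgue (E \<inter> heis_upper) = measure lebesgue (E \<inter> heis_lower) \<and>
     (\<exists>R u v. R > 0 \<and>
        (\<forall>z\<in>cball 0 R. u z \<ge> 0 \<and> v z \<ge> 0) \<and>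
        C2_on (ball 0 R) u \<and> continuous_on (cball 0 R) u \<and>
        C2_on (ball 0 R) v \<and> continuous_on (cball 0 R) v \<and>
        (\<forall>z\<in>sphere 0 R. u z = 0 \<and> v z = 0) \<and>
        frontier E \<inter> heis_upper = {(z, t) \<in> heis_upper. norm z < R \<and> t = u z} \<and>
        frontier E \<inter> heis_lower = {(z, t) \<in> heis_lower. norm z < R \<and> t = - v z} \<and>
        {z \<in> ball 0 R. u z = 0} \<inter> {z \<in> ball 0 R. v z = 0} = {} \<and>
        E = {(z, t). norm z < R \<and> - v z < t \<and> t < u z})}"

definition isop_class_ext :: "'n::finite heis set set" where
  "isop_class_ext = {heis_dil l ` heis_mult g ` E | l g E. l > 0 \<and> E \<in> isop_class}"

definition u_opt :: "'n::finite hplane \<Rightarrow> real" where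
  "u_opt z = pi / 8 + norm z / 4 * sqrt (1 - (norm z)\<^sup>2) - 1 / 4 * arcsin (norm z)"

definition E_opt :: "'n::finite heis set" where
  "E_opt = {(z, t). norm z < 1 \<and> \<bar>t\<bar> < u_opt z}"

definition isop_const :: "real \<Rightarrow> real" where
  "isop_const Q =
     ((Q - 1) * Gamma (Q / 2) powr (2 / Q)) /
     (Q powr ((Q - 1) / Q) * (Q - 2) * Gamma ((Q + 1) / 2) powr (1 / Q)
        * pi powr ((Q - 1) / (2 * Q)))"

end

theory Submission
  imports Defs
begin

text \<open>
  The proof is by calibration. After a dilation \<open>R = 1\<close>. The horizontal unit normal of the upper half of the
  bubble \<open>E_opt\<close> is \<open>\<nu>\<^sup>+(z) = z + (sqrt (1 - |z|\<^sup>2) / |z|) J z\<close> with \<open>J (x, y) = (-y, x)\<close>; it does not depend on \<open>t\<close>,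
  and its horizontal divergence is the constant \<open>2n\<close>. The same holds for the lower half with \<open>- J\<close>. Testing the
  perimeter of \<open>E\<close> with cut-off versions of \<open>\<nu>\<^sup>+\<close> on the upper graph and \<open>\<nu>\<^sup>-\<close> on the lower graph gives
  \<open>P\<^sub>H(E) \<ge> 2n |E| + c\<close>, where \<open>c\<close> is the integral of \<open>|z| sqrt (1 - |z|\<^sup>2)\<close> over the unit ball, and Young's inequality turns this
  into the isoperimetric inequality. In the case of equality the calibration is a maximiser of the flux, and rotating it
  slightly in the plane spanned by \<open>z\<close> and \<open>J z\<close> shows that \<open>\<nu>\<^sup>+\<close> is a multiple of the horizontal normal of the graph.
  This prescribes the derivative of \<open>u\<close> along the half circles \<open>s \<mapsto> cos s (cos s e + sin s J e)\<close>, which run from the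
  boundary to the origin, so \<open>u\<close> is determined by its boundary values.
\<close>

section \<open>Continuously differentiable functions and the divergence theorem\<close>

text \<open>The obstacle is regularity. \<open>H_perimeter\<close> is a supremum over test fields
  with continuous derivatives, while \<nu> is singular at the origin and not smooth at the unit
  sphere, and \<open>u\<close> is only continuous up to the sphere, where its gradient may fail to
  be integrable. The flux of a cut-off field is therefore rewritten by the divergence theorem so
  that only values of \<open>u\<close> enter, and the limits near the sphere are taken in that form.
  Young's inequality is applied to |E|^((Q-1)/Q) V^(1/Q), with V the volume of the bubble. The
  identity c = (Q-2) V / (Q-1) makes its right-hand side a multiple of 2n |E| + c, and after
  division by V^(1/Q) the factor is C_Q. Equality in the theorem then forces equality in the
  calibration bound itself, which is all that the rigidity argument uses. For the converse, the
  perimeter of \<open>E_opt\<close> has to be bounded from above over all test fields. The bound A,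
  the horizontal area of its two graphs, satisfies A = Q c, which is the value 2n V + c of the
  calibration bound at the bubble. V, c and A are Beta integrals in the variable |z|^2.\<close>

definition C1_on :: "'a::real_normed_vector set \<Rightarrow> ('a \<Rightarrow> 'b::real_normed_vector) \<Rightarrow> bool" where
  "C1_on S f \<longleftrightarrow> (\<exists>f'. (\<forall>x\<in>S. (f has_derivative f' x) (at x)) \<and> (\<forall>h. continuous_on S (\<lambda>x. f' x h)))"

lemma C1_onI:
  assumes "\<And>x. x \<in> S \<Longrightarrow> (f has_derivative f' x) (at x)" "\<And>h. continuous_on S (\<lambda>x. f' x h)"
  shows "C1_on S f"
  using assms unfolding C1_on_def by blast

lemma C1_onD:
  assumes "C1_on S f"
  shows "x \<in> S \<Longrightarrow> (f has_derivative frechet_derivative f (at x)) (at x)"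
    and "continuous_on S (\<lambda>x. frechet_derivative f (at x) h)"
proof -
  obtain f' where f': "\<And>x. x \<in> S \<Longrightarrow> (f has_derivative f' x) (at x)"
      "\<And>h. continuous_on S (\<lambda>x. f' x h)"
    using assms unfolding C1_on_def by blast
  have eq: "frechet_derivative f (at x) = f' x" if "x \<in> S" for x
    using frechet_derivative_at[OF f'(1)[OF that]] by simp
  show "x \<in> S \<Longrightarrow> (f has_derivative frechet_derivative f (at x)) (at x)"
    using f'(1) eq by simp
  show "continuous_on S (\<lambda>x. frechet_derivative f (at x) h)"
    using f'(2)[of h] by (rule continuous_on_eq) (simp add: eq)
qed

lemma C1_on_imp_continuous_on: "C1_on S f \<Longrightarrow> continuous_on S f"
  by (meson C1_onD(1) continuous_at_imp_continuous_on has_derivative_continuous)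

lemma C1_on_subset: "C1_on S f \<Longrightarrow> T \<subseteq> S \<Longrightarrow> C1_on T f"
  unfolding C1_on_def by (meson continuous_on_subset subsetD)

text \<open>\<open>C1_on\<close> asks for continuity of the derivative in each fixed direction only.
  Expanding \<open>h x\<close> in the finite basis extends this to directions that vary with the
  point, as the horizontal fields do.\<close>

lemma C1_on_continuous_derivative:
  fixes f :: "'a::euclidean_space \<Rightarrow> 'b::real_normed_vector"
  assumes f: "C1_on S f" and h: "continuous_on S h"
  shows "continuous_on S (\<lambda>x. frechet_derivative f (at x) (h x))"
proof -
  have "continuous_on S (\<lambda>x. \<Sum>b\<in>Basis. (h x \<bullet> b) *\<^sub>R frechet_derivative f (at x) b)"
    by (intro continuous_intros h C1_onD(2)[OF f])
  then show ?thesis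
  proof (rule continuous_on_eq)
    fix x assume "x \<in> S"
    then have L: "linear (frechet_derivative f (at x))"
      using C1_onD(1)[OF f] has_derivative_linear by blast
    have "frechet_derivative f (at x) (h x)
        = frechet_derivative f (at x) (\<Sum>b\<in>Basis. (h x \<bullet> b) *\<^sub>R b)"
      by (simp add: euclidean_representation)
    also have "\<dots> = (\<Sum>b\<in>Basis. (h x \<bullet> b) *\<^sub>R frechet_derivative f (at x) b)"
      by (simp add: linear_sum[OF L] linear_cmul[OF L])
    finally show "(\<Sum>b\<in>Basis. (h x \<bullet> b) *\<^sub>R frechet_derivative f (at x) b)
        = frechet_derivative f (at x) (h x)" by simp
  qed
qed

lemma C1_on_const [simp]: "C1_on S (\<lambda>x. c)"
  by (rule C1_onI[where f' = "\<lambda>_ _. 0"]) auto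

lemma C1_on_bounded_linear: "bounded_linear f \<Longrightarrow> C1_on S f"
  by (rule C1_onI[where f' = "\<lambda>_. f"]) (auto intro: bounded_linear_imp_has_derivative)

lemma C1_on_add: "C1_on S f \<Longrightarrow> C1_on S g \<Longrightarrow> C1_on S (\<lambda>x. f x + g x)"
  by (rule C1_onI[where f' = "\<lambda>x h. frechet_derivative f (at x) h + frechet_derivative g (at x) h"])
    (auto intro!: has_derivative_add continuous_intros dest: C1_onD)

lemma (in bounded_bilinear) C1_on_bilinear:
  assumes f: "C1_on S f" and g: "C1_on S g"
  shows "C1_on S (\<lambda>x. prod (f x) (g x))"
proof (rule C1_onI)
  show "((\<lambda>x. prod (f x) (g x)) has_derivative
      (\<lambda>h. prod (f x) (frechet_derivative g (at x) h) + prod (frechet_derivative f (at x) h) (g x))) (at x)"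
    if "x \<in> S" for x
    by (rule FDERIV[OF C1_onD(1)[OF f that] C1_onD(1)[OF g that]])
  show "continuous_on S (\<lambda>x. prod (f x) (frechet_derivative g (at x) h)
      + prod (frechet_derivative f (at x) h) (g x))" for h
    by (intro continuous_intros continuous_on C1_onD(2) C1_on_imp_continuous_on f g)
qed

lemmas C1_on_scaleR = bounded_bilinear.C1_on_bilinear[OF bounded_bilinear_scaleR]
lemmas C1_on_mult = bounded_bilinear.C1_on_bilinear[OF bounded_bilinear_mult]
lemmas C1_on_inner = bounded_bilinear.C1_on_bilinear[OF bounded_bilinear_inner]

lemma C1_on_compose_linear:
  assumes f: "C1_on T f" and L: "bounded_linear L" and sub: "\<And>x. x \<in> S \<Longrightarrow> L x \<in> T"
  shows "C1_on S (\<lambda>x. f (L x))"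
proof (rule C1_onI)
  show "((\<lambda>x. f (L x)) has_derivative (\<lambda>h. frechet_derivative f (at (L x)) (L h))) (at x)"
    if "x \<in> S" for x
    using has_derivative_compose[OF bounded_linear_imp_has_derivative[OF L] C1_onD(1)[OF f sub[OF that]]]
    by simp
  show "continuous_on S (\<lambda>x. frechet_derivative f (at (L x)) (L h))" for h
    by (rule continuous_on_compose2[OF C1_onD(2)[OF f]])
      (use L sub in \<open>auto intro: linear_continuous_on\<close>)
qed

lemma C1_on_linear_compose:
  assumes f: "C1_on S f" and L: "bounded_linear L"
  shows "C1_on S (\<lambda>x. L (f x))"
proof (rule C1_onI)
  show "((\<lambda>x. L (f x)) has_derivative (\<lambda>h. L (frechet_derivative f (at x) h))) (at x)"
    if "x \<in> S" for x
    using bounded_linear.has_derivative[OF L C1_onD(1)[OF f that]] .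
  show "continuous_on S (\<lambda>x. L (frechet_derivative f (at x) h))" for h
    by (intro bounded_linear.continuous_on[OF L] C1_onD(2)[OF f])
qed

lemma C1_on_minus: "C1_on S f \<Longrightarrow> C1_on S (\<lambda>x. - f x)"
  using C1_on_linear_compose[OF _ bounded_linear_minus[OF bounded_linear_ident]] by blast

lemma C1_on_diff: "C1_on S f \<Longrightarrow> C1_on S g \<Longrightarrow> C1_on S (\<lambda>x. f x - g x)"
  using C1_on_add[of S f "\<lambda>x. - g x"] C1_on_minus[of S g] by simp

lemma C1_on_compose_real:
  fixes \<phi> :: "real \<Rightarrow> real"
  assumes f: "C1_on S f" and \<phi>: "\<And>y. y \<in> T \<Longrightarrow> (\<phi> has_real_derivative \<phi>' y) (at y)"
    and \<phi>': "continuous_on T \<phi>'" and sub: "\<And>x. x \<in> S \<Longrightarrow> f x \<in> T"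
  shows "C1_on S (\<lambda>x. \<phi> (f x))"
proof (rule C1_onI)
  show "((\<lambda>x. \<phi> (f x)) has_derivative (\<lambda>h. \<phi>' (f x) * frechet_derivative f (at x) h)) (at x)"
    if "x \<in> S" for x
    using has_derivative_compose[OF C1_onD(1)[OF f that]
        \<phi>[OF sub[OF that], unfolded has_field_derivative_def]] by simp
  show "continuous_on S (\<lambda>x. \<phi>' (f x) * frechet_derivative f (at x) h)" for h
    by (intro continuous_intros C1_onD(2)[OF f]
        continuous_on_compose2[OF \<phi>' C1_on_imp_continuous_on[OF f]]) (use sub in auto)
qed

lemma C1_on_divide:
  fixes f g :: "'a::real_normed_vector \<Rightarrow> real"
  assumes "C1_on S f" "C1_on S g" "\<And>x. x \<in> S \<Longrightarrow> g x \<noteq> 0"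
  shows "C1_on S (\<lambda>x. f x / g x)"
proof -
  have "C1_on S (\<lambda>x. inverse (g x))"
    by (rule C1_on_compose_real[where T = "- {0}" and \<phi>' = "\<lambda>y. - (inverse y ^ Suc (Suc 0))"])
      (use assms DERIV_inverse in \<open>auto intro!: continuous_intros\<close>)
  from C1_on_mult[OF assms(1) this] show ?thesis by (simp add: divide_inverse)
qed

lemma C1_on_cong:
  assumes "C1_on S f" "open S" "\<And>x. x \<in> S \<Longrightarrow> f x = g x"
  shows "C1_on S g"
proof (rule C1_onI)
  show "(g has_derivative frechet_derivative f (at x)) (at x)" if "x \<in> S" for x
    using has_derivative_transform_within_open[OF C1_onD(1)[OF assms(1) that] assms(2) that] assms(3)
    by auto
qed (rule C1_onD(2)[OF assms(1)])

lemma C1_on_Un: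
  assumes "C1_on S f" "C1_on T f" "open S" "open T"
  shows "C1_on (S \<union> T) f"
  by (rule C1_onI[where f' = "\<lambda>x. frechet_derivative f (at x)"])
    (use assms in \<open>auto intro: C1_onD continuous_on_open_Un\<close>)

text \<open>\<open>S\<close> and the complement of \<open>C\<close> are open sets covering the whole
  space, and the extended function is continuously differentiable on each of them.\<close>

lemma C1_on_extend_zero:
  assumes "C1_on S f" "open S" "closed C" "C \<subseteq> S" "\<And>x. x \<in> S - C \<Longrightarrow> f x = 0"
  shows "C1_on UNIV (\<lambda>x. if x \<in> S then f x else 0)"
proof -
  have "C1_on (S \<union> - C) (\<lambda>x. if x \<in> S then f x else 0)"
  proof (rule C1_on_Un)
    show "C1_on S (\<lambda>x. if x \<in> S then f x else 0)"
      by (rule C1_on_cong[OF assms(1,2)]) auto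
    show "C1_on (- C) (\<lambda>x. if x \<in> S then f x else 0)"
      by (rule C1_on_cong[OF C1_on_const[of _ 0]]) (use assms in auto)
  qed (use assms in auto)
  moreover have "S \<union> - C = UNIV" using assms by auto
  ultimately show ?thesis by simp
qed

section \<open>Cut-off functions and integrals along measure-preserving flows\<close>

lemma obtain_smoothstep:
  obtains S S' :: "real \<Rightarrow> real" where
    "\<And>x. (S has_real_derivative S' x) (at x)" "continuous_on UNIV S'"
    "\<And>x. 0 \<le> S x" "\<And>x. S x \<le> 1" "\<And>x. 0 \<le> S' x"
    "\<And>x. x \<le> 0 \<Longrightarrow> S x = 0" "\<And>x. 1 \<le> x \<Longrightarrow> S x = 1"
    "\<And>x. 0 < x \<Longrightarrow> 0 < S x" "\<And>x. x \<le> 0 \<or> 1 \<le> x \<Longrightarrow> S' x = 0"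
proof -
  \<comment> \<open>The squared positive part has a continuous derivative and vanishes on the left
    half-line. The quotient \<open>q x / (q x + q (1 - x))\<close> is then a step; its denominator
    is positive because \<open>x\<close> and \<open>1 - x\<close> are never both
    nonpositive.\<close>
  define q :: "real \<Rightarrow> real" where "q x = (max 0 x)\<^sup>2" for x
  have dq: "(q has_real_derivative 2 * max 0 x) (at x)" for x
  proof (cases x "0::real" rule: linorder_cases)
    case less
    have "((\<lambda>x. 0) has_real_derivative 2 * max 0 x) (at x)" using less by simp
    then show ?thesis
      by (rule has_field_derivative_transform_within_open[where S = "{..<0}"])
        (use less in \<open>auto simp: q_def\<close>)
  next
    case greater
    have "((\<lambda>x. x\<^sup>2) has_real_derivative 2 * max 0 x) (at x)"
      using greater by (auto intro!: derivative_eq_intros)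
    then show ?thesis
      by (rule has_field_derivative_transform_within_open[where S = "{0<..}"])
        (use greater in \<open>auto simp: q_def\<close>)
  next
    case equal
    have "((\<lambda>h. (q (0 + h) - q 0) / h) \<longlongrightarrow> 0) (at 0)"
    proof (rule Lim_null_comparison)
      show "\<forall>\<^sub>F h in at 0. norm ((q (0 + h) - q 0) / h) \<le> \<bar>h\<bar>"
        by (intro always_eventually) (auto simp: q_def max_def power2_eq_square)
      show "((\<lambda>h::real. \<bar>h\<bar>) \<longlongrightarrow> 0) (at 0)" by (auto intro!: tendsto_eq_intros)
    qed
    then show ?thesis using equal by (simp add: DERIV_def)
  qed
  have pos: "q x + q (1 - x) > 0" for x
    by (cases "x > 0") (auto simp: q_def max_def intro: add_pos_nonneg)
  have q0: "q x \<ge> 0" for x by (simp add: q_def)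
  have qc: "continuous_on UNIV q"
    unfolding q_def by (intro continuous_intros)
  define S where "S x = q x / (q x + q (1 - x))" for x
  define S' where "S' x = (2 * max 0 x * q (1 - x) + q x * (2 * max 0 (1 - x))) / (q x + q (1 - x))\<^sup>2" for x
  show ?thesis
  proof (rule that[of S S'])
    show "(S has_real_derivative S' x) (at x)" for x
    proof -
      have "((\<lambda>x. q (1 - x)) has_real_derivative 2 * max 0 (1 - x) * (- 1)) (at x)"
        by (rule DERIV_chain2[OF dq]) (auto intro!: derivative_eq_intros)
      then have "(S has_real_derivative
          (2 * max 0 x * (q x + q (1 - x)) - q x * (2 * max 0 x + 2 * max 0 (1 - x) * (- 1)))
            / ((q x + q (1 - x)) * (q x + q (1 - x)))) (at x)"
        unfolding S_def using pos[of x]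
        by (intro DERIV_divide DERIV_add dq) auto
      then show ?thesis by (simp add: S'_def power2_eq_square algebra_simps)
    qed
    show "continuous_on UNIV S'"
      unfolding S'_def
      by (intro continuous_intros continuous_on_compose2[OF qc]) (use pos in \<open>auto simp: less_le\<close>)
    show "0 \<le> S x" "S x \<le> 1" "0 \<le> S' x" for x
      using q0[of x] q0[of "1 - x"] pos[of x] unfolding S_def S'_def
      by (auto simp: divide_simps)
    show "x \<le> 0 \<Longrightarrow> S x = 0" "1 \<le> x \<Longrightarrow> S x = 1" "0 < x \<Longrightarrow> 0 < S x" for x
      using pos[of x] by (auto simp: S_def q_def)
    show "x \<le> 0 \<or> 1 \<le> x \<Longrightarrow> S' x = 0" for x by (auto simp: S'_def q_def)
  qed
qed

lemma integrable_continuous_bounded_support: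
  fixes f :: "'a::euclidean_space \<Rightarrow> real"
  assumes "continuous_on UNIV f" "\<And>x. r < norm x \<Longrightarrow> f x = 0"
  shows "integrable lborel f"
proof -
  have "integrable lborel (\<lambda>x. indicator (cball 0 r) x *\<^sub>R f x)"
    by (intro borel_integrable_compact) (auto intro: continuous_on_subset[OF assms(1)])
  also have "(\<lambda>x. indicator (cball 0 r) x *\<^sub>R f x) = f"
    using assms(2) by (auto simp: fun_eq_iff indicator_def not_le)
  finally show ?thesis .
qed

lemma bounded_continuous_bounded_support:
  fixes f :: "'a::euclidean_space \<Rightarrow> real"
  assumes "continuous_on UNIV f" "\<And>x. r < norm x \<Longrightarrow> f x = 0"
  obtains M where "M > 0" "\<And>x. \<bar>f x\<bar> \<le> M"
proof -
  have "compact (f ` cball 0 r)"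
    by (intro compact_continuous_image continuous_on_subset[OF assms(1)]) auto
  then have "bounded (f ` cball 0 r)" by (rule compact_imp_bounded)
  then obtain M where M: "M > 0" "\<And>x. x \<in> cball 0 r \<Longrightarrow> \<bar>f x\<bar> \<le> M"
    unfolding bounded_pos by auto
  show ?thesis
    by (rule that[OF M(1)]) (metis M(1) M(2) abs_zero assms(2) less_eq_real_def linorder_not_less mem_cball_0)
qed

text \<open>
  The flow \<open>g \<mapsto> g + s X(g)\<close> preserves Lebesgue measure, so all difference quotients of \<open>\<phi>\<close> along it have integral \<open>0\<close>.
\<close>
lemma integral_derivative_along_flow:
  fixes X :: "'a::euclidean_space \<Rightarrow> 'a" and \<phi> D :: "'a \<Rightarrow> real"
  assumes X: "continuous_on UNIV X" and inv: "\<And>g s. X (g + s *\<^sub>R X g) = X g"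
    and pres: "\<And>s. distr lborel borel (\<lambda>g. g + s *\<^sub>R X g) = lborel"
    and \<phi>: "continuous_on UNIV \<phi>" and D: "continuous_on UNIV D"
    and der: "\<And>g. ((\<lambda>s. \<phi> (g + s *\<^sub>R X g)) has_real_derivative D g) (at 0)"
    and supp: "\<And>g. r < norm g \<Longrightarrow> \<phi> g = 0"
  shows "integrable lborel D" and "integral\<^sup>L lborel D = 0"
proof -
  define T where "T s g = g + s *\<^sub>R X g" for s g
  have Tc: "continuous_on UNIV (\<lambda>s. T s g)" "continuous_on UNIV (T s)" for s g
    unfolding T_def by (intro continuous_intros continuous_on_subset[OF X]; simp)+
  have derT: "((\<lambda>s. \<phi> (T s g)) has_real_derivative D (T s g)) (at s)" for s g
  proof -
    have "((\<lambda>h. \<phi> (T s g + h *\<^sub>R X (T s g))) has_real_derivative D (T s g)) (at 0)"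
      by (rule der)
    moreover have "T s g + h *\<^sub>R X (T s g) = T (h + s) g" for h
      unfolding T_def inv by (simp add: algebra_simps)
    ultimately have "((\<lambda>h. \<phi> (T (h + s) g)) has_real_derivative D (T s g)) (at 0)" by simp
    then show ?thesis using DERIV_shift[of "\<lambda>s. \<phi> (T s g)" "D (T s g)" 0 s] by simp
  qed
  \<comment> \<open>\<open>D g\<close> is the derivative at 0 of a function that vanishes near 0,
    since \<open>T s g\<close> stays outside the ball for small \<open>s\<close>.\<close>
  have D0: "D g = 0" if "r < norm g" for g
  proof -
    have "open ((\<lambda>s. norm (T s g)) -` {r<..})"
      by (rule open_vimage) (auto intro!: continuous_intros Tc)
    then have "((\<lambda>s. \<phi> (T s g)) has_real_derivative 0) (at 0)"
      by (rule has_field_derivative_transform_within_open[where f = "\<lambda>_. 0" and S = "(\<lambda>s. norm (T s g)) -` {r<..}", rotated])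
        (use that in \<open>auto simp: supp T_def\<close>)
    then show ?thesis using DERIV_unique[OF _ der[of g], of 0] unfolding T_def by simp
  qed
  show "integrable lborel D"
    using D D0 by (rule integrable_continuous_bounded_support)
  obtain M where M: "M > 0" "\<And>x. \<bar>D x\<bar> \<le> M"
    using bounded_continuous_bounded_support[OF D D0] by blast
  \<comment> \<open>\<open>X\<close> is constant along flow lines. A point that is inside the ball
    of radius \<open>r\<close> after a time of at most 1 has moved with speed at most
    \<open>N\<close>, so it started within \<open>r + N\<close> of the origin. This gives one
    bounded support for all difference quotients.\<close>
  have "compact (X ` cball 0 r)"
    by (intro compact_continuous_image continuous_on_subset[OF X]) auto
  then obtain N where N: "N > 0" "\<And>x. x \<in> cball 0 r \<Longrightarrow> norm (X x) \<le> N"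
    unfolding bounded_pos by (metis bounded_pos compact_imp_bounded image_eqI)
  define a :: "nat \<Rightarrow> real" where "a k = 1 / real (Suc k)" for k
  have a: "0 < a k" "a k \<le> 1" for k by (auto simp: a_def)
  have a0: "a \<longlonglongrightarrow> 0" unfolding a_def by (rule LIMSEQ_Suc[OF lim_1_over_n])
  define d where "d k g = (\<phi> (T (a k) g) - \<phi> g) / a k" for k g
  have dc: "continuous_on UNIV (d k)" for k
    unfolding d_def
    by (intro continuous_intros continuous_on_compose2[OF \<phi>] Tc)
      (use a[of k] in \<open>auto intro: continuous_on_compose2[OF \<phi>] Tc(2)\<close>)
  have dlim: "(\<lambda>k. d k g) \<longlonglongrightarrow> D g" for g
  proof -
    have "((\<lambda>h. (\<phi> (T (0 + h) g) - \<phi> (T 0 g)) / h) \<longlongrightarrow> D g) (at 0)"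
      using derT[of g 0] unfolding DERIV_def by (simp add: T_def)
    moreover have "filterlim a (at 0) sequentially"
      unfolding filterlim_at using a0 a by (auto intro!: always_eventually simp: less_imp_neq[symmetric])
    ultimately have "((\<lambda>k. (\<phi> (T (0 + a k) g) - \<phi> (T 0 g)) / a k) \<longlongrightarrow> D g) sequentially"
      by (rule filterlim_compose)
    then show ?thesis by (simp add: d_def T_def)
  qed
  \<comment> \<open>The mean value theorem along the flow line gives a bound that does not depend on
    \<open>k\<close>, as dominated convergence requires.\<close>
  have dM: "\<bar>d k g\<bar> \<le> M" for k g
  proof -
    have "\<exists>z>0. z < a k \<and> \<phi> (T (a k) g) - \<phi> (T 0 g) = (a k - 0) * D (T z g)"
      by (rule MVT2) (use a derT in auto)
    then obtain z where "\<phi> (T (a k) g) - \<phi> g = a k * D (T z g)"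
      by (auto simp: T_def)
    then have "d k g = D (T z g)" using a(1)[of k] by (simp add: d_def)
    then show ?thesis using M by simp
  qed
  have d0: "d k g = 0" if g: "r + N < norm g" for k g
  proof -
    have "norm (T (a k) g) > r"
    proof (rule ccontr)
      assume *: "\<not> norm (T (a k) g) > r"
      then have "norm (X (T (a k) g)) \<le> N" using N by auto
      moreover have "X (T (a k) g) = X g" by (simp add: T_def inv)
      ultimately have "norm (a k *\<^sub>R X g) \<le> N"
        using a[of k] by (simp add: mult_le_one order.trans[OF mult_left_le_one_le])
      moreover have "norm g \<le> norm (T (a k) g) + norm (a k *\<^sub>R X g)"
        unfolding T_def by (metis add_diff_cancel_right' norm_triangle_ineq4)
      ultimately show False using * g by linarith
    qed
    then show ?thesis using g N by (simp add: d_def supp)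
  qed
  have "(\<lambda>k. integral\<^sup>L lborel (d k)) \<longlonglongrightarrow> integral\<^sup>L lborel D"
  proof (rule integral_dominated_convergence[where w = "\<lambda>x. M * indicator (cball 0 (r + N)) x"])
    show "integrable lborel (\<lambda>x::'a. M * indicator (cball 0 (r + N)) x)"
      by (intro integrable_mult_right) (use emeasure_lborel_cball_finite in \<open>auto simp: integrable_indicator_iff infinity_ennreal_def[symmetric] simp del: infinity_ennreal_def\<close>)
    show "AE x in lborel. (\<lambda>k. d k x) \<longlonglongrightarrow> D x" using dlim by auto
    show "AE x in lborel. norm (d k x) \<le> M * indicator (cball 0 (r + N)) x" for k
      using dM d0 by (intro AE_I2) (auto simp: indicator_def not_le)
    show "D \<in> borel_measurable lborel" "d k \<in> borel_measurable lborel" for k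
      using D dc[of k] by (auto intro: borel_measurable_continuous_onI)
  qed
  moreover have "integral\<^sup>L lborel (d k) = 0" for k
  proof -
    have [measurable]: "\<phi> \<in> borel_measurable borel" "T (a k) \<in> borel_measurable borel"
      using \<phi> Tc by (auto intro: borel_measurable_continuous_onI)
    have i1: "integrable lborel \<phi>"
      by (rule integrable_continuous_bounded_support[OF \<phi> supp])
    have pr: "distr lborel borel (T (a k)) = lborel" using pres[of "a k"] by (simp add: T_def[abs_def])
    have i2: "integrable lborel (\<lambda>g. \<phi> (T (a k) g))"
      using i1 by (subst (asm) pr[symmetric]) (subst (asm) integrable_distr_eq; simp)
    have "integral\<^sup>L lborel (\<lambda>g. \<phi> (T (a k) g)) = integral\<^sup>L (distr lborel borel (T (a k))) \<phi>"
      by (subst integral_distr) auto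
    then have "integral\<^sup>L lborel (\<lambda>g. \<phi> (T (a k) g) - \<phi> g) = 0"
      using i1 i2 pr by simp
    then show ?thesis unfolding d_def by simp
  qed
  ultimately show "integral\<^sup>L lborel D = 0"
    using LIMSEQ_unique[of "\<lambda>k. integral\<^sup>L lborel (d k)" 0 "integral\<^sup>L lborel D"] by simp
qed

section \<open>The divergence theorem for compactly supported fields\<close>

definition divergence :: "('a::euclidean_space \<Rightarrow> 'a) \<Rightarrow> 'a \<Rightarrow> real" where
  "divergence f x = (\<Sum>b\<in>Basis. frechet_derivative f (at x) b \<bullet> b)"

lemma continuous_on_divergence: "C1_on S f \<Longrightarrow> continuous_on S (divergence f)"
  unfolding divergence_def by (intro continuous_intros C1_onD(2))

lemma divergence_eqI:
  "(f has_derivative f') (at x) \<Longrightarrow> divergence f x = (\<Sum>b\<in>Basis. f' b \<bullet> b)"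
  unfolding divergence_def using frechet_derivative_at by metis

lemma divergence_cong:
  assumes "open S" "x \<in> S" "\<And>y. y \<in> S \<Longrightarrow> f y = g y"
  shows "divergence f x = divergence g x"
proof -
  have "(f has_derivative f') (at x) \<longleftrightarrow> (g has_derivative f') (at x)" for f'
    using has_derivative_transform_within_open[of f f' x UNIV S g]
      has_derivative_transform_within_open[of g f' x UNIV S f] assms by auto
  then show ?thesis unfolding divergence_def frechet_derivative_def by simp
qed

lemma divergence_eq_0:
  assumes "open S" "x \<in> S" "\<And>y. y \<in> S \<Longrightarrow> f y = 0"
  shows "divergence f x = 0"
proof -
  have "(f has_derivative (\<lambda>_. 0)) (at x)"
    by (rule has_derivative_transform_within_open[of "\<lambda>_. 0" _ _ _ S]) (use assms in auto)
  then show ?thesis by (simp add: divergence_eqI)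
qed

text \<open>Each summand of the divergence is the derivative along a constant field
  \<open>b\<close>, whose flow consists of translations, so
  \<open>integral_derivative_along_flow\<close> applies.\<close>

lemma integral_divergence:
  fixes f :: "'a::euclidean_space \<Rightarrow> 'a"
  assumes f: "C1_on UNIV f" and supp: "\<And>x. r < norm x \<Longrightarrow> f x = 0"
  shows "integrable lborel (divergence f)" and "integral\<^sup>L lborel (divergence f) = 0"
proof -
  have *: "integrable lborel (\<lambda>x. frechet_derivative f (at x) b \<bullet> b)
      \<and> (\<integral>x. frechet_derivative f (at x) b \<bullet> b \<partial>lborel) = 0" for b
  proof -
    have 1: "distr lborel borel (\<lambda>g. g + s *\<^sub>R b) = lborel" for s
      using lborel_distr_plus[of "s *\<^sub>R b"] by (metis (no_types, lifting) add.commute distr_cong)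
    have 2: "continuous_on UNIV (\<lambda>x. f x \<bullet> b)"
      by (intro continuous_intros C1_on_imp_continuous_on f)
    have 3: "continuous_on UNIV (\<lambda>x. frechet_derivative f (at x) b \<bullet> b)"
      by (intro continuous_intros C1_onD(2)[OF f])
    have 4: "((\<lambda>s. f (g + s *\<^sub>R b) \<bullet> b) has_real_derivative frechet_derivative f (at g) b \<bullet> b) (at 0)" for g
    proof -
      have L: "linear (frechet_derivative f (at g))"
        using C1_onD(1)[OF f] has_derivative_linear by blast
      have "((\<lambda>s. g + s *\<^sub>R b) has_derivative (\<lambda>s. s *\<^sub>R b)) (at 0)"
        by (auto intro!: derivative_eq_intros)
      then have "((\<lambda>s. f (g + s *\<^sub>R b)) has_derivative (\<lambda>s. frechet_derivative f (at g) (s *\<^sub>R b))) (at 0)"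
        by (rule has_derivative_compose) (use C1_onD(1)[OF f, of g] in simp)
      then have "((\<lambda>s. f (g + s *\<^sub>R b) \<bullet> b) has_derivative (\<lambda>s. frechet_derivative f (at g) (s *\<^sub>R b) \<bullet> b)) (at 0)"
        by (rule has_derivative_inner_left)
      then show ?thesis
        unfolding has_field_derivative_def
        by (rule has_derivative_eq_rhs) (auto simp: linear_cmul[OF L] mult.commute)
    qed
    have 5: "f g \<bullet> b = 0" if "r < norm g" for g using supp[OF that] by simp
    show ?thesis
      using integral_derivative_along_flow[where X = "\<lambda>_. b", OF _ refl 1 2 3 4 5] by simp
  qed
  show "integrable lborel (divergence f)" unfolding divergence_def using * by auto
  show "integral\<^sup>L lborel (divergence f) = 0" unfolding divergence_def using * by (simp add: Bochner_Integration.integral_sum)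
qed

section \<open>The flux of a horizontal field through a graph\<close>

lemma integrable_ball_compact_support:
  fixes g :: "'a::euclidean_space \<Rightarrow> real"
  assumes g: "continuous_on (ball 0 1) g" and r: "r < 1" and supp: "\<And>z. r < norm z \<Longrightarrow> norm z < 1 \<Longrightarrow> g z = 0"
  shows "integrable lborel (\<lambda>z. indicator (ball 0 1) z * g z)"
proof (rule integrable_continuous_bounded_support[of _ r])
  show "indicator (ball 0 1) z * g z = 0" if "r < norm z" for z
    using supp[OF that] by (auto simp: indicator_def)
  have "continuous_on (ball 0 1 \<union> - cball 0 r) (\<lambda>z. indicator (ball 0 1) z * g z)"
  proof (rule continuous_on_open_Un)
    show "continuous_on (ball 0 1) (\<lambda>z. indicator (ball 0 1) z * g z)"
      by (rule continuous_on_eq[OF g]) auto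
    show "continuous_on (- cball 0 r) (\<lambda>z. indicator (ball 0 1) z * g z)"
      by (rule continuous_on_eq[OF continuous_on_const[of _ 0]]) (use supp in \<open>auto simp: indicator_def\<close>)
  qed auto
  moreover have "ball 0 1 \<union> - cball 0 r = (UNIV :: 'a set)" using r by auto
  ultimately show "continuous_on UNIV (\<lambda>z. indicator (ball 0 1) z * g z)" by simp
qed

text \<open>Competitors that do not depend on the vertical variable. Their support keeps a positive
  distance from the unit sphere, so that the gradient of a graph function is never integrated up to
  the sphere, where it may blow up.\<close>

definition unit_field :: "('a::euclidean_space \<Rightarrow> 'a) \<Rightarrow> bool" where
  "unit_field f \<longleftrightarrow> C1_on UNIV f \<and> (\<exists>r<1. \<forall>z. r < norm z \<longrightarrow> f z = 0) \<and> (\<forall>z. norm (f z) \<le> 1)"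

text \<open>Both halves of a domain are handled by one argument: the reflection of the vertical axis
  exchanges the lower and the upper graph and replaces \<open>J\<close> by its negative, which is a
  complex structure as well.\<close>

locale complex_structure =
  fixes J :: "'a::euclidean_space \<Rightarrow> 'a"
  assumes linear_J: "linear J" and J_orth: "J z \<bullet> z = 0" and J_J: "J (J z) = - z"
begin

lemma J_add: "J (x + y) = J x + J y" and J_scaleR: "J (c *\<^sub>R x) = c *\<^sub>R J x"
  using linear_J by (auto simp: linear_add linear_cmul)

lemma bounded_linear_J: "bounded_linear J"
  using linear_J by (simp add: linear_conv_bounded_linear)

lemma J_orth': "z \<bullet> J z = 0" using J_orth[of z] by (simp add: inner_commute)

lemma J_skew: "J x \<bullet> y = - (x \<bullet> J y)"
proof -
  have "J (x + y) \<bullet> (x + y) = 0" by (rule J_orth)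
  then show ?thesis using J_orth'[of x] J_orth'[of y] by (simp add: J_add inner_add_left inner_add_right inner_commute)
qed

lemma J_inner: "J x \<bullet> J y = x \<bullet> y"
  by (simp add: J_skew[of x "J y"] J_J)

lemma norm_J: "norm (J x) = norm x"
  by (simp add: norm_eq_sqrt_inner J_inner)

lemma norm_combination: "norm (a *\<^sub>R z + b *\<^sub>R J z) = sqrt (a\<^sup>2 + b\<^sup>2) * norm z"
proof -
  have "(a *\<^sub>R z + b *\<^sub>R J z) \<bullet> (a *\<^sub>R z + b *\<^sub>R J z) = (a\<^sup>2 + b\<^sup>2) * (z \<bullet> z)"
    by (simp add: inner_add_left inner_add_right J_orth J_orth' J_inner power2_eq_square algebra_simps)
  then show ?thesis by (simp add: norm_eq_sqrt_inner real_sqrt_mult)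
qed

text \<open>The rotational part contributes nothing: \<open>J b\<close> is orthogonal to
  \<open>b\<close> for every basis vector, and the gradient of the radial coefficient points along
  \<open>z\<close>, which is orthogonal to \<open>J z\<close>. This is why \<kappa> is absent from
  the result.\<close>

lemma divergence_radial:
  fixes \<alpha> \<kappa> :: "real \<Rightarrow> real"
  assumes \<alpha>: "(\<alpha> has_real_derivative \<alpha>') (at (z \<bullet> z))" and \<kappa>: "(\<kappa> has_real_derivative \<kappa>') (at (z \<bullet> z))"
  shows "divergence (\<lambda>z. \<alpha> (z \<bullet> z) *\<^sub>R z + \<kappa> (z \<bullet> z) *\<^sub>R J z) z
    = DIM('a) * \<alpha> (z \<bullet> z) + 2 * \<alpha>' * (z \<bullet> z)"
proof -
  have q: "((\<lambda>z. z \<bullet> z) has_derivative (\<lambda>h. 2 * (z \<bullet> h))) (at z)"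
    by (auto intro!: derivative_eq_intros simp: inner_commute)
  have \<alpha>q: "((\<lambda>z. \<alpha> (z \<bullet> z)) has_derivative (\<lambda>h. \<alpha>' * (2 * (z \<bullet> h)))) (at z)"
    using has_derivative_compose[OF q \<alpha>[unfolded has_field_derivative_def]] by simp
  have \<kappa>q: "((\<lambda>z. \<kappa> (z \<bullet> z)) has_derivative (\<lambda>h. \<kappa>' * (2 * (z \<bullet> h)))) (at z)"
    using has_derivative_compose[OF q \<kappa>[unfolded has_field_derivative_def]] by simp
  have "((\<lambda>z. \<alpha> (z \<bullet> z) *\<^sub>R z + \<kappa> (z \<bullet> z) *\<^sub>R J z) has_derivative
      (\<lambda>h. (\<alpha> (z \<bullet> z) *\<^sub>R h + (\<alpha>' * (2 * (z \<bullet> h))) *\<^sub>R z)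
         + (\<kappa> (z \<bullet> z) *\<^sub>R J h + (\<kappa>' * (2 * (z \<bullet> h))) *\<^sub>R J z))) (at z)"
    by (intro has_derivative_add has_derivative_scaleR \<alpha>q \<kappa>q has_derivative_ident
        bounded_linear_imp_has_derivative bounded_linear_J)
  then have "divergence (\<lambda>z. \<alpha> (z \<bullet> z) *\<^sub>R z + \<kappa> (z \<bullet> z) *\<^sub>R J z) z
    = (\<Sum>b\<in>Basis. ((\<alpha> (z \<bullet> z) *\<^sub>R b + (\<alpha>' * (2 * (z \<bullet> b))) *\<^sub>R z)
         + (\<kappa> (z \<bullet> z) *\<^sub>R J b + (\<kappa>' * (2 * (z \<bullet> b))) *\<^sub>R J z)) \<bullet> b)"
    by (rule divergence_eqI)
  also have "\<dots> = (\<Sum>b\<in>Basis. \<alpha> (z \<bullet> z) + 2 * \<alpha>' * ((z \<bullet> b) * (z \<bullet> b)) + 2 * \<kappa>' * ((z \<bullet> b) * (J z \<bullet> b)))"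
    by (intro sum.cong) (simp_all add: inner_add_left J_orth algebra_simps)
  also have "\<dots> = DIM('a) * \<alpha> (z \<bullet> z) + 2 * \<alpha>' * (z \<bullet> z) + 2 * \<kappa>' * (z \<bullet> J z)"
    unfolding sum.distrib sum_distrib_left[symmetric]
    by (subst (2 3) euclidean_inner) simp
  finally show ?thesis by (simp add: J_orth')
qed

end

locale graph_over_ball = complex_structure J for J :: "'a::euclidean_space \<Rightarrow> 'a" +
  fixes u :: "'a \<Rightarrow> real"
  assumes u_C1: "C1_on (ball 0 1) u" and u_cont: "continuous_on (cball 0 1) u"
    and u_boundary: "norm z = 1 \<Longrightarrow> u z = 0"
begin

text \<open>Pairing with the (not normalised) horizontal normal \<open>J z / 2 - \<nabla>u(z)\<close> of the graph of \<open>u\<close>.\<close>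
definition \<omega> :: "'a \<Rightarrow> 'a \<Rightarrow> real" where
  "\<omega> z h = J z \<bullet> h / 2 - frechet_derivative u (at z) h"

definition flux :: "('a \<Rightarrow> 'a) \<Rightarrow> real" where
  "flux f = (\<integral>z. indicator (ball 0 1) z * \<omega> z (f z) \<partial>lborel)"

lemma linear_\<omega>: "norm z < 1 \<Longrightarrow> linear (\<omega> z)"
proof -
  assume "norm z < 1"
  then have "linear (frechet_derivative u (at z))"
    using C1_onD(1)[OF u_C1, of z] has_derivative_linear by auto
  then show ?thesis unfolding \<omega>_def
    by (auto intro!: linearI simp: linear_add linear_cmul inner_add_right algebra_simps add_divide_distrib)
qed

lemma continuous_on_\<omega>:
  assumes "continuous_on S h" "S \<subseteq> ball 0 1"
  shows "continuous_on S (\<lambda>z. \<omega> z (h z))"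
  unfolding \<omega>_def
  by (intro continuous_intros C1_on_continuous_derivative C1_on_subset[OF u_C1] assms
      linear_continuous_on bounded_linear_J) simp

lemma \<omega>_bound: "norm z < 1 \<Longrightarrow> \<bar>\<omega> z h\<bar> \<le> (\<Sum>b\<in>Basis. \<bar>\<omega> z b\<bar>) * norm h"
proof -
  assume z: "norm z < 1"
  have "\<omega> z h = \<omega> z (\<Sum>b\<in>Basis. (h \<bullet> b) *\<^sub>R b)" by (simp add: euclidean_representation)
  also have "\<dots> = (\<Sum>b\<in>Basis. (h \<bullet> b) * \<omega> z b)"
    by (simp add: linear_sum[OF linear_\<omega>[OF z]] linear_cmul[OF linear_\<omega>[OF z]])
  also have "\<bar>\<dots>\<bar> \<le> (\<Sum>b\<in>Basis. norm h * \<bar>\<omega> z b\<bar>)"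
    by (rule order.trans[OF sum_abs sum_mono])
      (auto simp: abs_mult intro!: mult_right_mono Basis_le_norm)
  finally show ?thesis by (simp add: sum_distrib_left mult.commute)
qed

lemma integrable_\<omega>:
  assumes "C1_on UNIV f" "r < 1" "\<And>z. r < norm z \<Longrightarrow> f z = 0"
  shows "integrable lborel (\<lambda>z. indicator (ball 0 1) z * \<omega> z (f z))"
proof (rule integrable_ball_compact_support[OF _ assms(2)])
  show "continuous_on (ball 0 1) (\<lambda>z. \<omega> z (f z))"
    by (intro continuous_on_\<omega> continuous_on_subset[OF C1_on_imp_continuous_on[OF assms(1)]]) auto
  show "\<omega> z (f z) = 0" if "r < norm z" "norm z < 1" for z
    using assms(3)[OF that(1)] linear_0[OF linear_\<omega>[OF that(2)]] by simp
qed

lemma integrable_flux_divergence: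
  assumes f: "C1_on UNIV f" and r: "r < 1" and supp: "\<And>z. r < norm z \<Longrightarrow> f z = 0"
  shows "integrable lborel (\<lambda>z. indicator (ball 0 1) z * (J z \<bullet> f z / 2 + u z * divergence f z))"
proof (rule integrable_ball_compact_support[OF _ r])
  show "continuous_on (ball 0 1) (\<lambda>z. J z \<bullet> f z / 2 + u z * divergence f z)"
    by (intro continuous_intros linear_continuous_on bounded_linear_J C1_on_imp_continuous_on[OF u_C1]
        continuous_on_subset[OF C1_on_imp_continuous_on[OF f]]
        continuous_on_subset[OF continuous_on_divergence[OF f]]) auto
  show "J z \<bullet> f z / 2 + u z * divergence f z = 0" if "r < norm z" for z
    using supp[OF that] divergence_eq_0[of "- cball 0 r" z f] supp that by auto
qed

text \<open>The product of \<open>u\<close> and \<open>f\<close>, extended by zero, has a divergence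
  of integral zero. Adding it trades the derivative of \<open>u\<close> for values of
  \<open>u\<close>, which remain controlled up to the sphere.\<close>

lemma flux_eq_divergence:
  assumes f: "C1_on UNIV f" and r: "r < 1" and supp: "\<And>z. r < norm z \<Longrightarrow> f z = 0"
  shows "flux f = (\<integral>z. indicator (ball 0 1) z * (J z \<bullet> f z / 2 + u z * divergence f z) \<partial>lborel)"
proof -
  define H where "H z = (if z \<in> ball 0 1 then u z *\<^sub>R f z else 0)" for z
  have H: "C1_on UNIV H"
    unfolding H_def
    by (rule C1_on_extend_zero[where C = "cball 0 r"])
      (use r supp in \<open>auto intro!: C1_on_scaleR u_C1 C1_on_subset[OF f]\<close>)
  have H0: "H z = 0" if "r < norm z" for z using supp[OF that] by (simp add: H_def)
  have div: "divergence H z = indicator (ball 0 1) z * (frechet_derivative u (at z) (f z) + u z * divergence f z)" for z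
  proof (cases "norm z < 1")
    case True
    have L: "linear (frechet_derivative u (at z))"
      using C1_onD(1)[OF u_C1, of z] True has_derivative_linear by auto
    have "((\<lambda>z. u z *\<^sub>R f z) has_derivative (\<lambda>h. u z *\<^sub>R frechet_derivative f (at z) h
        + frechet_derivative u (at z) h *\<^sub>R f z)) (at z)"
      by (intro has_derivative_scaleR C1_onD(1)[OF u_C1] C1_onD(1)[OF f]) (use True in auto)
    then have "(H has_derivative (\<lambda>h. u z *\<^sub>R frechet_derivative f (at z) h
        + frechet_derivative u (at z) h *\<^sub>R f z)) (at z)"
      by (rule has_derivative_transform_within_open[of _ _ _ _ "ball 0 1"]) (use True in \<open>auto simp: H_def\<close>)
    then have "divergence H z = (\<Sum>b\<in>Basis. (u z *\<^sub>R frechet_derivative f (at z) b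
        + frechet_derivative u (at z) b *\<^sub>R f z) \<bullet> b)"
      by (rule divergence_eqI)
    also have "\<dots> = u z * divergence f z + (\<Sum>b\<in>Basis. (f z \<bullet> b) * frechet_derivative u (at z) b)"
      by (simp add: inner_add_left sum.distrib divergence_def sum_distrib_left mult.commute)
    also have "(\<Sum>b\<in>Basis. (f z \<bullet> b) * frechet_derivative u (at z) b) = frechet_derivative u (at z) (\<Sum>b\<in>Basis. (f z \<bullet> b) *\<^sub>R b)"
      by (simp add: linear_sum[OF L] linear_cmul[OF L])
    finally show ?thesis using True by (simp add: euclidean_representation)
  next
    case False
    have "divergence H z = 0"
      by (rule divergence_eq_0[of "- cball 0 r"]) (use False r H0 in auto)
    with False show ?thesis by simp
  qed
  have "(\<integral>z. indicator (ball 0 1) z * \<omega> z (f z) + divergence H z \<partial>lborel) = flux f + 0"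
    unfolding flux_def
    by (subst Bochner_Integration.integral_add[OF integrable_\<omega>[OF f r supp] integral_divergence(1)[OF H H0]])
      (auto simp: integral_divergence(2)[OF H H0])
  moreover have "indicator (ball 0 1) z * \<omega> z (f z) + divergence H z
      = indicator (ball 0 1) z * (J z \<bullet> f z / 2 + u z * divergence f z)" for z
    unfolding div \<omega>_def by (simp add: indicator_def)
  ultimately show ?thesis by simp
qed

end

section \<open>The calibration\<close>

context complex_structure
begin

text \<open>The horizontal unit normal of the bubble; \<open>\<nu> 0 = 0\<close> because of \<open>x / 0 = 0\<close>.\<close>
definition \<nu> :: "'a \<Rightarrow> 'a" where
  "\<nu> z = z + (sqrt (1 - (norm z)\<^sup>2) / norm z) *\<^sub>R J z"

end

context graph_over_ball
begin

text \<open>The formal flux of \<nu> in divergence form: the divergence of \<nu> is the dimension,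
  and \<open>J z \<bullet> \<nu> z\<close> equals |z| sqrt (1 - |z|^2).\<close>

definition bubble_flux :: real where
  "bubble_flux = DIM('a) * (\<integral>z. indicator (ball 0 1) z * u z \<partial>lborel)
     + (\<integral>z. indicator (ball 0 1) z * (norm z * sqrt (1 - (norm z)\<^sup>2)) \<partial>lborel :: 'a measure) / 2"

text \<open>
  The boundary layer of the cut-off is harmless: by the divergence theorem the radial weight that it carries
  is bounded, and \<open>u\<close> tends to \<open>0\<close> there. No cut-off of \<open>z\<close> is needed at the origin, since the singular part of
  \<open>\<nu>\<close> is divergence free for every radial coefficient.
\<close>
lemma obtain_calibration_sequence:
  obtains f where "\<And>k::nat. unit_field (f k)" "\<And>z. norm z < 1 \<Longrightarrow> (\<lambda>k. f k z) \<longlonglongrightarrow> \<nu> z"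
    "(\<lambda>k. flux (f k)) \<longlonglongrightarrow> bubble_flux"
proof -
  obtain S S' where S: "\<And>x. (S has_real_derivative S' x) (at x)" "continuous_on UNIV S'"
    "\<And>x. 0 \<le> S x" "\<And>x. S x \<le> 1" "\<And>x. 0 \<le> S' x"
    "\<And>x. x \<le> 0 \<Longrightarrow> S x = 0" "\<And>x. 1 \<le> x \<Longrightarrow> S x = 1"
    and S'0: "\<And>x. x \<le> 0 \<or> 1 \<le> x \<Longrightarrow> S' x = 0"
    using obtain_smoothstep by metis
  define c where "c k = real k + 2" for k :: nat
  \<comment> \<open>The argument \<open>x\<close> stands for |z|^2. The cut-off is 1 for
    \<open>x \<le> 1 - 2 / c k\<close> and 0 for \<open>x \<ge> 1 - 1 / c k\<close>; the layer in
    between shrinks to the sphere.\<close>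
  define \<alpha> where "\<alpha> k x = S (c k * (1 - x) - 1)" for k x
  define \<alpha>' where "\<alpha>' k x = - (c k * S' (c k * (1 - x) - 1))" for k x
  \<comment> \<open>The summand \<open>1 / c k\<close> under the root removes the singularity at the
    origin and only lowers the coefficient of \<open>J z\<close>, so the norm of the field stays at
    most 1.\<close>
  define \<kappa> where "\<kappa> k x = \<alpha> k x * (sqrt (1 - x) / sqrt (x + 1 / c k))" for k x
  define f where "f k z = (if z \<in> ball 0 1 then \<alpha> k (z \<bullet> z) *\<^sub>R z + \<kappa> k (z \<bullet> z) *\<^sub>R J z else 0)" for k z
  define \<rho> where "\<rho> k = sqrt (1 - 1 / c k)" for k
  have c: "c k \<ge> 2" "c k > 0" for k by (auto simp: c_def)
  have c_top: "filterlim c at_top sequentially" unfolding c_def by real_asymp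
  have d\<alpha>: "(\<alpha> k has_real_derivative \<alpha>' k x) (at x)" for k x
    unfolding \<alpha>_def \<alpha>'_def
    by (rule DERIV_cong[OF DERIV_chain2[OF S(1)]]) (auto intro!: derivative_eq_intros)
  have \<alpha>'c: "continuous_on T (\<alpha>' k)" for k T
    unfolding \<alpha>'_def by (intro continuous_intros continuous_on_compose2[OF S(2)]) auto
  have \<alpha>c: "continuous_on T (\<alpha> k)" for k T
    by (rule DERIV_continuous_on[OF has_field_derivative_at_within[OF d\<alpha>]])
  have \<alpha>01: "0 \<le> \<alpha> k x" "\<alpha> k x \<le> 1" for k x using S by (auto simp: \<alpha>_def)
  have \<alpha>0: "\<alpha> k x = 0" if "1 - 1 / c k \<le> x" for k x
  proof -
    have "c k * (1 - x) \<le> c k * (1 / c k)" by (intro mult_left_mono) (use that c[of k] in auto)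
    then show ?thesis using c[of k] by (auto simp: \<alpha>_def intro!: S(6))
  qed
  have \<alpha>1: "(\<lambda>k. \<alpha> k x) \<longlonglongrightarrow> 1" if "x < 1" for x
  proof -
    have "filterlim (\<lambda>k. c k * (1 - x)) at_top sequentially"
      by (rule filterlim_at_top_mult_tendsto_pos[OF tendsto_const _ c_top, where c = "1 - x", simplified mult.commute[of _ "c _"]])
        (use that in auto)
    then have "\<forall>\<^sub>F k in sequentially. c k * (1 - x) \<ge> 2" by (rule filterlim_at_top[THEN iffD1, rule_format])
    then have "\<forall>\<^sub>F k in sequentially. \<alpha> k x = 1" by eventually_elim (auto simp: \<alpha>_def intro!: S(7))
    then show ?thesis by (rule tendsto_eventually)
  qed
  have \<rho>: "0 \<le> \<rho> k" "\<rho> k < 1" "(\<rho> k)\<^sup>2 = 1 - 1 / c k" for k using c[of k] by (auto simp: \<rho>_def)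
  have \<rho>_less: "1 - 1 / c k \<le> z \<bullet> z" if "\<rho> k < norm z" for k and z :: 'a
    using power_mono[of "\<rho> k" "norm z" 2] that \<rho>[of k] by (simp add: power2_norm_eq_inner)
  have zz: "z \<bullet> z < 1 \<longleftrightarrow> norm z < 1" for z :: 'a
    by (simp add: power2_norm_eq_inner[symmetric] abs_square_less_1)
  have qC: "C1_on T (\<lambda>z::'a. z \<bullet> z)" for T
    by (intro C1_on_inner C1_on_bounded_linear bounded_linear_ident)
  have d\<kappa>: "\<exists>\<kappa>'. (\<forall>x\<in>{0..<1}. (\<kappa> k has_real_derivative \<kappa>' x) (at x)) \<and> continuous_on {0..<1} \<kappa>'" for k
  proof -
    let ?d = "\<lambda>x. \<alpha>' k x * (sqrt (1 - x) / sqrt (x + 1 / c k)) +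
       ((- (inverse (sqrt (1 - x)) / 2) * sqrt (x + 1 / c k)
          - sqrt (1 - x) * (inverse (sqrt (x + 1 / c k)) / 2)) / (sqrt (x + 1 / c k) * sqrt (x + 1 / c k))) * \<alpha> k x"
    have pos: "x + 1 / c k > 0" if "0 \<le> x" for x using that c[of k] by (simp add: add_nonneg_pos)
    have "(\<kappa> k has_real_derivative ?d x) (at x)" if "x \<in> {0..<1}" for x
    proof -
      have "((\<lambda>x. sqrt (1 - x)) has_real_derivative - (inverse (sqrt (1 - x)) / 2)) (at x)"
        using that by (auto intro!: derivative_eq_intros)
      moreover have "((\<lambda>x. sqrt (x + 1 / c k)) has_real_derivative inverse (sqrt (x + 1 / c k)) / 2) (at x)"
        using that pos[of x] by (auto intro!: derivative_eq_intros)
      ultimately show ?thesis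
        unfolding \<kappa>_def by (intro DERIV_mult[OF d\<alpha> DERIV_divide]) (use pos[of x] that in auto)
    qed
    moreover have "continuous_on {0..<1} ?d"
      by (intro continuous_intros \<alpha>'c \<alpha>c) (use less_imp_neq[OF pos] in \<open>auto dest: sym\<close>)
    ultimately show ?thesis by (intro exI[of _ ?d] conjI ballI)
  qed
  have fC: "C1_on UNIV (f k)" for k
    unfolding f_def
  proof (rule C1_on_extend_zero[where C = "cball 0 (\<rho> k)"])
    obtain \<kappa>' where \<kappa>': "\<And>x. x \<in> {0..<1} \<Longrightarrow> (\<kappa> k has_real_derivative \<kappa>' x) (at x)" "continuous_on {0..<1} \<kappa>'"
      using d\<kappa>[of k] by blast
    show "C1_on (ball 0 1) (\<lambda>z. \<alpha> k (z \<bullet> z) *\<^sub>R z + \<kappa> k (z \<bullet> z) *\<^sub>R J z)"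
      by (intro C1_on_add C1_on_scaleR C1_on_bounded_linear bounded_linear_J bounded_linear_ident
          C1_on_compose_real[OF qC d\<alpha> \<alpha>'c, where T = UNIV] C1_on_compose_real[OF qC \<kappa>'])
        (auto simp: zz)
    show "\<alpha> k (z \<bullet> z) *\<^sub>R z + \<kappa> k (z \<bullet> z) *\<^sub>R J z = 0" if "z \<in> ball 0 1 - cball 0 (\<rho> k)" for z
      using \<alpha>0[OF \<rho>_less[of k z]] that by (simp add: \<kappa>_def)
  qed (use \<rho>(2)[of k] in auto)
  have f0: "f k z = 0" if "\<rho> k < norm z" for k z
    using \<alpha>0[OF \<rho>_less[OF that]] by (simp add: f_def \<kappa>_def)
  have \<kappa>_bound: "\<kappa> k x * sqrt x \<le> sqrt (1 - x)" "0 \<le> \<kappa> k x" if "0 \<le> x" "x < 1" for k x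
  proof -
    have "sqrt x \<le> sqrt (x + 1 / c k)" "sqrt (x + 1 / c k) > 0"
      using c[of k] that by (auto simp: add_nonneg_pos)
    then have "sqrt x / sqrt (x + 1 / c k) \<le> 1" "0 \<le> sqrt x / sqrt (x + 1 / c k)"
      using that by (simp, intro divide_nonneg_pos) auto
    then have *: "\<alpha> k x * (sqrt x / sqrt (x + 1 / c k)) \<le> 1"
      by (intro mult_le_one \<alpha>01)
    have "\<kappa> k x * sqrt x = sqrt (1 - x) * (\<alpha> k x * (sqrt x / sqrt (x + 1 / c k)))"
      by (simp add: \<kappa>_def)
    also have "\<dots> \<le> sqrt (1 - x) * 1" using * that by (intro mult_left_mono) auto
    finally show "\<kappa> k x * sqrt x \<le> sqrt (1 - x)" by simp
    show "0 \<le> \<kappa> k x" using \<alpha>01 that c[of k] by (simp add: \<kappa>_def)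
  qed
  have sqrt_zz: "sqrt (z \<bullet> z) = norm z" for z :: 'a by (simp add: norm_eq_sqrt_inner)
  have norm_f: "norm (f k z) \<le> 1" for k z
  proof (cases "norm z < 1")
    case True
    let ?x = "z \<bullet> z"
    have x: "0 \<le> ?x" "?x < 1" using True zz by auto
    \<comment> \<open>The radial part has squared norm at most |z|^2 and the orthogonal rotational
      part at most 1 - |z|^2.\<close>
    have "(\<alpha> k ?x)\<^sup>2 * ?x + (\<kappa> k ?x * sqrt ?x)\<^sup>2 \<le> 1 * ?x + (sqrt (1 - ?x))\<^sup>2"
      using \<kappa>_bound[OF x] x \<alpha>01 by (intro add_mono mult_right_mono power_mono) (auto simp: power_le_one)
    also have "\<dots> = 1" using x by simp
    finally have "((\<alpha> k ?x)\<^sup>2 + (\<kappa> k ?x)\<^sup>2) * ?x \<le> 1"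
      using x by (simp add: power_mult_distrib algebra_simps)
    then have "sqrt (((\<alpha> k ?x)\<^sup>2 + (\<kappa> k ?x)\<^sup>2) * ?x) \<le> 1" by simp
    then show ?thesis using True by (simp add: f_def norm_combination real_sqrt_mult sqrt_zz)
  qed (simp add: f_def)
  have unit: "unit_field (f k)" for k
    unfolding unit_field_def using fC norm_f f0 \<rho> by blast
  have inv_c: "(\<lambda>k. 1 / c k) \<longlonglongrightarrow> 0" unfolding c_def by real_asymp
  have \<kappa>_lim: "(\<lambda>k. \<kappa> k x) \<longlonglongrightarrow> sqrt (1 - x) / sqrt x" if "0 < x" "x < 1" for x
  proof -
    have "(\<lambda>k. \<kappa> k x) \<longlonglongrightarrow> 1 * (sqrt (1 - x) / sqrt (x + 0))"
      unfolding \<kappa>_def using that by (intro tendsto_intros \<alpha>1 inv_c) auto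
    then show ?thesis by simp
  qed
  have f_lim: "(\<lambda>k. f k z) \<longlonglongrightarrow> \<nu> z" if "norm z < 1" for z
  proof (cases "z = 0")
    case True
    then show ?thesis by (simp add: f_def \<nu>_def linear_0[OF linear_J])
  next
    case False
    have "(\<lambda>k. \<alpha> k (z \<bullet> z) *\<^sub>R z + \<kappa> k (z \<bullet> z) *\<^sub>R J z)
        \<longlonglongrightarrow> 1 *\<^sub>R z + (sqrt (1 - z \<bullet> z) / sqrt (z \<bullet> z)) *\<^sub>R J z"
      by (intro tendsto_intros \<alpha>1 \<kappa>_lim) (use that False zz in auto)
    then show ?thesis using that by (simp add: f_def \<nu>_def power2_norm_eq_inner sqrt_zz)
  qed
  define B where "B z = (indicator (ball 0 1) z :: real)" for z :: 'a
  have [measurable]: "B \<in> borel_measurable borel" unfolding B_def by (intro borel_measurable_indicator) simp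
  have int_B: "integrable lborel B"
    unfolding B_def using emeasure_lborel_ball_finite[of "0::'a" 1]
    by (auto simp: integrable_indicator_iff infinity_ennreal_def[symmetric] simp del: infinity_ennreal_def)
  have \<alpha>'0: "\<alpha>' k (z \<bullet> z) = 0" if "\<rho> k < norm z" for k and z :: 'a
  proof -
    have "1 - 1 / c k < z \<bullet> z"
      using power_strict_mono[OF that, of 2] \<rho>[of k] by (simp add: power2_norm_eq_inner)
    then have "c k * (1 - z \<bullet> z) < c k * (1 / c k)"
      using c[of k] by (intro mult_strict_left_mono) auto
    then show ?thesis using c[of k] by (simp add: \<alpha>'_def S'0)
  qed
  have \<alpha>zc: "continuous_on UNIV (\<lambda>z::'a. \<alpha> k (z \<bullet> z))" for k
    by (intro C1_on_imp_continuous_on C1_on_compose_real[OF qC d\<alpha> \<alpha>'c, where T = UNIV]) auto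
  have \<alpha>'zc: "continuous_on UNIV (\<lambda>z::'a. \<alpha>' k (z \<bullet> z))" for k
    by (intro continuous_on_compose2[OF \<alpha>'c[of UNIV]] continuous_intros) auto
  have \<kappa>zc: "continuous_on (ball 0 1) (\<lambda>z::'a. \<kappa> k (z \<bullet> z))" for k
  proof -
    obtain \<kappa>' where \<kappa>': "\<And>x. x \<in> {0..<1} \<Longrightarrow> (\<kappa> k has_real_derivative \<kappa>' x) (at x)" "continuous_on {0..<1} \<kappa>'"
      using d\<kappa>[of k] by blast
    show ?thesis
      by (rule C1_on_imp_continuous_on, rule C1_on_compose_real[OF qC \<kappa>']) (auto simp: zz)
  qed
  have uc: "continuous_on (ball 0 1) u" by (rule continuous_on_subset[OF u_cont]) auto
  have weight_int: "integrable lborel (\<lambda>z. B z * (2 * \<alpha>' k (z \<bullet> z) * (z \<bullet> z)))" for k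
    unfolding B_def
    by (rule integrable_ball_compact_support[OF _ \<rho>(2)[of k]])
      (auto intro!: continuous_intros continuous_on_subset[OF \<alpha>'zc] simp: \<alpha>'0)
  \<comment> \<open>This is the divergence theorem for
    \<open>\<alpha> k (z \<bullet> z) *\<^sub>R z\<close>. Although \<open>\<alpha>' k\<close>
    carries the factor \<open>c k\<close>, the total mass of the layer weight is the dimension times
    the integral of the cut-off, hence bounded in \<open>k\<close>.\<close>
  have weight: "- (\<integral>z. B z * (2 * \<alpha>' k (z \<bullet> z) * (z \<bullet> z)) \<partial>lborel) = DIM('a) * (\<integral>z. B z * \<alpha> k (z \<bullet> z) \<partial>lborel)" for k
  proof -
    let ?g = "\<lambda>z::'a. \<alpha> k (z \<bullet> z) *\<^sub>R z + 0 *\<^sub>R J z"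
    have gC: "C1_on UNIV ?g"
      by (intro C1_on_add C1_on_scaleR C1_on_bounded_linear bounded_linear_ident bounded_linear_J C1_on_const
          C1_on_compose_real[OF qC d\<alpha> \<alpha>'c, where T = UNIV]) auto
    have g0: "?g z = 0" if "\<rho> k < norm z" for z using \<alpha>0[OF \<rho>_less[OF that]] by simp
    have div: "divergence ?g z = DIM('a) * (B z * \<alpha> k (z \<bullet> z)) + B z * (2 * \<alpha>' k (z \<bullet> z) * (z \<bullet> z))" for z
    proof -
      have "divergence ?g z = DIM('a) * \<alpha> k (z \<bullet> z) + 2 * \<alpha>' k (z \<bullet> z) * (z \<bullet> z)"
        by (rule divergence_radial[OF d\<alpha>, where \<kappa> = "\<lambda>_. 0" and \<kappa>' = 0]) simp
      moreover have "\<alpha> k (z \<bullet> z) = 0 \<and> \<alpha>' k (z \<bullet> z) = 0" if "\<not> norm z < 1"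
        using \<alpha>0[OF \<rho>_less[of k z]] \<alpha>'0[of k z] that \<rho>(2)[of k] by auto
      ultimately show ?thesis by (auto simp: B_def indicator_def)
    qed
    have i1: "integrable lborel (\<lambda>z. B z * \<alpha> k (z \<bullet> z))"
      unfolding B_def
      by (rule integrable_ball_compact_support[OF _ \<rho>(2)[of k]])
        (auto intro!: continuous_intros continuous_on_subset[OF \<alpha>zc] \<alpha>0 \<rho>_less)
    have "0 = (\<integral>z. DIM('a) * (B z * \<alpha> k (z \<bullet> z)) + B z * (2 * \<alpha>' k (z \<bullet> z) * (z \<bullet> z)) \<partial>lborel)"
      using integral_divergence(2)[OF gC g0] unfolding div by simp
    also have "\<dots> = DIM('a) * (\<integral>z. B z * \<alpha> k (z \<bullet> z) \<partial>lborel) + (\<integral>z. B z * (2 * \<alpha>' k (z \<bullet> z) * (z \<bullet> z)) \<partial>lborel)"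
      by (subst Bochner_Integration.integral_add) (use i1 weight_int in auto)
    finally show ?thesis by simp
  qed
  have flux_f: "flux (f k) = (\<integral>z. B z * (\<kappa> k (z \<bullet> z) * (z \<bullet> z) / 2) \<partial>lborel)
      + DIM('a) * (\<integral>z. B z * (u z * \<alpha> k (z \<bullet> z)) \<partial>lborel)
      + (\<integral>z. B z * (u z * (2 * \<alpha>' k (z \<bullet> z) * (z \<bullet> z))) \<partial>lborel)" for k
  proof -
    have \<kappa>0: "\<kappa> k (z \<bullet> z) = 0" if "\<rho> k < norm z" for z :: 'a
      using \<alpha>0[OF \<rho>_less[OF that]] by (simp add: \<kappa>_def)
    have i: "integrable lborel (\<lambda>z. B z * (\<kappa> k (z \<bullet> z) * (z \<bullet> z) / 2))"
      unfolding B_def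
      by (rule integrable_ball_compact_support[OF _ \<rho>(2)[of k]]) (auto intro!: continuous_intros \<kappa>zc simp: \<kappa>0)
    have i2: "integrable lborel (\<lambda>z. B z * (u z * \<alpha> k (z \<bullet> z)))"
      unfolding B_def
      by (rule integrable_ball_compact_support[OF _ \<rho>(2)[of k]])
        (auto intro!: continuous_intros uc continuous_on_subset[OF \<alpha>zc] \<alpha>0 \<rho>_less)
    have i3: "integrable lborel (\<lambda>z. B z * (u z * (2 * \<alpha>' k (z \<bullet> z) * (z \<bullet> z))))"
      unfolding B_def
      by (rule integrable_ball_compact_support[OF _ \<rho>(2)[of k]])
        (auto intro!: continuous_intros uc continuous_on_subset[OF \<alpha>'zc] simp: \<alpha>'0)
    obtain \<kappa>' where \<kappa>': "\<And>x. x \<in> {0..<1} \<Longrightarrow> (\<kappa> k has_real_derivative \<kappa>' x) (at x)"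
      using d\<kappa>[of k] by blast
    have "indicator (ball 0 1) z * (J z \<bullet> f k z / 2 + u z * divergence (f k) z)
      = B z * (\<kappa> k (z \<bullet> z) * (z \<bullet> z) / 2) + DIM('a) * (B z * (u z * \<alpha> k (z \<bullet> z)))
        + B z * (u z * (2 * \<alpha>' k (z \<bullet> z) * (z \<bullet> z)))" for z
    proof (cases "norm z < 1")
      case True
      have "divergence (f k) z = divergence (\<lambda>z. \<alpha> k (z \<bullet> z) *\<^sub>R z + \<kappa> k (z \<bullet> z) *\<^sub>R J z) z"
        by (rule divergence_cong[of "ball 0 1"]) (use True in \<open>auto simp: f_def\<close>)
      also have "\<dots> = DIM('a) * \<alpha> k (z \<bullet> z) + 2 * \<alpha>' k (z \<bullet> z) * (z \<bullet> z)"
        by (rule divergence_radial[OF d\<alpha> \<kappa>']) (use True zz in auto)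
      finally have d: "divergence (f k) z = DIM('a) * \<alpha> k (z \<bullet> z) + 2 * \<alpha>' k (z \<bullet> z) * (z \<bullet> z)" .
      have "J z \<bullet> f k z = \<kappa> k (z \<bullet> z) * (z \<bullet> z)"
        using True by (simp add: f_def inner_add_right J_orth J_inner)
      then show ?thesis using True d by (simp add: B_def algebra_simps)
    qed (simp add: B_def)
    then show ?thesis
      using flux_eq_divergence[OF fC \<rho>(2) f0, of k k] i i2 i3 by simp
  qed
  obtain M where M: "M > 0" "\<And>z. norm z < 1 \<Longrightarrow> \<bar>u z\<bar> \<le> M"
  proof -
    have "bounded (u ` cball 0 1)"
      by (intro compact_imp_bounded compact_continuous_image u_cont) auto
    then show ?thesis using that unfolding bounded_pos by auto
  qed
  have Bu: "(\<lambda>z. B z * u z) \<in> borel_measurable borel"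
  proof -
    have "(\<lambda>z. indicator (ball 0 1) z *\<^sub>R u z) \<in> borel_measurable borel"
      by (intro borel_measurable_continuous_on_indicator uc) auto
    then show ?thesis by (simp add: B_def)
  qed
  have L1: "(\<lambda>k. \<integral>z. B z * (\<kappa> k (z \<bullet> z) * (z \<bullet> z) / 2) \<partial>lborel)
      \<longlonglongrightarrow> (\<integral>z. B z * (norm z * sqrt (1 - (norm z)\<^sup>2)) / 2 \<partial>lborel)"
  proof (rule integral_dominated_convergence[where w = B])
    show "(\<lambda>z. B z * (\<kappa> k (z \<bullet> z) * (z \<bullet> z) / 2)) \<in> borel_measurable lborel" for k
    proof -
      have "(\<lambda>z::'a. indicator (ball 0 1) z *\<^sub>R (\<kappa> k (z \<bullet> z) * (z \<bullet> z) / 2)) \<in> borel_measurable borel"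
        by (intro borel_measurable_continuous_on_indicator continuous_intros \<kappa>zc) auto
      then show ?thesis by (simp add: B_def)
    qed
    have \<kappa>1: "0 \<le> \<kappa> k x * x" "\<kappa> k x * x \<le> 1" if "0 \<le> x" "x < 1" for k x
    proof -
      have "\<kappa> k x * x = (\<kappa> k x * sqrt x) * sqrt x" using that by simp
      also have "\<dots> \<le> sqrt (1 - x) * sqrt x" using \<kappa>_bound[OF that] that by (intro mult_right_mono) auto
      also have "\<dots> \<le> 1" using that by (intro mult_le_one) auto
      finally show "\<kappa> k x * x \<le> 1" .
      show "0 \<le> \<kappa> k x * x" using \<kappa>_bound[OF that] that by simp
    qed
    show "AE z in lborel. norm (B z * (\<kappa> k (z \<bullet> z) * (z \<bullet> z) / 2)) \<le> B z" for k
    proof (rule AE_I2)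
      fix z :: 'a
      show "norm (B z * (\<kappa> k (z \<bullet> z) * (z \<bullet> z) / 2)) \<le> B z"
        using \<kappa>1[of "z \<bullet> z" k] zz[of z] by (cases "norm z < 1") (auto simp: B_def)
    qed
    show "AE z in lborel. (\<lambda>k. B z * (\<kappa> k (z \<bullet> z) * (z \<bullet> z) / 2)) \<longlonglongrightarrow> B z * (norm z * sqrt (1 - (norm z)\<^sup>2)) / 2"
    proof (rule AE_I2)
      fix z :: 'a
      show "(\<lambda>k. B z * (\<kappa> k (z \<bullet> z) * (z \<bullet> z) / 2)) \<longlonglongrightarrow> B z * (norm z * sqrt (1 - (norm z)\<^sup>2)) / 2"
      proof (cases "norm z < 1 \<and> z \<noteq> 0")
        case True
        have "(\<lambda>k. B z * (\<kappa> k (z \<bullet> z) * (z \<bullet> z) / 2)) \<longlonglongrightarrow> B z * (sqrt (1 - z \<bullet> z) / sqrt (z \<bullet> z) * (z \<bullet> z) / 2)"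
          by (intro tendsto_intros \<kappa>_lim) (use True zz in auto)
        moreover have "sqrt (1 - z \<bullet> z) / sqrt (z \<bullet> z) * (z \<bullet> z) = norm z * sqrt (1 - (norm z)\<^sup>2)"
          using True by (simp add: sqrt_zz flip: power2_norm_eq_inner) (simp add: power2_eq_square)
        ultimately show ?thesis by (simp only: times_divide_eq_right[of "B z", symmetric])
      qed (auto simp: B_def indicator_def)
    qed
  qed (use int_B in \<open>simp_all\<close>)
  have L2: "(\<lambda>k. \<integral>z. B z * (u z * \<alpha> k (z \<bullet> z)) \<partial>lborel) \<longlonglongrightarrow> (\<integral>z. B z * u z \<partial>lborel)"
  proof (rule integral_dominated_convergence[where w = "\<lambda>z. M * B z"])
    show "(\<lambda>z. B z * (u z * \<alpha> k (z \<bullet> z))) \<in> borel_measurable lborel" for k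
    proof -
      have "(\<lambda>z::'a. \<alpha> k (z \<bullet> z)) \<in> borel_measurable borel"
        by (rule borel_measurable_continuous_onI[OF \<alpha>zc])
      then have "(\<lambda>z. B z * u z * \<alpha> k (z \<bullet> z)) \<in> borel_measurable borel"
        by (rule borel_measurable_times[OF Bu])
      then show ?thesis by (simp add: mult.assoc)
    qed
    show "AE z in lborel. norm (B z * (u z * \<alpha> k (z \<bullet> z))) \<le> M * B z" for k
    proof (rule AE_I2)
      fix z :: 'a
      have "\<bar>u z\<bar> * \<bar>\<alpha> k (z \<bullet> z)\<bar> \<le> M * 1" if "norm z < 1"
        using M(1) M(2)[OF that] \<alpha>01 by (intro mult_mono) auto
      then show "norm (B z * (u z * \<alpha> k (z \<bullet> z))) \<le> M * B z"
        by (auto simp: B_def indicator_def abs_mult)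
    qed
    show "AE z in lborel. (\<lambda>k. B z * (u z * \<alpha> k (z \<bullet> z))) \<longlonglongrightarrow> B z * u z"
    proof (rule AE_I2)
      fix z :: 'a
      have "(\<lambda>k. B z * (u z * \<alpha> k (z \<bullet> z))) \<longlonglongrightarrow> B z * (u z * 1)" if "norm z < 1"
        by (intro tendsto_intros \<alpha>1) (use that zz in auto)
      then show "(\<lambda>k. B z * (u z * \<alpha> k (z \<bullet> z))) \<longlonglongrightarrow> B z * u z"
        by (cases "norm z < 1") (auto simp: B_def)
    qed
  qed (use int_B Bu in \<open>simp_all\<close>)
  have L3: "(\<lambda>k. \<integral>z. B z * (u z * (2 * \<alpha>' k (z \<bullet> z) * (z \<bullet> z))) \<partial>lborel) \<longlonglongrightarrow> 0"
  proof (rule tendstoI)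
    fix e :: real assume e: "e > 0"
    define VB where "VB = (\<integral>z. B z \<partial>lborel)"
    have VB: "VB \<ge> 0" unfolding VB_def by (intro Bochner_Integration.integral_nonneg) (auto simp: B_def)
    \<comment> \<open>\<open>DIM('a) * VB\<close> bounds the mass of the layer weight; the added 1
      makes the denominator positive and the final inequality strict.\<close>
    define \<epsilon> where "\<epsilon> = e / (DIM('a) * VB + 1)"
    have den: "DIM('a) * VB + 1 > 0" using VB by (intro add_nonneg_pos) auto
    have \<epsilon>: "\<epsilon> > 0" using e den by (simp add: \<epsilon>_def)
    have "uniformly_continuous_on (cball 0 1) u" by (intro compact_uniformly_continuous u_cont) auto
    then obtain d where d: "d > 0" "\<And>y z. y \<in> cball 0 1 \<Longrightarrow> z \<in> cball 0 1 \<Longrightarrow> dist z y < d \<Longrightarrow> dist (u z) (u y) < \<epsilon>"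
      unfolding uniformly_continuous_on_def using \<epsilon> by metis
    \<comment> \<open>Compare \<open>z\<close> with its radial projection onto the sphere, where
      \<open>u\<close> vanishes.\<close>
    have near: "\<bar>u z\<bar> \<le> \<epsilon>" if "norm z < 1" "1 - norm z < d" "z \<noteq> 0" for z
    proof -
      let ?y = "(1 / norm z) *\<^sub>R z"
      have y: "norm ?y = 1" using that by simp
      have "z - ?y = (1 - 1 / norm z) *\<^sub>R z" by (simp add: algebra_simps)
      then have "dist z ?y = \<bar>1 - 1 / norm z\<bar> * norm z" by (simp add: dist_norm)
      also have "\<dots> = 1 - norm z" using that by (simp add: abs_if field_simps)
      finally have "dist (u z) (u ?y) < \<epsilon>" using that y d(2)[of ?y z] by auto
      then show ?thesis using u_boundary[OF y] by (simp add: dist_norm)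
    qed
    \<comment> \<open>The weight vanishes for |z|^2 < 1 - 2 / c k. Once this threshold exceeds the
      square of 1 - d, the layer lies within distance \<open>d\<close> of the sphere; the maximum
      with 0 covers the case of \<open>d\<close> larger than 1.\<close>
    have "(\<lambda>k. 1 - 2 * (1 / c k)) \<longlonglongrightarrow> 1 - 2 * 0" by (intro tendsto_intros inv_c)
    moreover have "max (1 - d) 0 < (1::real)" using d by simp
    then have "(max (1 - d) 0)\<^sup>2 < (1::real)" by (simp add: power2_eq_square mult_less_cancel_right1 abs_square_less_1[simplified power2_eq_square])
    ultimately have "\<forall>\<^sub>F k in sequentially. (max (1 - d) 0)\<^sup>2 < 1 - 2 * (1 / c k)"
      by (intro order_tendstoD) auto
    then show "\<forall>\<^sub>F k in sequentially. dist (\<integral>z. B z * (u z * (2 * \<alpha>' k (z \<bullet> z) * (z \<bullet> z))) \<partial>lborel) 0 < e"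
    proof eventually_elim
      case (elim k)
      have pt: "norm (B z * (u z * (2 * \<alpha>' k (z \<bullet> z) * (z \<bullet> z)))) \<le> - \<epsilon> * (B z * (2 * \<alpha>' k (z \<bullet> z) * (z \<bullet> z)))" for z :: 'a
      proof (cases "norm z < 1 \<and> \<alpha>' k (z \<bullet> z) \<noteq> 0")
        case True
        then have "\<not> (1 < c k * (1 - z \<bullet> z) - 1)" using S'0 by (auto simp: \<alpha>'_def)
        then have "1 - 2 * (1 / c k) \<le> z \<bullet> z" using c[of k] by (simp add: field_simps)
        then have "(max (1 - d) 0)\<^sup>2 < (norm z)\<^sup>2"
          using elim by (metis less_le_trans power2_norm_eq_inner)
        then have "max (1 - d) 0 < norm z" by (rule power2_less_imp_less) simp
        then have "\<bar>u z\<bar> \<le> \<epsilon>" using near[of z] True by auto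
        moreover have neg: "\<alpha>' k (z \<bullet> z) \<le> 0" using S(5) c[of k] by (simp add: \<alpha>'_def)
        ultimately have "\<bar>u z\<bar> * (2 * \<bar>\<alpha>' k (z \<bullet> z)\<bar> * (z \<bullet> z)) \<le> \<epsilon> * (2 * \<bar>\<alpha>' k (z \<bullet> z)\<bar> * (z \<bullet> z))"
          by (intro mult_right_mono mult_nonneg_nonneg) auto
        then show ?thesis using True neg by (simp add: B_def abs_mult abs_of_nonpos)
      qed (auto simp: B_def)
      have "norm (\<integral>z. B z * (u z * (2 * \<alpha>' k (z \<bullet> z) * (z \<bullet> z))) \<partial>lborel)
          \<le> (\<integral>z. - \<epsilon> * (B z * (2 * \<alpha>' k (z \<bullet> z) * (z \<bullet> z))) \<partial>lborel)"
        by (intro Bochner_Integration.integral_norm_bound_integral integrable_mult_right weight_int pt)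
          (unfold B_def, rule integrable_ball_compact_support[OF _ \<rho>(2)[of k]],
            auto intro!: continuous_intros uc continuous_on_subset[OF \<alpha>'zc] simp: \<alpha>'0)
      also have "\<dots> = \<epsilon> * (DIM('a) * (\<integral>z. B z * \<alpha> k (z \<bullet> z) \<partial>lborel))"
        by (subst weight[of k, symmetric]) simp
      also have "\<dots> \<le> \<epsilon> * (DIM('a) * VB)"
      proof -
        have "(\<integral>z. B z * \<alpha> k (z \<bullet> z) \<partial>lborel) \<le> VB"
          unfolding VB_def
        proof (rule integral_mono[OF _ int_B])
          show "integrable lborel (\<lambda>z. B z * \<alpha> k (z \<bullet> z))"
            unfolding B_def
            by (rule integrable_ball_compact_support[OF _ \<rho>(2)[of k]])
              (auto intro!: continuous_intros continuous_on_subset[OF \<alpha>zc] \<alpha>0 \<rho>_less)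
          show "B z * \<alpha> k (z \<bullet> z) \<le> B z" for z
            using \<alpha>01 by (auto simp: B_def indicator_def)
        qed
        then show ?thesis using \<epsilon> by (intro mult_left_mono) auto
      qed
      also have "\<dots> < e"
      proof -
        have "\<epsilon> * (DIM('a) * VB) < \<epsilon> * (DIM('a) * VB + 1)" using \<epsilon> by (intro mult_strict_left_mono) auto
        also have "\<dots> = e" using den by (simp add: \<epsilon>_def)
        finally show ?thesis .
      qed
      finally show ?case by simp
    qed
  qed
  have "(\<lambda>k. flux (f k)) \<longlonglongrightarrow> (\<integral>z. B z * (norm z * sqrt (1 - (norm z)\<^sup>2)) / 2 \<partial>lborel)
      + DIM('a) * (\<integral>z. B z * u z \<partial>lborel) + 0"
    unfolding flux_f by (intro tendsto_intros L1 L2 L3)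
  then have "(\<lambda>k. flux (f k)) \<longlonglongrightarrow> bubble_flux"
    by (simp add: bubble_flux_def B_def add.commute)
  with unit f_lim show ?thesis by (rule that)
qed

end

section \<open>Rigidity\<close>

lemma continuous_on_imp_tendsto_nhds:
  fixes f :: "'a::t2_space \<Rightarrow> 'b::topological_space"
  assumes f: "continuous_on A f" and A: "open A" and x: "x \<in> A"
  shows "(f \<longlongrightarrow> f x) (nhds x)"
proof -
  have "isCont f x" using f A x by (simp add: continuous_on_eq_continuous_at)
  then show ?thesis unfolding isCont_def using tendsto_at_iff_tendsto_nhds[of f x] by (rule iffD1[rotated])
qed

context graph_over_ball
begin

text \<open>Rotation by the angle \<beta> in the plane of \<open>f k z\<close> and
  \<open>J (f k z)\<close> preserves norms, so it yields another competitor. The difference of the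
  two fluxes lives on the support of \<beta>, away from the sphere, so its limit in \<open>k\<close>
  follows by dominated convergence even though \<nu> itself is no competitor.\<close>

lemma rotated_calibration:
  assumes max: "\<And>f. unit_field f \<Longrightarrow> flux f \<le> bubble_flux"
    and \<beta>: "C1_on UNIV \<beta>" and r: "r < 1" and supp: "\<And>z. r < norm z \<Longrightarrow> \<beta> z = 0"
  shows "integrable lborel (\<lambda>z. indicator (ball 0 1) z *
      ((cos (\<beta> z) - 1) * \<omega> z (\<nu> z) + sin (\<beta> z) * \<omega> z (J (\<nu> z))))" (is "integrable _ ?I")
    and "integral\<^sup>L lborel (\<lambda>z. indicator (ball 0 1) z *
      ((cos (\<beta> z) - 1) * \<omega> z (\<nu> z) + sin (\<beta> z) * \<omega> z (J (\<nu> z)))) \<le> 0"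
proof -
  obtain f where unit: "\<And>k::nat. unit_field (f k)"
    and f_lim: "\<And>z. norm z < 1 \<Longrightarrow> (\<lambda>k. f k z) \<longlonglongrightarrow> \<nu> z"
    and flux_lim: "(\<lambda>k. flux (f k)) \<longlonglongrightarrow> bubble_flux"
    using obtain_calibration_sequence by blast
  have fC: "C1_on UNIV (f k)" and norm_f: "norm (f k z) \<le> 1" for k z
    using unit[of k] by (auto simp: unit_field_def)
  have norm_Jf: "norm (J (f k z)) \<le> 1" for k z using norm_f by (simp add: norm_J)
  define g where "g k z = cos (\<beta> z) *\<^sub>R f k z + sin (\<beta> z) *\<^sub>R J (f k z)" for k z
  have cosC: "C1_on UNIV (\<lambda>z. cos (\<beta> z))" and sinC: "C1_on UNIV (\<lambda>z. sin (\<beta> z))"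
    by (rule C1_on_compose_real[OF \<beta>, of UNIV cos "\<lambda>x. - sin x"] C1_on_compose_real[OF \<beta>, of UNIV sin cos];
        auto intro!: derivative_eq_intros continuous_intros)+
  have gC: "C1_on UNIV (g k)" for k
    unfolding g_def by (intro C1_on_add C1_on_scaleR cosC sinC fC C1_on_linear_compose[OF _ bounded_linear_J])
  have g_unit: "unit_field (g k)" for k
  proof -
    obtain r' where r': "r' < 1" "\<And>z. r' < norm z \<Longrightarrow> f k z = 0"
      using unit[of k] unfolding unit_field_def by auto
    have "g k z = 0" if "r' < norm z" for z
      using r'(2)[OF that] by (simp add: g_def linear_0[OF linear_J])
    moreover have "norm (g k z) \<le> 1" for z
      using norm_f[of k z] by (simp add: g_def norm_combination)
    ultimately show ?thesis unfolding unit_field_def using gC r'(1) by blast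
  qed
  define d where "d k z = indicator (ball 0 1) z *
      ((cos (\<beta> z) - 1) * \<omega> z (f k z) + sin (\<beta> z) * \<omega> z (J (f k z)))" for k z
  have d_eq: "d k z = indicator (ball 0 1) z * \<omega> z (g k z) - indicator (ball 0 1) z * \<omega> z (f k z)" for k z
  proof (cases "norm z < 1")
    case True
    show ?thesis
      using True by (simp add: d_def g_def linear_add[OF linear_\<omega>] linear_cmul[OF linear_\<omega>] algebra_simps)
  qed (simp add: d_def)
  have int: "integrable lborel (\<lambda>z. indicator (ball 0 1) z * \<omega> z (h z))" if "unit_field h" for h
    using that integrable_\<omega> unfolding unit_field_def by blast
  have d_int: "integrable lborel (d k)" for k
    unfolding d_eq[abs_def] by (intro Bochner_Integration.integrable_diff int unit g_unit)
  have d_flux: "integral\<^sup>L lborel (d k) = flux (g k) - flux (f k)" for k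
    unfolding d_eq[abs_def] flux_def by (intro Bochner_Integration.integral_diff int unit g_unit)
  \<comment> \<open>The trigonometric factors vanish outside the ball of radius \<open>r\<close>, so
    this majorant is integrable however fast the derivative of \<open>u\<close> grows near the
    sphere.\<close>
  define W where "W z = indicator (ball 0 1) z * ((\<bar>cos (\<beta> z) - 1\<bar> + \<bar>sin (\<beta> z)\<bar>) * (\<Sum>b\<in>Basis. \<bar>\<omega> z b\<bar>))" for z
  have W: "integrable lborel W"
    unfolding W_def
  proof (rule integrable_ball_compact_support[OF _ r])
    show "continuous_on (ball 0 1) (\<lambda>z. (\<bar>cos (\<beta> z) - 1\<bar> + \<bar>sin (\<beta> z)\<bar>) * (\<Sum>b\<in>Basis. \<bar>\<omega> z b\<bar>))"
      by (intro continuous_intros continuous_on_\<omega>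
          continuous_on_subset[OF C1_on_imp_continuous_on[OF \<beta>]]) auto
  qed (simp add: supp)
  have dW: "norm (d k z) \<le> W z" for k z
  proof (cases "norm z < 1")
    case True
    have b: "\<bar>\<omega> z h\<bar> \<le> (\<Sum>b\<in>Basis. \<bar>\<omega> z b\<bar>)" if "norm h \<le> 1" for h
      using \<omega>_bound[OF True, of h] mult_left_mono[OF that, of "\<Sum>b\<in>Basis. \<bar>\<omega> z b\<bar>"]
      by (simp add: sum_nonneg)
    have "\<bar>(cos (\<beta> z) - 1) * \<omega> z (f k z) + sin (\<beta> z) * \<omega> z (J (f k z))\<bar>
      \<le> \<bar>cos (\<beta> z) - 1\<bar> * \<bar>\<omega> z (f k z)\<bar> + \<bar>sin (\<beta> z)\<bar> * \<bar>\<omega> z (J (f k z))\<bar>"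
      by (metis abs_mult abs_triangle_ineq)
    also have "\<dots> \<le> \<bar>cos (\<beta> z) - 1\<bar> * (\<Sum>b\<in>Basis. \<bar>\<omega> z b\<bar>) + \<bar>sin (\<beta> z)\<bar> * (\<Sum>b\<in>Basis. \<bar>\<omega> z b\<bar>)"
      by (intro add_mono mult_left_mono b norm_f norm_Jf) auto
    finally show ?thesis using True by (simp add: d_def W_def algebra_simps)
  qed (simp add: d_def W_def)
  have d_lim: "(\<lambda>k. d k z) \<longlonglongrightarrow> ?I z" for z
  proof (cases "norm z < 1")
    case True
    have bl: "bounded_linear (\<omega> z)" using linear_\<omega>[OF True] by (simp add: linear_conv_bounded_linear)
    show ?thesis
      unfolding d_def
      by (intro tendsto_intros bounded_linear.tendsto[OF bl] bounded_linear.tendsto[OF bounded_linear_J] f_lim True)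
  qed (simp add: d_def)
  have I_meas: "?I \<in> borel_measurable lborel"
    by (rule borel_measurable_LIMSEQ_real[OF d_lim]) (use borel_measurable_integrable[OF d_int] in auto)
  have AE: "AE z in lborel. (\<lambda>k. d k z) \<longlonglongrightarrow> ?I z" "\<And>k. AE z in lborel. norm (d k z) \<le> W z"
    using d_lim dW by auto
  show "integrable lborel ?I"
    by (rule integrable_dominated_convergence[OF I_meas _ W AE]) (use borel_measurable_integrable[OF d_int] in auto)
  have "(\<lambda>k. integral\<^sup>L lborel (d k)) \<longlonglongrightarrow> integral\<^sup>L lborel ?I"
    by (rule integral_dominated_convergence[OF I_meas _ W AE]) (use borel_measurable_integrable[OF d_int] in auto)
  moreover have "(\<lambda>k. bubble_flux - flux (f k)) \<longlonglongrightarrow> bubble_flux - bubble_flux"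
    by (intro tendsto_intros flux_lim)
  ultimately have "integral\<^sup>L lborel ?I \<le> bubble_flux - bubble_flux"
    by (rule LIMSEQ_le) (use max[OF g_unit] d_flux in auto)
  then show "integral\<^sup>L lborel ?I \<le> 0" by simp
qed

text \<open>First variation. A small rotation near \<open>z0\<close>, with the sign of
  \<open>\<omega> z0 (J (\<nu> z0))\<close>, gains a term of first order in the angle and loses at
  most one of second order. The origin is excluded because \<nu> is discontinuous there.\<close>

lemma maximal_flux_imp_horizontal_normal:
  assumes max: "\<And>f. unit_field f \<Longrightarrow> flux f \<le> bubble_flux"
    and z0: "norm z0 < 1" "z0 \<noteq> 0"
  shows "\<omega> z0 (J (\<nu> z0)) = 0"
proof (rule ccontr)
  assume ne: "\<omega> z0 (J (\<nu> z0)) \<noteq> 0"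
  define \<sigma> where "\<sigma> = sgn (\<omega> z0 (J (\<nu> z0)))"
  have \<sigma>: "\<sigma> = 1 \<or> \<sigma> = -1" using ne by (auto simp: \<sigma>_def sgn_if)
  define c where "c = \<bar>\<omega> z0 (J (\<nu> z0))\<bar> / 2"
  define M where "M = \<bar>\<omega> z0 (\<nu> z0)\<bar> + 1"
  have c: "c > 0" and M: "M > 0" using ne by (auto simp: c_def M_def)
  let ?A = "ball (0::'a) 1 - {0}"
  have A: "open ?A" by auto
  have \<nu>c: "continuous_on ?A \<nu>"
    unfolding \<nu>_def by (intro continuous_intros linear_continuous_on bounded_linear_J) auto
  have c1: "continuous_on ?A (\<lambda>z. \<sigma> * \<omega> z (J (\<nu> z)))"
    by (intro continuous_intros continuous_on_\<omega> bounded_linear.continuous_on[OF bounded_linear_J] \<nu>c) auto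
  have c2: "continuous_on ?A (\<lambda>z. \<bar>\<omega> z (\<nu> z)\<bar>)"
    by (intro continuous_intros continuous_on_\<omega> \<nu>c) auto
  have z0A: "z0 \<in> ?A" using z0 by auto
  have "((\<lambda>z. \<sigma> * \<omega> z (J (\<nu> z))) \<longlongrightarrow> \<sigma> * \<omega> z0 (J (\<nu> z0))) (nhds z0)"
    by (rule continuous_on_imp_tendsto_nhds[OF c1 A z0A])
  then have e1: "\<forall>\<^sub>F z in nhds z0. c < \<sigma> * \<omega> z (J (\<nu> z))"
    by (rule order_tendstoD) (use ne in \<open>auto simp: c_def \<sigma>_def sgn_if\<close>)
  have "((\<lambda>z. \<bar>\<omega> z (\<nu> z)\<bar>) \<longlongrightarrow> \<bar>\<omega> z0 (\<nu> z0)\<bar>) (nhds z0)"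
    by (rule continuous_on_imp_tendsto_nhds[OF c2 A z0A])
  then have e2: "\<forall>\<^sub>F z in nhds z0. \<bar>\<omega> z (\<nu> z)\<bar> < M"
    by (rule order_tendstoD) (auto simp: M_def)
  have "\<forall>\<^sub>F z in nhds z0. z \<in> ?A" using A z0A by (rule eventually_nhds_in_open)
  with e1 e2 have "\<forall>\<^sub>F z in nhds z0. c < \<sigma> * \<omega> z (J (\<nu> z)) \<and> \<bar>\<omega> z (\<nu> z)\<bar> < M \<and> z \<in> ?A"
    by eventually_elim auto
  then obtain \<delta>' where \<delta>': "\<delta>' > 0" "\<And>z. dist z z0 < \<delta>' \<Longrightarrow> c < \<sigma> * \<omega> z (J (\<nu> z)) \<and> \<bar>\<omega> z (\<nu> z)\<bar> < M"
    unfolding eventually_nhds_metric by auto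
  define \<delta> where "\<delta> = min \<delta>' ((1 - norm z0) / 2)"
  have \<delta>: "\<delta> > 0" using \<delta>'(1) z0 by (auto simp: \<delta>_def)
  have near: "c < \<sigma> * \<omega> z (J (\<nu> z))" "\<bar>\<omega> z (\<nu> z)\<bar> < M" if "dist z z0 < \<delta>" for z
    using \<delta>'(2)[of z] that by (auto simp: \<delta>_def)
  define r where "r = (1 + norm z0) / 2"
  have r: "r < 1" using z0 by (simp add: r_def)
  have far: "\<delta> \<le> dist z z0" if "r < norm z" for z
  proof -
    have "norm z \<le> norm (z - z0) + norm z0" by (metis diff_add_cancel norm_triangle_ineq)
    moreover have "\<delta> \<le> (1 - norm z0) / 2" unfolding \<delta>_def by (rule min.cobounded2)
    ultimately show ?thesis using that by (simp add: r_def dist_norm field_simps)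
  qed
  obtain S S' where S: "\<And>x. (S has_real_derivative S' x) (at x)" "continuous_on UNIV S'"
    "\<And>x. 0 \<le> S x" "\<And>x. S x \<le> 1" "\<And>x. x \<le> 0 \<Longrightarrow> S x = 0" "\<And>x. 0 < x \<Longrightarrow> 0 < S x"
    using obtain_smoothstep by metis
  \<comment> \<open>The maximal angle. Up to the common factor \<open>2 * sin x\<close> the loss is
    at most \<open>s / 2 * M\<close> and the gain at least \<open>1 / 2 * c\<close>, so
    \<open>s * M < c\<close> decides the sign. The bound \<open>s \<le> 1 / 2\<close> keeps the
    half-angle where the cosine is at least 1 / 2.\<close>
  define s where "s = min 1 (c / M) / 2"
  have s: "0 < s" "s \<le> 1 / 2" "s * M < c"
    using c M by (auto simp: s_def min_def field_simps)
  define b where "b z = s * S (\<delta>\<^sup>2 - (z - z0) \<bullet> (z - z0))" for z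
  define \<beta> where "\<beta> z = \<sigma> * b z" for z
  have b0: "0 \<le> b z" "b z \<le> s" for z
    using S(3,4) s mult_left_mono[OF S(4), of s] by (auto simp: b_def)
  have b_pos: "0 < b z" if "dist z z0 < \<delta>" for z
    using power_strict_mono[OF that, of 2] s S(6)
    by (simp add: b_def dist_norm power2_norm_eq_inner)
  have b_zero: "b z = 0" if "\<not> dist z z0 < \<delta>" for z
    using power_mono[of \<delta> "dist z z0" 2] that \<delta> S(5)
    by (simp add: b_def dist_norm power2_norm_eq_inner)
  have "C1_on UNIV (\<lambda>z. z - z0)"
    by (intro C1_on_diff C1_on_bounded_linear bounded_linear_ident C1_on_const)
  from C1_on_diff[OF C1_on_const C1_on_inner[OF this this]]
  have "C1_on UNIV (\<lambda>z. \<delta>\<^sup>2 - (z - z0) \<bullet> (z - z0))" .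
  then have \<beta>C: "C1_on UNIV \<beta>"
    unfolding \<beta>_def b_def
    by (intro C1_on_mult C1_on_const C1_on_compose_real[of _ _ UNIV S S']) (use S in auto)
  have \<beta>0: "\<beta> z = 0" if "r < norm z" for z
    using b_zero[of z] far[OF that] by (simp add: \<beta>_def)
  let ?I = "\<lambda>z. indicator (ball 0 1) z * ((cos (\<beta> z) - 1) * \<omega> z (\<nu> z) + sin (\<beta> z) * \<omega> z (J (\<nu> z)))"
  note rot = rotated_calibration[OF max \<beta>C r \<beta>0]
  have pos: "?I z > 0" if z: "dist z z0 < \<delta>" for z
  proof -
    \<comment> \<open>In the half-angle \<open>x\<close>, both \<open>sin (\<beta> z)\<close> and
      \<open>cos (\<beta> z) - 1\<close> carry the factor \<open>2 * sin x\<close>; what remains is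
      a comparison of \<open>cos x\<close> times the gain with \<open>sin x\<close> times the
      loss.\<close>
    define x where "x = b z / 2"
    have x: "0 < x" "x \<le> s / 2" using b_pos[OF z] b0[of z] by (auto simp: x_def)
    have nz: "norm z < 1" using far[of z] z r by (meson not_le order.strict_trans1 not_less)
    have sin_b: "sin (\<beta> z) = \<sigma> * (2 * sin x * cos x)" and cos_b: "cos (\<beta> z) - 1 = - (2 * (sin x)\<^sup>2)"
      using \<sigma> sin_double[of x] cos_double_sin[of x] by (auto simp: \<beta>_def x_def)
    have sx: "0 < sin x" "sin x \<le> x"
      using x s by (auto intro!: sin_gt_zero sin_x_le_x order.strict_trans1[OF _ pi_gt3[THEN order.strict_trans[rotated]]])
    have cx: "1 / 2 \<le> cos x"
    proof -
      have "cos (pi / 3) \<le> cos x"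
        by (intro cos_monotone_0_pi_le) (use x s pi_gt3 in auto)
      then show ?thesis by (simp add: cos_60)
    qed
    have "sin x * \<omega> z (\<nu> z) \<le> sin x * M" using near(2)[OF z] sx by (intro mult_left_mono) auto
    also have "\<dots> \<le> x * M" using sx M by (intro mult_right_mono) auto
    also have "\<dots> \<le> s / 2 * M" using x M by (intro mult_right_mono) auto
    also have "\<dots> < 1 / 2 * c" using s by simp
    also have "\<dots> \<le> cos x * c" using cx c by (intro mult_right_mono) auto
    also have "\<dots> \<le> cos x * (\<sigma> * \<omega> z (J (\<nu> z)))" using near(1)[OF z] cx by (intro mult_left_mono) auto
    finally have "0 < 2 * sin x * (cos x * (\<sigma> * \<omega> z (J (\<nu> z))) - sin x * \<omega> z (\<nu> z))"
      using sx by simp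
    also have "\<dots> = ?I z"
      using nz by (simp add: sin_b cos_b power2_eq_square algebra_simps)
    finally show ?thesis .
  qed
  have zero: "?I z = 0" if "\<not> dist z z0 < \<delta>" for z
    using b_zero[OF that] by (simp add: \<beta>_def)
  have nonneg: "0 \<le> ?I z" for z using pos[of z] zero[of z] by (cases "dist z z0 < \<delta>") auto
  \<comment> \<open>A nonnegative integrand with nonpositive integral vanishes almost everywhere,
    yet this one is positive on a ball of positive measure.\<close>
  have "integral\<^sup>L lborel ?I = 0"
    using rot(2) Bochner_Integration.integral_nonneg[of lborel ?I] nonneg by (intro antisym) auto
  then have "AE z in lborel. ?I z = 0"
    using integral_nonneg_eq_0_iff_AE[OF rot(1)] nonneg by auto
  then have "AE z in lborel. z \<notin> ball z0 \<delta>"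
    by eventually_elim (use pos in \<open>fastforce simp: dist_commute\<close>)
  then have "emeasure lborel (ball z0 \<delta>) = 0"
    by (subst (asm) AE_iff_measurable[OF _ refl]) (auto simp: ball_def)
  moreover have "emeasure lborel (ball z0 \<delta>) > 0"
    using \<delta> by (subst emeasure_ball) auto
  ultimately show False by simp
qed

text \<open>The half circle \<gamma> is an integral curve of \<open>J (\<nu> z)\<close>. The
  vanishing of \<omega> in this direction says that the lift of \<gamma> to the graph is a
  horizontal curve, so \<open>u\<close> grows along it at the rate |\<gamma>|^2 / 2. Integration
  starts at a boundary point, where \<open>u\<close> is 0.\<close>

lemma maximal_flux_imp_bubble:
  assumes max: "\<And>f. unit_field f \<Longrightarrow> flux f \<le> bubble_flux" and z: "norm z < 1"
  shows "u z = pi / 8 + norm z / 4 * sqrt (1 - (norm z)\<^sup>2) - 1 / 4 * arcsin (norm z)"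
proof -
  \<comment> \<open>For \<open>z = 0\<close> any unit vector will do, since every half circle ends
    at the origin.\<close>
  obtain e where e: "norm e = 1" "z = norm z *\<^sub>R e"
  proof (cases "z = 0")
    case True
    then show ?thesis using that[of "SOME i. i \<in> Basis"] by (simp add: SOME_Basis)
  next
    case False
    then show ?thesis using that[of "(1 / norm z) *\<^sub>R z"] by simp
  qed
  define a where "a = arccos (norm z)"
  have a: "0 < a" "a \<le> pi / 2" "cos a = norm z" "sin a = sqrt (1 - (norm z)\<^sup>2)"
    using z order.trans[OF _ norm_ge_zero[of z], of "-1"] arccos_less_arccos[of "norm z" 1] arccos_le_pi2[of "norm z"]
    by (auto simp: a_def sin_arccos)
  \<comment> \<open>The phase \<open>a\<close> turns the half circle so that it starts on the unit
    sphere at time 0 and reaches \<open>z\<close> at time \<open>a\<close>.\<close>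
  define \<gamma> where "\<gamma> s = cos s *\<^sub>R (cos (s - a) *\<^sub>R e + sin (s - a) *\<^sub>R J e)" for s
  have norm_\<gamma>: "norm (\<gamma> s) = cos s" if "0 \<le> s" "s \<le> a" for s
  proof -
    have "0 \<le> cos s" using that a by (intro cos_ge_zero) auto
    then show ?thesis by (simp add: \<gamma>_def norm_combination e)
  qed
  \<comment> \<open>The subtracted term is the primitive of (cos s)^2 / 2 that vanishes at
    0.\<close>
  define F where "F s = u (\<gamma> s) - (s / 4 + sin s * cos s / 4)" for s
  have d\<gamma>: "(\<gamma> has_vector_derivative J (\<gamma> s) - (sin s / cos s) *\<^sub>R \<gamma> s) (at s)" if "cos s \<noteq> 0" for s
  proof -
    have "(\<gamma> has_vector_derivative
        (cos s *\<^sub>R ((- sin (s - a)) *\<^sub>R e + cos (s - a) *\<^sub>R J e) + (- sin s) *\<^sub>R (cos (s - a) *\<^sub>R e + sin (s - a) *\<^sub>R J e))) (at s)"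
      unfolding \<gamma>_def
      by (auto intro!: derivative_eq_intros simp: has_real_derivative_iff_has_vector_derivative[symmetric])
    also have "(cos s *\<^sub>R ((- sin (s - a)) *\<^sub>R e + cos (s - a) *\<^sub>R J e) + (- sin s) *\<^sub>R (cos (s - a) *\<^sub>R e + sin (s - a) *\<^sub>R J e))
      = J (\<gamma> s) - (sin s / cos s) *\<^sub>R \<gamma> s"
      using that by (simp add: \<gamma>_def J_add J_scaleR J_J algebra_simps)
    finally show ?thesis .
  qed
  have dF: "(F has_real_derivative 0) (at s)" if s: "0 < s" "s < a" for s
  proof -
    have cs: "0 < cos s" using s a by (intro cos_gt_zero_pi) auto
    have ss: "0 < sin s" using s a by (intro sin_gt_zero) auto
    have sin_eq: "sqrt (1 - (cos s)\<^sup>2) = sin s" using ss by (simp add: sin_squared_eq[symmetric])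
    have ng: "norm (\<gamma> s) = cos s" using norm_\<gamma> s by auto
    have "cos s < cos 0" by (rule cos_monotone_0_pi) (use s a in auto)
    then have g1: "norm (\<gamma> s) < 1" using ng by simp
    have g0: "\<gamma> s \<noteq> 0" using ng cs by auto
    let ?v = "J (\<gamma> s) - (sin s / cos s) *\<^sub>R \<gamma> s"
    have J\<nu>: "J (\<nu> (\<gamma> s)) = ?v"
      by (simp add: \<nu>_def ng sin_eq J_add J_scaleR J_J)
    have "0 = \<omega> (\<gamma> s) ?v"
      using maximal_flux_imp_horizontal_normal[OF max g1 g0] J\<nu> by simp
    also have "\<dots> = (cos s)\<^sup>2 / 2 - frechet_derivative u (at (\<gamma> s)) ?v"
      by (simp add: \<omega>_def inner_diff_right J_inner J_orth ng[symmetric] power2_norm_eq_inner)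
    finally have fu: "frechet_derivative u (at (\<gamma> s)) ?v = (cos s)\<^sup>2 / 2" by simp
    have L: "linear (frechet_derivative u (at (\<gamma> s)))"
      using C1_onD(1)[OF u_C1, of "\<gamma> s"] g1 has_derivative_linear by auto
    have "((\<lambda>s. u (\<gamma> s)) has_derivative (\<lambda>h. frechet_derivative u (at (\<gamma> s)) (h *\<^sub>R ?v))) (at s)"
      by (rule has_derivative_compose[OF d\<gamma>[unfolded has_vector_derivative_def] C1_onD(1)[OF u_C1]])
        (use cs g1 in auto)
    then have du: "((\<lambda>s. u (\<gamma> s)) has_real_derivative (cos s)\<^sup>2 / 2) (at s)"
      unfolding has_field_derivative_def
      by (rule has_derivative_eq_rhs) (auto simp: linear_cmul[OF L] fu)
    have "(F has_real_derivative (cos s)\<^sup>2 / 2 - (1 / 4 + (cos s * cos s - sin s * sin s) / 4)) (at s)"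
      unfolding F_def
      by (intro DERIV_diff du) (auto intro!: derivative_eq_intros simp: field_simps)
    moreover have "(cos s)\<^sup>2 / 2 - (1 / 4 + (cos s * cos s - sin s * sin s) / 4) = 0"
      using sin_cos_squared_add[of s] by (simp add: power2_eq_square field_simps)
    ultimately show ?thesis by simp
  qed
  have cF: "continuous_on {0..a} F"
  proof -
    have "continuous_on {0..a} \<gamma>" unfolding \<gamma>_def by (intro continuous_intros)
    then have "continuous_on {0..a} (\<lambda>s. u (\<gamma> s))"
      by (rule continuous_on_compose2[OF u_cont]) (auto simp: norm_\<gamma>)
    then show ?thesis unfolding F_def by (intro continuous_intros) auto
  qed
  have "F a = F 0" by (rule DERIV_isconst_end[OF a(1) cF]) (use dF in auto)
  moreover have "F 0 = 0" using u_boundary[of "\<gamma> 0"] norm_\<gamma>[of 0] a by (simp add: F_def)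
  moreover have "\<gamma> a = z" by (simp add: \<gamma>_def a e(2)[symmetric])
  ultimately have "u z = a / 4 + sqrt (1 - (norm z)\<^sup>2) * norm z / 4" by (simp add: F_def a(3,4))
  also have "a = pi / 2 - arcsin (norm z)" using z order.trans[OF _ norm_ge_zero[of z], of "-1"] by (simp add: a_def arccos_arcsin_eq)
  finally show ?thesis by (simp add: field_simps)
qed

end

section \<open>Horizontal fields on the Heisenberg group\<close>

definition rot :: "'n::finite hplane \<Rightarrow> 'n hplane" where
  "rot z = (- snd z, fst z)"

definition frame :: "'n + 'n \<Rightarrow> 'n::finite hplane" where
  "frame j = (case j of Inl i \<Rightarrow> (axis i 1, 0) | Inr i \<Rightarrow> (0, axis i 1))"

interpretation rot: complex_structure "rot :: 'n::finite hplane \<Rightarrow> 'n hplane"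
  by standard (auto simp: rot_def inner_prod_def inner_commute intro!: linearI)

interpretation neg_rot: complex_structure "\<lambda>z :: 'n::finite hplane. - rot z"
  by standard (auto simp: rot_def inner_prod_def inner_commute intro!: linearI)

text \<open>In this form the geometry enters only through \<open>rot\<close>, and sums over the
  frame become sums over \<open>Basis\<close> by \<open>sum_frame\<close>.\<close>

lemma X_field_eq: "X_field j g = (frame j, rot (fst g) \<bullet> frame j / 2)"
  by (auto simp: X_field_def frame_def rot_def inner_axis split: prod.split sum.split)

lemma heis_mult_eq: "heis_mult g h = (fst g + fst h, snd g + snd h + rot (fst g) \<bullet> fst h / 2)"
  by (auto simp: heis_mult_def rot_def inner_commute split: prod.split)

lemma sum_frame: "(\<Sum>j\<in>UNIV. h (frame j)) = (\<Sum>b\<in>(Basis :: 'n::finite hplane set). h b)"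
proof (rule sum.reindex_bij_betw, rule bij_betwI')
  show "(frame x = (frame y :: 'n hplane)) = (x = y)" for x y :: "'n + 'n"
    by (auto simp: frame_def axis_eq_axis split: sum.splits)
  show "frame x \<in> (Basis :: 'n hplane set)" for x :: "'n + 'n"
    by (auto simp: frame_def Basis_prod_def axis_in_Basis_iff split: sum.splits)
  show "\<exists>x\<in>UNIV. b = frame x" if "b \<in> (Basis :: 'n hplane set)" for b :: "'n hplane"
  proof -
    from that obtain i where "b = (axis i 1, 0) \<or> b = (0, axis i 1)"
      by (auto simp: Basis_prod_def Basis_vec_def)
    then have "b = frame (Inl i) \<or> b = frame (Inr i)" by (auto simp: frame_def)
    then show ?thesis by auto
  qed
qed

text \<open>The rotation of \<open>frame j\<close> is orthogonal to \<open>frame j\<close>, so the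
  vertical slope of the field does not change along its own lines.\<close>

lemma X_field_translate: "X_field j (g + s *\<^sub>R X_field j g) = X_field j g"
  by (simp add: X_field_eq rot.J_add rot.J_scaleR inner_add_left rot.J_orth)

section \<open>Shears of the group and Lebesgue measure\<close>

lemma nn_integral_lborel_translate:
  fixes f :: "'a::euclidean_space \<Rightarrow> ennreal"
  assumes [measurable]: "f \<in> borel_measurable borel"
  shows "(\<integral>\<^sup>+x. f (x + a) \<partial>lborel) = (\<integral>\<^sup>+x. f x \<partial>lborel)"
proof -
  have "(\<integral>\<^sup>+x. f x \<partial>lborel) = (\<integral>\<^sup>+x. f x \<partial>distr lborel borel ((+) a))" by (simp add: lborel_distr_plus)
  also have "\<dots> = (\<integral>\<^sup>+x. f (x + a) \<partial>lborel)" by (subst nn_integral_distr) (auto simp: add.commute)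
  finally show ?thesis by simp
qed

text \<open>By Tonelli's theorem it suffices to translate each vertical fibre and then the
  horizontal variable. Both the flows of the frame and the left translations are maps of this
  shape.\<close>

lemma lborel_distr_shear:
  fixes c :: "'a::euclidean_space \<Rightarrow> real"
  assumes [measurable]: "c \<in> borel_measurable borel"
  shows "distr lborel borel (\<lambda>p. (fst p + a, snd p + c (fst p))) = lborel"
proof (rule measure_eqI)
  let ?T = "\<lambda>p :: 'a \<times> real. (fst p + a, snd p + c (fst p))"
  have bp: "(borel :: ('a \<times> real) measure) = borel \<Otimes>\<^sub>M borel" by (rule borel_prod[symmetric])
  have T[measurable]: "?T \<in> borel_measurable borel"
    unfolding bp by measurable
  fix A assume "A \<in> sets (distr lborel borel ?T)"
  then have A[measurable]: "A \<in> sets borel" by simp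
  have A'[measurable]: "A \<in> sets (borel \<Otimes>\<^sub>M borel)" using A unfolding borel_prod .
  have "emeasure (distr lborel borel ?T) A = (\<integral>\<^sup>+p. indicator A (?T p) \<partial>lborel)"
  proof -
    have "emeasure (distr lborel borel ?T) A = (\<integral>\<^sup>+p. indicator A p \<partial>distr lborel borel ?T)" by simp
    also have "\<dots> = (\<integral>\<^sup>+p. indicator A (?T p) \<partial>lborel)" by (rule nn_integral_distr) auto
    finally show ?thesis .
  qed
  also have "\<dots> = (\<integral>\<^sup>+z. \<integral>\<^sup>+t. indicator A (z + a, t + c z) \<partial>lborel \<partial>lborel)"
    unfolding lborel_prod[symmetric]
    by (subst lborel.nn_integral_fst[symmetric]) auto
  also have "\<dots> = (\<integral>\<^sup>+z. \<integral>\<^sup>+t. indicator A (z + a, t) \<partial>lborel \<partial>lborel)"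
    by (intro nn_integral_cong nn_integral_lborel_translate) measurable
  also have "\<dots> = (\<integral>\<^sup>+z. \<integral>\<^sup>+t. indicator A (z, t) \<partial>lborel \<partial>lborel)"
    by (rule nn_integral_lborel_translate) measurable
  also have "\<dots> = (\<integral>\<^sup>+p. indicator A p \<partial>lborel)"
    unfolding lborel_prod[symmetric]
    by (subst lborel.nn_integral_fst) auto
  finally show "emeasure (distr lborel borel ?T) A = emeasure lborel A" by simp
qed simp

lemma lborel_distr_X_flow:
  "distr lborel borel (\<lambda>g. g + s *\<^sub>R X_field j g) = (lborel :: 'n::finite heis measure)"
proof -
  have "(\<lambda>z :: 'n hplane. s * (rot z \<bullet> frame j / 2)) \<in> borel_measurable borel"
    by (intro borel_measurable_continuous_onI continuous_intros linear_continuous_on rot.bounded_linear_J) simp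
  from lborel_distr_shear[OF this, of "s *\<^sub>R frame j"]
  have "distr lborel borel (\<lambda>p. (fst p + s *\<^sub>R frame j, snd p + s * (rot (fst p) \<bullet> frame j / 2)))
    = (lborel :: 'n heis measure)" .
  moreover have "(\<lambda>g :: 'n heis. g + s *\<^sub>R X_field j g)
      = (\<lambda>p. (fst p + s *\<^sub>R frame j, snd p + s * (rot (fst p) \<bullet> frame j / 2)))"
    by (intro ext prod_eqI) (simp_all add: X_field_eq)
  ultimately show ?thesis by simp
qed

lemma continuous_on_X_field: "continuous_on UNIV (X_field j :: 'n::finite heis \<Rightarrow> 'n heis)"
proof -
  have "continuous_on UNIV (\<lambda>g :: 'n heis. (frame j, rot (fst g) \<bullet> frame j / 2))"
    by (intro continuous_intros bounded_linear.continuous_on[OF rot.bounded_linear_J]) simp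
  then show ?thesis by (simp add: X_field_eq[symmetric])
qed

section \<open>From vector fields to admissible test fields\<close>

lemma compactly_supported_in_UNIV:
  fixes f :: "'a::euclidean_space \<Rightarrow> real"
  assumes "\<And>g. r < norm g \<Longrightarrow> f g = 0"
  shows "compactly_supported_in UNIV f"
proof -
  have "{x. f x \<noteq> 0} \<subseteq> cball 0 r" using assms by (intro subsetI) (force intro: leI)
  then have "bounded {x. f x \<noteq> 0}" using bounded_subset bounded_cball by blast
  then show ?thesis by (simp add: compactly_supported_in_def)
qed

lemma C1_field_X_deriv:
  fixes F :: "'n::finite heis \<Rightarrow> 'n hplane"
  assumes F: "C1_on UNIV F"
  shows "((\<lambda>s. F (g + s *\<^sub>R X_field i g) \<bullet> e) has_real_derivative
      frechet_derivative F (at g) (X_field i g) \<bullet> e) (at 0)"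
proof -
  let ?X = "X_field i g"
  have L: "linear (frechet_derivative F (at g))"
    using C1_onD(1)[OF F] has_derivative_linear by blast
  have "((\<lambda>s. g + s *\<^sub>R ?X) has_derivative (\<lambda>s. s *\<^sub>R ?X)) (at 0)"
    by (auto intro!: derivative_eq_intros)
  then have "((\<lambda>s. F (g + s *\<^sub>R ?X)) has_derivative (\<lambda>s. frechet_derivative F (at g) (s *\<^sub>R ?X))) (at 0)"
    by (rule has_derivative_compose) (use C1_onD(1)[OF F, of g] in simp)
  then have "((\<lambda>s. F (g + s *\<^sub>R ?X) \<bullet> e) has_derivative (\<lambda>s. frechet_derivative F (at g) (s *\<^sub>R ?X) \<bullet> e)) (at 0)"
    by (rule has_derivative_inner_left)
  then show ?thesis
    unfolding has_field_derivative_def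
    by (rule has_derivative_eq_rhs) (auto simp: linear_cmul[OF L] mult.commute)
qed

lemma set_lebesgue_integral_lborel:
  fixes h :: "'a::euclidean_space \<Rightarrow> real"
  assumes "E \<in> sets borel" "h \<in> borel_measurable borel"
  shows "set_lebesgue_integral lebesgue E h = (\<integral>g. indicator E g * h g \<partial>lborel)"
  unfolding set_lebesgue_integral_def
  by (subst integral_completion) (use assms in auto)

text \<open>The components along the orthonormal frame turn a vector-valued field into an admissible
  family. Total differentiability supplies the derivatives along the frame lines, and
  \<open>D\<close> is the horizontal divergence.\<close>

lemma H_perimeter_ge:
  fixes F :: "'n::finite heis \<Rightarrow> 'n hplane"
  assumes F: "C1_on UNIV F" and supp: "\<And>g. r < norm g \<Longrightarrow> F g = 0" and norm: "\<And>g. norm (F g) \<le> 1"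
    and E: "E \<in> sets borel"
  defines "D \<equiv> \<lambda>g. \<Sum>j\<in>UNIV. frechet_derivative F (at g) (X_field j g) \<bullet> frame j"
  shows "ereal (\<integral>g. indicator E g * D g \<partial>lborel) \<le> H_perimeter E UNIV"
    and "continuous_on UNIV D" and "integrable lborel D"
proof -
  define \<zeta> where "\<zeta> j g = F g \<bullet> frame j" for j g
  have X: "X_deriv i (\<zeta> j) g = frechet_derivative F (at g) (X_field i g) \<bullet> frame j" for i j g
    unfolding X_deriv_def \<zeta>_def by (rule DERIV_imp_deriv[OF C1_field_X_deriv[OF F]])
  have Fc: "continuous_on UNIV (\<lambda>g. frechet_derivative F (at g) (X_field i g))" for i
    by (rule C1_on_continuous_derivative[OF F continuous_on_X_field])
  have F'0: "frechet_derivative F (at g) h = 0" if "r < norm g" for g h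
  proof -
    have "(F has_derivative (\<lambda>_. 0)) (at g)"
      by (rule has_derivative_transform_within_open[of "\<lambda>_. 0" _ _ _ "- cball 0 r"]) (use that supp in auto)
    then show ?thesis using frechet_derivative_at by metis
  qed
  have "\<zeta> \<in> horizontal_test_fields UNIV"
    unfolding horizontal_test_fields_def
  proof (intro CollectI conjI allI ballI)
    fix i j :: "'n + 'n" and g :: "'n heis"
    show "continuous_on UNIV (\<zeta> i)"
      unfolding \<zeta>_def by (intro continuous_intros C1_on_imp_continuous_on[OF F])
    show "compactly_supported_in UNIV (\<zeta> i)"
      by (rule compactly_supported_in_UNIV[of r]) (simp add: \<zeta>_def supp)
    show "X_differentiable j (\<zeta> i)"
      unfolding X_differentiable_def \<zeta>_def real_differentiable_def by (intro allI, rule exI, rule C1_field_X_deriv[OF F])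
    show "continuous_on UNIV (X_deriv j (\<zeta> i))"
      unfolding X[abs_def] by (intro continuous_intros Fc)
    show "compactly_supported_in UNIV (X_deriv j (\<zeta> i))"
      by (rule compactly_supported_in_UNIV[of r]) (simp add: X F'0)
    have "(\<Sum>i\<in>UNIV. (\<zeta> i g)\<^sup>2) = (\<Sum>b\<in>Basis. (F g \<bullet> b) * (F g \<bullet> b))"
      unfolding \<zeta>_def power2_eq_square by (rule sum_frame)
    also have "\<dots> = (norm (F g))\<^sup>2"
      by (simp add: power2_norm_eq_inner euclidean_inner[of "F g" "F g"])
    finally show "sqrt (\<Sum>i\<in>UNIV. (\<zeta> i g)\<^sup>2) \<le> 1" using norm[of g] by simp
  qed
  then have "ereal (set_lebesgue_integral lebesgue E (\<lambda>g. \<Sum>i\<in>UNIV. X_deriv i (\<zeta> i) g)) \<le> H_perimeter E UNIV"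
    unfolding H_perimeter_def by (rule SUP_upper)
  moreover have "(\<lambda>g. \<Sum>i\<in>UNIV. X_deriv i (\<zeta> i) g) = D" unfolding D_def X by simp
  moreover show Dc: "continuous_on UNIV D" unfolding D_def by (intro continuous_intros Fc)
  moreover have "set_lebesgue_integral lebesgue E D = (\<integral>g. indicator E g * D g \<partial>lborel)"
    by (rule set_lebesgue_integral_lborel[OF E borel_measurable_continuous_onI[OF Dc]])
  ultimately show "ereal (\<integral>g. indicator E g * D g \<partial>lborel) \<le> H_perimeter E UNIV" by simp
  show "integrable lborel D"
    by (rule integrable_continuous_bounded_support[OF Dc, of r]) (simp add: D_def F'0)
qed

section \<open>The lower bound for the perimeter\<close>

lemma integral_Ioo_eq_Icc:
  fixes f :: "real \<Rightarrow> real"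
  assumes "f \<in> borel_measurable borel"
  shows "(\<integral>t. indicator {a<..<b} t * f t \<partial>lborel) = (\<integral>t. f t * indicator {a..b} t \<partial>lborel)"
proof (rule integral_cong_AE)
  have "AE t in lborel. t \<noteq> a \<and> t \<noteq> b" by (simp add: AE_lborel_singleton)
  then show "AE t in lborel. indicator {a<..<b} t * f t = f t * indicator {a..b} t"
    by eventually_elim (auto simp: indicator_def)
qed (use assms in simp_all)

text \<open>In the variable \<tau>, the density \<open>pi / 2 * sin (pi * \<tau>)\<close> on [0, 1]
  has mass 1 and mean 1 / 2, which produces \<open>A - B / 2\<close>; each of the two interpolation
  weights has average 1 / 2 over the fibre. The proof writes down a primitive \<open>G\<close> in
  \<tau>.\<close>

lemma integral_over_fibre:
  fixes u v A B p q :: real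
  assumes w: "u + v > 0"
  defines "\<tau> \<equiv> \<lambda>t. (t + v) / (u + v)"
  shows "(\<integral>t. indicator {- v<..<u} t * (pi / 2 * sin (pi * \<tau> t) * ((A - \<tau> t * B) / (u + v))
      + (1 - cos (pi * \<tau> t)) / 2 * p + (1 + cos (pi * \<tau> t)) / 2 * q) \<partial>lborel)
    = A - B / 2 + (u + v) / 2 * (p + q)" (is "(\<integral>t. _ * ?h t \<partial>lborel) = _")
proof -
  have w0: "u + v \<noteq> 0" using w by simp
  have hc: "continuous_on UNIV ?h"
    unfolding \<tau>_def using w0 by (intro continuous_intros) auto
  have "(\<integral>t. indicator {- v<..<u} t * ?h t \<partial>lborel) = (\<integral>t. ?h t * indicator {- v..u} t \<partial>lborel)"
    by (rule integral_Ioo_eq_Icc[OF borel_measurable_continuous_onI[OF hc]])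
  define G where "G \<sigma> = - (cos (pi * \<sigma>) / 2 * A) - B / 2 * (sin (pi * \<sigma>) / pi - \<sigma> * cos (pi * \<sigma>))
      + (u + v) * ((\<sigma> - sin (pi * \<sigma>) / pi) / 2 * p + (\<sigma> + sin (pi * \<sigma>) / pi) / 2 * q)" for \<sigma>
  have dG: "(G has_real_derivative pi / 2 * sin (pi * \<sigma>) * (A - \<sigma> * B)
      + (u + v) * ((1 - cos (pi * \<sigma>)) / 2 * p + (1 + cos (pi * \<sigma>)) / 2 * q)) (at \<sigma>)" for \<sigma>
    unfolding G_def by (auto intro!: derivative_eq_intros simp: field_simps)
  have d\<tau>: "(\<tau> has_real_derivative 1 / (u + v)) (at t)" for t
    unfolding \<tau>_def using w0 by (auto intro!: derivative_eq_intros)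
  have d: "((\<lambda>t. G (\<tau> t)) has_real_derivative ?h t) (at t)" for t
    by (rule DERIV_cong[OF DERIV_chain2[OF dG d\<tau>]]) (use w0 in \<open>simp add: add_divide_distrib\<close>)
  have "(\<integral>t. ?h t * indicator {- v..u} t \<partial>lborel) = G (\<tau> u) - G (\<tau> (- v))"
    by (rule integral_FTC_Icc_real)
      (use w d continuous_on_eq_continuous_at[OF open_UNIV, THEN iffD1, OF hc] in auto)
  also have "\<dots> = A - B / 2 + (u + v) / 2 * (p + q)"
    using w0 by (simp add: \<tau>_def G_def field_simps)
  finally show ?thesis
    using \<open>(\<integral>t. indicator {- v<..<u} t * ?h t \<partial>lborel) = _\<close> by simp
qed

text \<open>The domains after scaling to radius 1. The condition \<open>thick\<close> says that
  every fibre over the open ball has positive length, so that the relative height in the fibre can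
  be formed.\<close>

locale graph_domain =
  fixes u v :: "'n::finite hplane \<Rightarrow> real"
  assumes u_C1: "C1_on (ball 0 1) u" and u_cont: "continuous_on (cball 0 1) u"
    and v_C1: "C1_on (ball 0 1) v" and v_cont: "continuous_on (cball 0 1) v"
    and u_boundary: "norm z = 1 \<Longrightarrow> u z = 0" and v_boundary: "norm z = 1 \<Longrightarrow> v z = 0"
    and thick: "norm z < 1 \<Longrightarrow> 0 < u z + v z"
begin

sublocale upper: graph_over_ball rot u
  by standard (use u_C1 u_cont u_boundary in auto)

sublocale lower: graph_over_ball "\<lambda>z. - rot z" v
  by standard (use v_C1 v_cont v_boundary in auto)

definition dom :: "'n heis set" where
  "dom = {(z, t). norm z < 1 \<and> - v z < t \<and> t < u z}"

lemma open_dom: "open dom"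
proof -
  have c: "continuous_on (ball 0 1 \<times> UNIV) (\<lambda>p :: 'n heis. u (fst p) - snd p)"
    "continuous_on (ball 0 1 \<times> UNIV) (\<lambda>p :: 'n heis. v (fst p) + snd p)"
    by (intro continuous_intros continuous_on_compose2[OF u_cont] continuous_on_compose2[OF v_cont]; auto)+
  have o: "open (ball 0 1 \<times> UNIV :: 'n heis set)" by (intro open_Times) auto
  have "dom = ((ball 0 1 \<times> UNIV) \<inter> (\<lambda>p. u (fst p) - snd p) -` {0<..})
      \<inter> ((ball 0 1 \<times> UNIV) \<inter> (\<lambda>p. v (fst p) + snd p) -` {0<..})"
    by (auto simp: dom_def)
  also have "open \<dots>"
    by (intro open_Int continuous_open_preimage[OF c(1) o] continuous_open_preimage[OF c(2) o]) auto
  finally show ?thesis .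
qed

lemma obtain_height_bound:
  obtains M where "M > 0" "\<And>z. norm z < 1 \<Longrightarrow> u z < M" "\<And>z. norm z < 1 \<Longrightarrow> v z < M"
proof -
  have "bounded (u ` cball 0 1)" "bounded (v ` cball 0 1)"
    by (intro compact_imp_bounded compact_continuous_image u_cont v_cont; simp)+
  then obtain M1 M2 where "M1 > 0" "M2 > 0" "\<And>z. norm z \<le> 1 \<Longrightarrow> \<bar>u z\<bar> \<le> M1" "\<And>z. norm z \<le> 1 \<Longrightarrow> \<bar>v z\<bar> \<le> M2"
    unfolding bounded_pos by auto
  then have "u z < M1 + M2 + 1 \<and> v z < M1 + M2 + 1" if "norm z < 1" for z
    using that by (smt (verit))
  with \<open>M1 > 0\<close> \<open>M2 > 0\<close> show ?thesis by (intro that[of "M1 + M2 + 1"]) auto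
qed

lemma integral_dom:
  fixes h :: "'n heis \<Rightarrow> real"
  assumes h: "integrable lborel (\<lambda>p. indicator dom p * h p)"
  shows "(\<integral>p. indicator dom p * h p \<partial>lborel)
    = (\<integral>z. indicator (ball 0 1) z * (\<integral>t. indicator {- v z<..<u z} t * h (z, t) \<partial>lborel) \<partial>lborel)"
proof -
  have "(\<integral>p. indicator dom p * h p \<partial>lborel) = (\<integral>z. \<integral>t. indicator dom (z, t) * h (z, t) \<partial>lborel \<partial>lborel)"
    using lborel_pair.integral_fst'[of "\<lambda>p. indicator dom p * h p"] h unfolding lborel_prod by simp
  also have "\<dots> = (\<integral>z. indicator (ball 0 1) z * (\<integral>t. indicator {- v z<..<u z} t * h (z, t) \<partial>lborel) \<partial>lborel)"
  proof (rule Bochner_Integration.integral_cong[OF refl])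
    fix z :: "'n hplane"
    have "indicator dom (z, t) = (indicator (ball 0 1) z * indicator {- v z<..<u z} t :: real)" for t
      by (auto simp: dom_def indicator_def)
    then show "(\<integral>t. indicator dom (z, t) * h (z, t) \<partial>lborel)
      = indicator (ball 0 1) z * (\<integral>t. indicator {- v z<..<u z} t * h (z, t) \<partial>lborel)"
      by (simp add: mult.assoc)
  qed
  finally show ?thesis .
qed

lemma emeasure_dom_finite: "emeasure lborel dom < \<infinity>"
proof -
  obtain M where M: "M > 0" "\<And>z. norm z < 1 \<Longrightarrow> u z < M" "\<And>z. norm z < 1 \<Longrightarrow> v z < M"
    by (rule obtain_height_bound) auto
  have "bounded (ball 0 1 \<times> {- M<..<M} :: 'n heis set)"
    by (intro bounded_Times) auto
  moreover have "dom \<subseteq> ball 0 1 \<times> {- M<..<M}" using M(2,3) by (fastforce simp: dom_def)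
  ultimately show ?thesis using bounded_subset emeasure_bounded_finite by blast
qed

lemma integrable_ball_u: "integrable lborel (\<lambda>z. indicator (ball 0 1) z * u z)"
  and integrable_ball_v: "integrable lborel (\<lambda>z. indicator (ball 0 1) z * v z)"
proof -
  have *: "integrable lborel (\<lambda>z. indicator (ball 0 1) z * h z)"
    if "continuous_on (cball 0 1) h" for h :: "'n hplane \<Rightarrow> real"
  proof -
    have "set_integrable lborel (ball 0 1) h"
    proof (rule set_integrable_subset[of _ "cball 0 1"])
      show "set_integrable lborel (cball 0 1) h"
        unfolding set_integrable_def by (rule borel_integrable_compact[OF compact_cball that])
    qed auto
    then show ?thesis by (simp add: set_integrable_def)
  qed
  show "integrable lborel (\<lambda>z. indicator (ball 0 1) z * u z)" by (rule *[OF u_cont])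
  show "integrable lborel (\<lambda>z. indicator (ball 0 1) z * v z)" by (rule *[OF v_cont])
qed

lemma measure_dom:
  "measure lborel dom = (\<integral>z. indicator (ball 0 1) z * u z \<partial>lborel) + (\<integral>z. indicator (ball 0 1) z * v z \<partial>lborel)"
proof -
  have i: "integrable lborel (\<lambda>p. indicator dom p * (1::real))"
    using open_dom emeasure_dom_finite by (simp add: integrable_indicator_iff)
  have "measure lborel dom = (\<integral>p. indicator dom p * 1 \<partial>lborel)"
    using open_dom by simp
  also have "\<dots> = (\<integral>z. indicator (ball 0 1) z * (\<integral>t. indicator {- v z<..<u z} t * 1 \<partial>lborel) \<partial>lborel)"
    by (rule integral_dom[OF i])
  also have "\<dots> = (\<integral>z. indicator (ball 0 1) z * u z + indicator (ball 0 1) z * v z \<partial>lborel)"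
  proof (rule Bochner_Integration.integral_cong[OF refl])
    fix z :: "'n hplane"
    show "indicator (ball 0 1) z * (\<integral>t. indicator {- v z<..<u z} t * (1::real) \<partial>lborel)
      = indicator (ball 0 1) z * u z + indicator (ball 0 1) z * v z"
      using thick[of z] by (cases "norm z < 1") auto
  qed
  also have "\<dots> = (\<integral>z. indicator (ball 0 1) z * u z \<partial>lborel) + (\<integral>z. indicator (ball 0 1) z * v z \<partial>lborel)"
    by (rule Bochner_Integration.integral_add[OF integrable_ball_u integrable_ball_v])
  finally show ?thesis .
qed

text \<open>
  The test field interpolates between \<open>g\<close> on the lower graph and \<open>f\<close> on the upper graph; the profile
  \<open>(1 - cos (\<pi> \<tau>)) / 2\<close> stays in \<open>[0, 1]\<close> for all real \<open>\<tau>\<close> and makes the fibre integrals elementary.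
\<close>
lemma flux_le_perimeter:
  assumes f: "unit_field f" and g: "unit_field g"
  shows "ereal (upper.flux f + lower.flux g) \<le> H_perimeter dom UNIV"
proof -
  obtain r1 where r1: "r1 < 1" "\<And>z. r1 < norm z \<Longrightarrow> f z = 0" using f by (auto simp: unit_field_def)
  obtain r2 where r2: "r2 < 1" "\<And>z. r2 < norm z \<Longrightarrow> g z = 0" using g by (auto simp: unit_field_def)
  define r where "r = max r1 r2"
  have r: "r < 1" and f0: "\<And>z. r < norm z \<Longrightarrow> f z = 0" and g0: "\<And>z. r < norm z \<Longrightarrow> g z = 0"
    using r1 r2 by (auto simp: r_def)
  have fC: "C1_on UNIV f" and gC: "C1_on UNIV g" and fn: "\<And>z. norm (f z) \<le> 1" and gn: "\<And>z. norm (g z) \<le> 1"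
    using f g by (auto simp: unit_field_def)
  obtain M where M: "M > 0" "\<And>z. norm z < 1 \<Longrightarrow> u z < M" "\<And>z. norm z < 1 \<Longrightarrow> v z < M"
    by (rule obtain_height_bound) auto
  obtain S S' where S: "\<And>x. (S has_real_derivative S' x) (at x)" "continuous_on UNIV S'"
    "\<And>x. 0 \<le> S x" "\<And>x. S x \<le> 1" "\<And>x. x \<le> 0 \<Longrightarrow> S x = 0" "\<And>x. 1 \<le> x \<Longrightarrow> S x = 1"
    using obtain_smoothstep by metis
  define \<tau> where "\<tau> p = (snd p + v (fst p)) / (u (fst p) + v (fst p))" for p :: "'n heis"
  \<comment> \<open>A vertical cut-off that is 1 for |t| \<le> M, hence on the whole domain, and 0
    for |t| \<ge> M + 1. It makes the support bounded without contributing to the divergence on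
    \<open>dom\<close>.\<close>
  define K where "K p = S (M + 1 - snd p) * S (M + 1 + snd p)" for p :: "'n heis"
  define G where "G p = ((1 - cos (pi * \<tau> p)) / 2) *\<^sub>R f (fst p) + ((1 + cos (pi * \<tau> p)) / 2) *\<^sub>R g (fst p)" for p
  define F where "F p = (if p \<in> ball 0 1 \<times> UNIV then K p *\<^sub>R G p else 0)" for p
  let ?B = "ball 0 1 \<times> UNIV :: 'n heis set"
  have B_open: "open ?B" by (intro open_Times) auto
  have lin: "bounded_linear (fst :: 'n heis \<Rightarrow> _)" "bounded_linear (snd :: 'n heis \<Rightarrow> _)"
    by (rule bounded_linear_fst bounded_linear_snd)+
  have sndC: "C1_on T (\<lambda>p :: 'n heis. snd p)" for T by (rule C1_on_bounded_linear[OF lin(2)])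
  have uC: "C1_on ?B (\<lambda>p. u (fst p))" and vC: "C1_on ?B (\<lambda>p. v (fst p))"
    by (rule C1_on_compose_linear[OF u_C1 lin(1)] C1_on_compose_linear[OF v_C1 lin(1)]; auto)+
  have \<tau>C: "C1_on ?B \<tau>"
    unfolding \<tau>_def by (intro C1_on_divide C1_on_add sndC uC vC) (use thick in fastforce)
  have cosC: "C1_on ?B (\<lambda>p. cos (pi * \<tau> p))"
    by (rule C1_on_compose_real[OF \<tau>C, of UNIV "\<lambda>x. cos (pi * x)" "\<lambda>x. - sin (pi * x) * pi"])
      (auto intro!: derivative_eq_intros continuous_intros)
  have half: "C1_on ?B (\<lambda>p. (1 - cos (pi * \<tau> p)) / 2)" "C1_on ?B (\<lambda>p. (1 + cos (pi * \<tau> p)) / 2)"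
    by (intro C1_on_divide C1_on_diff C1_on_add C1_on_const cosC; simp)+
  have GC: "C1_on ?B G"
    unfolding G_def
    by (intro C1_on_add C1_on_scaleR half C1_on_compose_linear[OF fC lin(1)] C1_on_compose_linear[OF gC lin(1)]) auto
  have KC: "C1_on T K" for T
  proof -
    have "C1_on T (\<lambda>p :: 'n heis. M + 1 - snd p)" "C1_on T (\<lambda>p :: 'n heis. M + 1 + snd p)"
      by (intro C1_on_diff C1_on_add C1_on_const sndC)+
    from this[THEN C1_on_compose_real, OF S(1,2)] show ?thesis
      unfolding K_def by (intro C1_on_mult) auto
  qed
  have FC: "C1_on UNIV F"
    unfolding F_def
  proof (rule C1_on_extend_zero[OF _ B_open, of _ "cball 0 r \<times> UNIV"])
    show "C1_on ?B (\<lambda>p. K p *\<^sub>R G p)" by (rule C1_on_scaleR[OF KC GC])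
    show "K p *\<^sub>R G p = 0" if "p \<in> ?B - cball 0 r \<times> UNIV" for p
      using that f0[of "fst p"] g0[of "fst p"] by (cases p) (auto simp: G_def)
  qed (use r in \<open>auto intro!: closed_Times\<close>)
  have F0: "F p = 0" if "1 + (M + 1) < norm p" for p
  proof (cases "norm (fst p) < 1")
    case True
    have "norm p \<le> norm (fst p) + norm (snd p)" by (metis norm_Pair_le prod.collapse)
    with True that have "M + 1 < \<bar>snd p\<bar>" by simp
    then have "K p = 0" using S(5)[of "M + 1 - snd p"] S(5)[of "M + 1 + snd p"] by (auto simp: K_def abs_if split: if_splits)
    then show ?thesis by (simp add: F_def)
  qed (auto simp: F_def mem_Times_iff)
  have Fn: "norm (F p) \<le> 1" for p
  proof -
    have c01: "0 \<le> 1 - cos (pi * \<tau> p)" "0 \<le> 1 + cos (pi * \<tau> p)"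
      using cos_le_one[of "pi * \<tau> p"] cos_ge_minus_one[of "pi * \<tau> p"] by linarith+
    have "norm (G p) \<le> norm (((1 - cos (pi * \<tau> p)) / 2) *\<^sub>R f (fst p)) + norm (((1 + cos (pi * \<tau> p)) / 2) *\<^sub>R g (fst p))"
      unfolding G_def by (rule norm_triangle_ineq)
    also have "\<dots> = (1 - cos (pi * \<tau> p)) / 2 * norm (f (fst p)) + (1 + cos (pi * \<tau> p)) / 2 * norm (g (fst p))"
      using c01 by simp
    also have "\<dots> \<le> (1 - cos (pi * \<tau> p)) / 2 * 1 + (1 + cos (pi * \<tau> p)) / 2 * 1"
      using c01 by (intro add_mono mult_left_mono fn gn) auto
    finally have "norm (G p) \<le> 1" by (simp add: field_simps)
    moreover have "0 \<le> K p" "K p \<le> 1" using S(3,4) by (auto simp: K_def mult_le_one)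
    ultimately show ?thesis by (auto simp: F_def mult_le_one)
  qed
  define D where "D p = (\<Sum>j\<in>UNIV. frechet_derivative F (at p) (X_field j p) \<bullet> frame j)" for p
  have dom_borel: "dom \<in> sets borel" using open_dom by simp
  note ge = H_perimeter_ge[OF FC F0 Fn dom_borel, folded D_def]
  define fu where "fu z = frechet_derivative u (at z)" for z
  define fv where "fv z = frechet_derivative v (at z)" for z
  \<comment> \<open>The first summand comes from the derivative of the profile in the direction
    \<open>f z - g z\<close>; its part with \<open>rot z\<close> is the vertical component of the
    frame. The other two interpolate the divergences of \<open>f\<close> and
    \<open>g\<close>.\<close>
  have D_eq: "D (z, t) = pi / 2 * sin (pi * \<tau> (z, t)) *
        ((rot z \<bullet> (f z - g z) / 2 + fv z (f z - g z) - \<tau> (z, t) * (fu z (f z - g z) + fv z (f z - g z))) / (u z + v z))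
      + (1 - cos (pi * \<tau> (z, t))) / 2 * divergence f z + (1 + cos (pi * \<tau> (z, t))) / 2 * divergence g z"
    if p: "(z, t) \<in> dom" for z t
  proof -
    have z: "norm z < 1" and t: "\<bar>t\<bar> < M" using p M(2,3)[of z] by (auto simp: dom_def)
    have w: "u z + v z \<noteq> 0" using thick[OF z] by simp
    let ?w = "u z + v z"
    have Lu: "linear (fu z)" and Lv: "linear (fv z)"
      unfolding fu_def fv_def using C1_onD(1)[OF u_C1, of z] C1_onD(1)[OF v_C1, of z] z has_derivative_linear by auto
    have df: "(fst has_derivative fst) (at (z, t))" "(snd has_derivative snd) (at (z, t))"
      by (auto intro!: bounded_linear_imp_has_derivative lin)
    have du: "((\<lambda>p. u (fst p)) has_derivative (\<lambda>h. fu z (fst h))) (at (z, t))"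
      using has_derivative_compose[OF df(1), of u "fu z"] C1_onD(1)[OF u_C1, of z] z by (simp add: fu_def)
    have dv: "((\<lambda>p. v (fst p)) has_derivative (\<lambda>h. fv z (fst h))) (at (z, t))"
      using has_derivative_compose[OF df(1), of v "fv z"] C1_onD(1)[OF v_C1, of z] z by (simp add: fv_def)
    have dff: "((\<lambda>p. f (fst p)) has_derivative (\<lambda>h. frechet_derivative f (at z) (fst h))) (at (z, t))"
      using has_derivative_compose[OF df(1), of f] C1_onD(1)[OF fC, of z] by simp
    have dgg: "((\<lambda>p. g (fst p)) has_derivative (\<lambda>h. frechet_derivative g (at z) (fst h))) (at (z, t))"
      using has_derivative_compose[OF df(1), of g] C1_onD(1)[OF gC, of z] by simp
    define \<tau>' where "\<tau>' h = (snd h + fv z (fst h) - \<tau> (z, t) * (fu z (fst h) + fv z (fst h))) / ?w" for h :: "'n heis"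
    have d\<tau>: "(\<tau> has_derivative \<tau>') (at (z, t))"
    proof -
      have "(\<tau> has_derivative (\<lambda>h. ((snd h + fv z (fst h)) * ?w - (t + v z) * (fu z (fst h) + fv z (fst h))) / (?w * ?w))) (at (z, t))"
        unfolding \<tau>_def[abs_def]
        using has_derivative_divide'[OF has_derivative_add[OF df(2) dv] has_derivative_add[OF du dv]] w by simp
      also have "(\<lambda>h. ((snd h + fv z (fst h)) * ?w - (t + v z) * (fu z (fst h) + fv z (fst h))) / (?w * ?w)) = \<tau>'"
        unfolding \<tau>'_def \<tau>_def using w by (auto simp: fun_eq_iff field_simps)
      finally show ?thesis .
    qed
    have dcos: "((\<lambda>p. cos (pi * \<tau> p)) has_derivative (\<lambda>h. - (sin (pi * \<tau> (z, t)) * (pi * \<tau>' h)))) (at (z, t))"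
      by (auto intro!: derivative_eq_intros d\<tau>)
    let ?c = "cos (pi * \<tau> (z, t))" and ?s = "sin (pi * \<tau> (z, t))"
    define G' where "G' h = (pi / 2 * ?s * \<tau>' h) *\<^sub>R (f z - g z)
        + ((1 - ?c) / 2) *\<^sub>R frechet_derivative f (at z) (fst h) + ((1 + ?c) / 2) *\<^sub>R frechet_derivative g (at z) (fst h)" for h
    have c1: "((\<lambda>p. (1 - cos (pi * \<tau> p)) / 2) has_derivative (\<lambda>h. pi / 2 * ?s * \<tau>' h)) (at (z, t))"
      by (rule has_derivative_eq_rhs[OF has_derivative_divide[OF has_derivative_diff[OF has_derivative_const[of 1] dcos]
            has_derivative_const[of 2]]]) auto
    have c2: "((\<lambda>p. (1 + cos (pi * \<tau> p)) / 2) has_derivative (\<lambda>h. - (pi / 2 * ?s * \<tau>' h))) (at (z, t))"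
      by (rule has_derivative_eq_rhs[OF has_derivative_divide[OF has_derivative_add[OF has_derivative_const[of 1] dcos]
            has_derivative_const[of 2]]]) auto
    have "(G has_derivative G') (at (z, t))"
      unfolding G_def[abs_def]
      by (rule has_derivative_eq_rhs[OF has_derivative_add[OF has_derivative_scaleR[OF c1 dff] has_derivative_scaleR[OF c2 dgg]]])
        (auto simp: G'_def fun_eq_iff algebra_simps)
    then have "(F has_derivative G') (at (z, t))"
    proof (rule has_derivative_transform_within_open)
      show "open (ball 0 1 \<times> {- M<..<M} :: 'n heis set)" by (intro open_Times) auto
      show "(z, t) \<in> ball 0 1 \<times> {- M<..<M}" using z t by auto
      show "G p = F p" if "p \<in> ball 0 1 \<times> {- M<..<M}" for p
        using that S(6) by (auto simp: F_def K_def)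
    qed
    then have F': "frechet_derivative F (at (z, t)) = G'" using frechet_derivative_at by metis
    have "D (z, t) = (\<Sum>j\<in>UNIV. G' (frame j, rot z \<bullet> frame j / 2) \<bullet> frame j)"
      by (simp add: D_def F' X_field_eq)
    also have "\<dots> = (\<Sum>b\<in>Basis. G' (b, rot z \<bullet> b / 2) \<bullet> b)"
      by (rule sum_frame[of "\<lambda>b. G' (b, rot z \<bullet> b / 2) \<bullet> b"])
    also have "\<dots> = (\<Sum>b\<in>Basis. pi / 2 * ?s * (\<tau>' (b, rot z \<bullet> b / 2) * ((f z - g z) \<bullet> b))
        + (1 - ?c) / 2 * (frechet_derivative f (at z) b \<bullet> b) + (1 + ?c) / 2 * (frechet_derivative g (at z) b \<bullet> b))"
      by (simp add: G'_def inner_add_left mult.assoc)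
    also have "\<dots> = pi / 2 * ?s * (\<Sum>b\<in>Basis. \<tau>' (b, rot z \<bullet> b / 2) * ((f z - g z) \<bullet> b))
        + (1 - ?c) / 2 * divergence f z + (1 + ?c) / 2 * divergence g z"
      by (simp only: sum.distrib divergence_def sum_distrib_left)
    also have "(\<Sum>b\<in>Basis. \<tau>' (b, rot z \<bullet> b / 2) * ((f z - g z) \<bullet> b)) = \<tau>' (f z - g z, rot z \<bullet> (f z - g z) / 2)"
    proof -
      define L where "L b = \<tau>' (b, rot z \<bullet> b / 2)" for b
      have L: "linear L"
        unfolding L_def \<tau>'_def
        by (rule linearI) (simp_all add: linear_add[OF Lu] linear_add[OF Lv] linear_cmul[OF Lu] linear_cmul[OF Lv]
            inner_add_right algebra_simps add_divide_distrib diff_divide_distrib)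
      have "L (f z - g z) = L (\<Sum>b\<in>Basis. ((f z - g z) \<bullet> b) *\<^sub>R b)" by (simp only: euclidean_representation)
      also have "\<dots> = (\<Sum>b\<in>Basis. L b * ((f z - g z) \<bullet> b))"
        by (simp add: linear_sum[OF L] linear_cmul[OF L] mult.commute)
      finally show ?thesis by (simp add: L_def)
    qed
    finally show ?thesis by (simp add: \<tau>'_def)
  qed
  have int_D: "integrable lborel (\<lambda>p. indicator dom p * D p)"
    using integrable_mult_indicator[of dom lborel D] ge(3) open_dom by simp
  let ?I = "\<lambda>z. indicator (ball 0 1) z :: real"
  define U where "U h z = ?I z * (rot z \<bullet> h z / 2 + u z * divergence h z)" for h z
  define V where "V h z = ?I z * (- rot z \<bullet> h z / 2 + v z * divergence h z)" for h z
  define U' where "U' h z = ?I z * upper.\<omega> z (h z)" for h z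
  define V' where "V' h z = ?I z * lower.\<omega> z (h z)" for h z
  have ints: "integrable lborel (U h)" "integrable lborel (V h)" "integrable lborel (U' h)" "integrable lborel (V' h)"
    and vals: "integral\<^sup>L lborel (U h) = upper.flux h" "integral\<^sup>L lborel (V h) = lower.flux h"
      "integral\<^sup>L lborel (U' h) = upper.flux h" "integral\<^sup>L lborel (V' h) = lower.flux h"
    if "C1_on UNIV h" "\<And>z. r < norm z \<Longrightarrow> h z = 0" for h
    using upper.integrable_flux_divergence[OF that(1) r that(2)] lower.integrable_flux_divergence[OF that(1) r that(2)]
      upper.integrable_\<omega>[OF that(1) r that(2)] lower.integrable_\<omega>[OF that(1) r that(2)]
      upper.flux_eq_divergence[OF that(1) r that(2)] lower.flux_eq_divergence[OF that(1) r that(2)]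
    by (simp_all add: U_def[abs_def] V_def[abs_def] U'_def[abs_def] V'_def[abs_def] upper.flux_def lower.flux_def)
  have "(\<integral>p. indicator dom p * D p \<partial>lborel)
      = (\<integral>z. ?I z * (\<integral>t. indicator {- v z<..<u z} t * D (z, t) \<partial>lborel) \<partial>lborel)"
    by (rule integral_dom[OF int_D])
  \<comment> \<open>By the divergence theorem \<open>U h\<close> and \<open>U' h\<close> have the
    same integral, and so do \<open>V h\<close> and \<open>V' h\<close>. The two differences
    therefore integrate to zero; they absorb the cross terms of \<open>f\<close> with
    \<open>v\<close> and of \<open>g\<close> with \<open>u\<close>. The remaining four terms average
    to the two fluxes.\<close>
  also have "\<dots> = (\<integral>z. (U f z + U' f z + V g z + V' g z + (V f z - V' f z) + (U g z - U' g z)) / 2 \<partial>lborel)"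
  proof (rule Bochner_Integration.integral_cong[OF refl])
    fix z :: "'n hplane"
    show "?I z * (\<integral>t. indicator {- v z<..<u z} t * D (z, t) \<partial>lborel)
      = (U f z + U' f z + V g z + V' g z + (V f z - V' f z) + (U g z - U' g z)) / 2"
    proof (cases "norm z < 1")
      case True
      have L: "linear (fu z)" "linear (fv z)"
        unfolding fu_def fv_def using C1_onD(1)[OF u_C1, of z] C1_onD(1)[OF v_C1, of z] True has_derivative_linear by auto
      define A where "A = rot z \<bullet> (f z - g z) / 2 + fv z (f z - g z)"
      define B where "B = fu z (f z - g z) + fv z (f z - g z)"
      have "(\<integral>t. indicator {- v z<..<u z} t * D (z, t) \<partial>lborel)
        = (\<integral>t. indicator {- v z<..<u z} t * (pi / 2 * sin (pi * ((t + v z) / (u z + v z))) * ((A - (t + v z) / (u z + v z) * B) / (u z + v z))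
      + (1 - cos (pi * ((t + v z) / (u z + v z)))) / 2 * divergence f z + (1 + cos (pi * ((t + v z) / (u z + v z)))) / 2 * divergence g z) \<partial>lborel)"
      proof (rule Bochner_Integration.integral_cong[OF refl])
        fix t
        show "indicator {- v z<..<u z} t * D (z, t) = indicator {- v z<..<u z} t * (pi / 2 * sin (pi * ((t + v z) / (u z + v z))) * ((A - (t + v z) / (u z + v z) * B) / (u z + v z))
      + (1 - cos (pi * ((t + v z) / (u z + v z)))) / 2 * divergence f z + (1 + cos (pi * ((t + v z) / (u z + v z)))) / 2 * divergence g z)"
          using D_eq[of z t] True by (cases "t \<in> {- v z<..<u z}") (auto simp: dom_def A_def B_def \<tau>_def)
      qed
      also have "\<dots> = A - B / 2 + (u z + v z) / 2 * (divergence f z + divergence g z)"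
        by (rule integral_over_fibre[OF thick[OF True]])
      finally have eq: "(\<integral>t. indicator {- v z<..<u z} t * D (z, t) \<partial>lborel)
        = A - B / 2 + (u z + v z) / 2 * (divergence f z + divergence g z)" .
      show ?thesis
        unfolding eq A_def B_def U_def V_def U'_def V'_def upper.\<omega>_def lower.\<omega>_def fu_def[symmetric] fv_def[symmetric]
        using True by (simp add: linear_diff[OF L(1)] linear_diff[OF L(2)] inner_diff_right field_simps)
    qed (simp add: U_def V_def U'_def V'_def)
  qed
  also have "\<dots> = upper.flux f + lower.flux g"
    using ints[OF fC f0] ints[OF gC g0] vals[OF fC f0] vals[OF gC g0] by simp
  finally show ?thesis using ge(1) by simp
qed

lemma perimeter_lower_bound:
  "ereal (upper.bubble_flux + lower.bubble_flux) \<le> H_perimeter dom UNIV"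
proof -
  obtain f where f: "\<And>k::nat. unit_field (f k)" "(\<lambda>k. upper.flux (f k)) \<longlonglongrightarrow> upper.bubble_flux"
    using upper.obtain_calibration_sequence by metis
  obtain g where g: "\<And>k::nat. unit_field (g k)" "(\<lambda>k. lower.flux (g k)) \<longlonglongrightarrow> lower.bubble_flux"
    using lower.obtain_calibration_sequence by metis
  have "(\<lambda>k. ereal (upper.flux (f k) + lower.flux (g k))) \<longlonglongrightarrow> ereal (upper.bubble_flux + lower.bubble_flux)"
    by (intro tendsto_intros f g)
  then show ?thesis by (rule LIMSEQ_le_const2) (use flux_le_perimeter f(1) g(1) in auto)
qed

text \<open>The perimeter controls only the sum of the two fluxes. Keeping a calibrating sequence on
  one graph while the field on the other varies shows that each flux is maximal by itself, and the
  rigidity result then applies to \<open>u\<close> and \<open>v\<close> separately.\<close>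

lemma perimeter_minimal_imp_bubble:
  assumes eq: "H_perimeter dom UNIV = ereal (upper.bubble_flux + lower.bubble_flux)"
  shows "dom = E_opt"
proof -
  have le: "upper.flux f + lower.flux g \<le> upper.bubble_flux + lower.bubble_flux" if "unit_field f" "unit_field g" for f g
    using flux_le_perimeter[OF that] unfolding eq by simp
  obtain f where f: "\<And>k::nat. unit_field (f k)" "(\<lambda>k. upper.flux (f k)) \<longlonglongrightarrow> upper.bubble_flux"
    using upper.obtain_calibration_sequence by metis
  obtain g where g: "\<And>k::nat. unit_field (g k)" "(\<lambda>k. lower.flux (g k)) \<longlonglongrightarrow> lower.bubble_flux"
    using lower.obtain_calibration_sequence by metis
  have "upper.flux h \<le> upper.bubble_flux" if "unit_field h" for h
  proof -
    have "(\<lambda>k. upper.flux h + lower.flux (g k)) \<longlonglongrightarrow> upper.flux h + lower.bubble_flux"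
      by (intro tendsto_intros g)
    then have "upper.flux h + lower.bubble_flux \<le> upper.bubble_flux + lower.bubble_flux"
      by (rule LIMSEQ_le_const2) (use le[OF that g(1)] in auto)
    then show ?thesis by simp
  qed
  then have u: "u z = u_opt z" if "norm z < 1" for z
    using upper.maximal_flux_imp_bubble[OF _ that] by (simp add: u_opt_def)
  have "lower.flux h \<le> lower.bubble_flux" if "unit_field h" for h
  proof -
    have "(\<lambda>k. upper.flux (f k) + lower.flux h) \<longlonglongrightarrow> upper.bubble_flux + lower.flux h"
      by (intro tendsto_intros f)
    then have "upper.bubble_flux + lower.flux h \<le> upper.bubble_flux + lower.bubble_flux"
      by (rule LIMSEQ_le_const2) (use le[OF f(1) that] in auto)
    then show ?thesis by simp
  qed
  then have v: "v z = u_opt z" if "norm z < 1" for z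
    using lower.maximal_flux_imp_bubble[OF _ that] by (simp add: u_opt_def)
  show ?thesis by (auto simp: dom_def E_opt_def u v)
qed

end

section \<open>The perimeter of the bubble\<close>

lemma norm_sq_neq_1: "norm z < 1 \<Longrightarrow> (norm z)\<^sup>2 \<noteq> 1"
  using abs_square_less_1[of "norm z"] by simp

lemma u_opt_has_derivative:
  fixes z :: "'n::finite hplane"
  assumes z: "norm z < 1"
  shows "(u_opt has_derivative (\<lambda>h. - (norm z / (2 * sqrt (1 - (norm z)\<^sup>2)) * (z \<bullet> h)))) (at z)"
proof -
  define \<phi> where "\<phi> s = pi / 8 + s / 4 * sqrt (1 - s\<^sup>2) - 1 / 4 * arcsin s" for s :: real
  have d\<phi>: "(\<phi> has_real_derivative - (s\<^sup>2 / (2 * sqrt (1 - s\<^sup>2)))) (at s)" if "-1 < s" "s < 1" for s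
  proof -
    have s: "s\<^sup>2 < 1" using that by (simp add: abs_square_less_1)
    have r: "sqrt (1 - s\<^sup>2) > 0" "sqrt (1 - s\<^sup>2) * sqrt (1 - s\<^sup>2) = 1 - s\<^sup>2" using s by auto
    have "(\<phi> has_real_derivative (1 / 4 * sqrt (1 - s\<^sup>2) + (inverse (sqrt (1 - s\<^sup>2)) / 2 * (- (2 * s))) * (s / 4))
        - 1 / 4 * inverse (sqrt (1 - s\<^sup>2))) (at s)"
      unfolding \<phi>_def using s that by (auto intro!: derivative_eq_intros)
    moreover have "(1 / 4 * sqrt (1 - s\<^sup>2) + (inverse (sqrt (1 - s\<^sup>2)) / 2 * (- (2 * s))) * (s / 4))
        - 1 / 4 * inverse (sqrt (1 - s\<^sup>2)) = - (s\<^sup>2 / (2 * sqrt (1 - s\<^sup>2)))"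
      using r by (simp add: field_simps power2_eq_square)
    ultimately show ?thesis by simp
  qed
  have u: "u_opt = (\<lambda>z :: 'n hplane. \<phi> (norm z))" by (simp add: fun_eq_iff u_opt_def \<phi>_def)
  show ?thesis
  proof (cases "z = 0")
    case False
    have "((\<lambda>z. \<phi> (norm z)) has_derivative (\<lambda>h. - ((norm z)\<^sup>2 / (2 * sqrt (1 - (norm z)\<^sup>2))) * (sgn z \<bullet> h))) (at z)"
      using has_derivative_compose[OF has_derivative_norm[OF False] d\<phi>[of "norm z", unfolded has_field_derivative_def]]
        z order.strict_trans2[OF _ norm_ge_zero[of z], of "-1"] by (simp add: inner_commute)
    then show ?thesis
      unfolding u by (rule has_derivative_eq_rhs)
        (use False in \<open>auto simp: fun_eq_iff sgn_div_norm power2_eq_square field_simps\<close>)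
  next
    \<comment> \<open>The norm is not differentiable at the origin, but \<phi> has derivative 0
      there, so the composition is differentiable with derivative 0.\<close>
    case True
    have "((\<lambda>s. (\<phi> (0 + s) - \<phi> 0) / s) \<longlongrightarrow> 0) (at 0)"
      using d\<phi>[of 0] by (simp add: DERIV_def)
    moreover have "filterlim norm (at 0) (at (0::'n hplane))"
      unfolding filterlim_at by (auto intro!: tendsto_eq_intros simp: eventually_at_filter)
    ultimately have "((\<lambda>h :: 'n hplane. (\<phi> (0 + norm h) - \<phi> 0) / norm h) \<longlongrightarrow> 0) (at 0)"
      by (rule filterlim_compose)
    then have "((\<lambda>h :: 'n hplane. norm ((\<phi> (0 + norm h) - \<phi> 0) / norm h)) \<longlongrightarrow> 0) (at 0)"
      by (rule tendsto_norm_zero)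
    then show ?thesis
      unfolding u True has_derivative_at by (simp add: norm_divide)
  qed
qed

lemma u_opt_C1: "C1_on (ball 0 1) (u_opt :: 'n::finite hplane \<Rightarrow> real)"
proof (rule C1_onI)
  show "(u_opt has_derivative (\<lambda>h. - (norm z / (2 * sqrt (1 - (norm z)\<^sup>2)) * (z \<bullet> h)))) (at z)"
    if "z \<in> ball 0 1" for z :: "'n hplane"
    using u_opt_has_derivative[of z] that by simp
  show "continuous_on (ball 0 1) (\<lambda>z :: 'n hplane. - (norm z / (2 * sqrt (1 - (norm z)\<^sup>2)) * (z \<bullet> h)))" for h
    by (intro continuous_intros) (auto simp: norm_sq_neq_1)
qed

lemma u_opt_continuous: "continuous_on (cball 0 1) (u_opt :: 'n::finite hplane \<Rightarrow> real)"
proof -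
  have *: "-1 \<le> norm z" for z :: "'n hplane" using norm_ge_zero[of z] by linarith
  show ?thesis unfolding u_opt_def by (intro continuous_intros) (use * in auto)
qed

lemma u_opt_boundary: "norm z = 1 \<Longrightarrow> u_opt z = 0"
  by (simp add: u_opt_def)

lemma u_opt_pos:
  assumes "norm z < 1"
  shows "0 < u_opt z"
proof -
  have n: "-1 \<le> norm z" using norm_ge_zero[of z] by linarith
  have "arcsin (norm z) < pi / 2"
    using assms n arcsin_less_arcsin[of "norm z" 1] by simp
  moreover have "0 \<le> norm z / 4 * sqrt (1 - (norm z)\<^sup>2)"
    using assms by (intro mult_nonneg_nonneg) (auto simp: abs_square_le_1)
  ultimately show ?thesis by (simp add: u_opt_def)
qed

text \<open>The bubble is itself a domain of this kind, which provides its openness and its volume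
  formula.\<close>

interpretation opt: graph_domain "u_opt :: 'n::finite hplane \<Rightarrow> real" u_opt
proof
  show "0 < u_opt z + u_opt z" if "norm z < 1" for z :: "'n hplane" using u_opt_pos[OF that] by simp
qed (auto intro: u_opt_C1 u_opt_continuous u_opt_boundary)

lemma dom_opt: "opt.dom = E_opt"
  by (auto simp: opt.dom_def E_opt_def)

section \<open>An upper bound for the perimeter of the bubble\<close>

lemma norm_frame_sum: "norm (\<Sum>j\<in>UNIV. c j *\<^sub>R (frame j :: 'n::finite hplane)) = sqrt (\<Sum>j\<in>UNIV. (c j)\<^sup>2)"
proof -
  have f: "frame i \<bullet> (frame j :: 'n hplane) = (if i = j then 1 else 0)" for i j :: "'n + 'n"
    by (auto simp: frame_def inner_axis_axis split: sum.split)
  have "(\<Sum>j\<in>UNIV. c j *\<^sub>R (frame j :: 'n hplane)) \<bullet> (\<Sum>j\<in>UNIV. c j *\<^sub>R frame j) = (\<Sum>j\<in>UNIV. (c j)\<^sup>2)"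
    by (simp add: inner_sum_left inner_sum_right power2_eq_square f if_distrib[where f = "\<lambda>x. _ * x"] cong: if_cong)
  then show ?thesis by (simp add: norm_eq_sqrt_inner)
qed

lemma compactly_supported_imp_bounded_support:
  fixes f :: "'a::euclidean_space \<Rightarrow> real"
  assumes "compactly_supported_in UNIV f"
  obtains r where "\<And>g. r < norm g \<Longrightarrow> f g = 0"
proof -
  have "bounded {x. f x \<noteq> 0}"
    using assms bounded_closure[of "{x. f x \<noteq> 0}"] by (simp add: compactly_supported_in_def)
  then obtain r where "\<And>x. f x \<noteq> 0 \<Longrightarrow> norm x \<le> r" unfolding bounded_iff by auto
  then show ?thesis using that by (meson not_le)
qed

text \<open>
  Integrating by parts against a smoothed indicator function avoids traces on the boundary: its horizontal
  total variation is computed by Tonelli's theorem and is bounded by the area of the two graphs.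
\<close>
lemma smoothed_perimeter_bound:
  fixes \<zeta> :: "'n::finite + 'n \<Rightarrow> 'n heis \<Rightarrow> real" and A \<epsilon> :: real
  assumes \<zeta>: "\<zeta> \<in> horizontal_test_fields UNIV"
    and area: "(\<integral>\<^sup>+z. indicator (ball 0 1) z * ennreal (norm z / sqrt (1 - (norm z)\<^sup>2)) \<partial>(lborel :: 'n hplane measure)) = ennreal A"
    and A: "0 \<le> A" and \<epsilon>: "0 < \<epsilon>"
    and S: "\<And>x. (S has_real_derivative S' x) (at x)" "continuous_on UNIV S'"
      "\<And>x. 0 \<le> S x" "\<And>x. S x \<le> 1" "\<And>x. 0 \<le> S' x" "\<And>x. x \<le> 0 \<Longrightarrow> S x = 0" "\<And>x. 1 \<le> x \<Longrightarrow> S x = 1"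
      "\<And>x. x \<le> 0 \<or> 1 \<le> x \<Longrightarrow> S' x = 0"
  defines "\<phi> \<equiv> \<lambda>p :: 'n heis. if p \<in> ball 0 1 \<times> UNIV then
      S ((u_opt (fst p) - snd p) / \<epsilon> - 1) * S ((u_opt (fst p) + snd p) / \<epsilon> - 1) else 0"
  shows "(\<integral>p. \<phi> p * (\<Sum>j\<in>UNIV. X_deriv j (\<zeta> j) p) \<partial>lborel) \<le> A" and "continuous_on UNIV \<phi>"
proof -
  let ?B = "ball 0 1 \<times> UNIV :: 'n heis set"
  \<comment> \<open>\<open>m\<close> rises from 0 at \<epsilon> to 1 at 2 \<epsilon>. The smoothed
    indicator thus vanishes within vertical distance \<epsilon> of the graphs, and its derivative
    lives in the two layers between the distances \<epsilon> and 2 \<epsilon>.\<close>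
  define m where "m x = S (x / \<epsilon> - 1)" for x
  define m' where "m' x = S' (x / \<epsilon> - 1) / \<epsilon>" for x
  have dm: "(m has_real_derivative m' x) (at x)" for x
    unfolding m_def m'_def
    by (rule DERIV_cong[OF DERIV_chain2[OF S(1)]]) (use \<epsilon> in \<open>auto intro!: derivative_eq_intros\<close>)
  have m'c: "continuous_on UNIV m'"
    unfolding m'_def using \<epsilon> by (intro continuous_intros continuous_on_compose2[OF S(2)]) auto
  have m01: "0 \<le> m x" "m x \<le> 1" "0 \<le> m' x" for x using S \<epsilon> by (auto simp: m_def m'_def)
  have m0: "m x = 0" if "x \<le> \<epsilon>" for x unfolding m_def by (rule S(6)) (use that \<epsilon> in simp)
  have m'0: "m' x = 0" if "x \<le> \<epsilon> \<or> 2 * \<epsilon> \<le> x" for x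
    using S(8)[of "x / \<epsilon> - 1"] that \<epsilon> by (simp add: m'_def field_simps)
  define q where "q p = m (u_opt (fst p) - snd p) * m (u_opt (fst p) + snd p)" for p :: "'n heis"
  have \<phi>q: "\<phi> = (\<lambda>p. if p \<in> ?B then q p else 0)" unfolding \<phi>_def q_def m_def by simp
  have B_open: "open ?B" by (intro open_Times) auto
  have lin: "bounded_linear (fst :: 'n heis \<Rightarrow> _)" "bounded_linear (snd :: 'n heis \<Rightarrow> _)"
    by (rule bounded_linear_fst bounded_linear_snd)+
  \<comment> \<open>The largest radius at which \<open>u_opt\<close> still reaches \<epsilon>,
    attained by compactness. Beyond it the fibre is too short for both factors of \<open>q\<close>
    to be nonzero.\<close>
  obtain \<rho> where \<rho>: "\<rho> < 1" "\<And>z :: 'n hplane. \<rho> < norm z \<Longrightarrow> norm z < 1 \<Longrightarrow> u_opt z < \<epsilon>"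
  proof -
    define T where "T = {z \<in> cball (0 :: 'n hplane) 1. \<epsilon> \<le> u_opt z}"
    have "closed T" unfolding T_def
      using continuous_on_closed_Collect_le[OF continuous_on_const u_opt_continuous closed_cball, of \<epsilon>] by simp
    moreover have "bounded T" by (rule bounded_subset[OF bounded_cball[of 0 1]]) (auto simp: T_def)
    ultimately have "compact T" by (simp add: compact_eq_bounded_closed)
    show ?thesis
    proof (cases "T = {}")
      case True
      have "u_opt z < \<epsilon>" if "norm z < 1" for z :: "'n hplane"
      proof (rule ccontr)
        assume "\<not> u_opt z < \<epsilon>"
        then have "z \<in> T" using that by (simp add: T_def)
        then show False using True by simp
      qed
      then show ?thesis by (intro that[of 0]) simp_all
    next
      case False
      then obtain z0 where z0: "z0 \<in> T" "\<And>z. z \<in> T \<Longrightarrow> norm z \<le> norm z0"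
        using continuous_attains_sup[OF \<open>compact T\<close> False continuous_on_norm[OF continuous_on_id]] by auto
      have "norm z0 \<noteq> 1" using z0(1) u_opt_boundary[of z0] \<epsilon> by (auto simp: T_def)
      then have "norm z0 < 1" using z0(1) by (auto simp: T_def)
      moreover have "u_opt z < \<epsilon>" if "norm z0 < norm z" "norm z < 1" for z :: "'n hplane"
      proof (rule ccontr)
        assume "\<not> u_opt z < \<epsilon>"
        then have "z \<in> T" using that by (simp add: T_def)
        then show False using z0(2)[of z] that by simp
      qed
      ultimately show ?thesis by (rule that)
    qed
  qed
  have q0: "q p = 0" if "norm (fst p) < 1" "u_opt (fst p) \<le> \<epsilon>" for p
  proof -
    have "u_opt (fst p) - snd p \<le> \<epsilon> \<or> u_opt (fst p) + snd p \<le> \<epsilon>" using that by linarith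
    then show ?thesis unfolding q_def using m0[of "u_opt (fst p) - snd p"] m0[of "u_opt (fst p) + snd p"] by auto
  qed
  have uC: "C1_on ?B (\<lambda>p. u_opt (fst p))" by (rule C1_on_compose_linear[OF u_opt_C1 lin(1)]) auto
  have sndC: "C1_on ?B (\<lambda>p. snd p)" by (rule C1_on_bounded_linear[OF lin(2)])
  have qC: "C1_on ?B q"
    unfolding q_def
    by (rule C1_on_mult[OF C1_on_compose_real[OF C1_on_diff[OF uC sndC] dm m'c]
        C1_on_compose_real[OF C1_on_add[OF uC sndC] dm m'c]]) auto
  have \<phi>C: "C1_on UNIV \<phi>"
    unfolding \<phi>q
  proof (rule C1_on_extend_zero[OF qC B_open])
    show "closed (cball 0 \<rho> \<times> UNIV :: 'n heis set)" by (intro closed_Times) auto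
    show "cball 0 \<rho> \<times> UNIV \<subseteq> ?B" using \<rho>(1) by auto
    show "q p = 0" if "p \<in> ?B - cball 0 \<rho> \<times> UNIV" for p
      using that by (intro q0 less_imp_le[OF \<rho>(2)]) (auto simp: mem_Times_iff)
  qed
  show \<phi>c: "continuous_on UNIV \<phi>" by (rule C1_on_imp_continuous_on[OF \<phi>C])
  define X\<phi> where "X\<phi> j p = frechet_derivative \<phi> (at p) (X_field j p)" for j p
  have X\<phi>c: "continuous_on UNIV (X\<phi> j)" for j
    unfolding X\<phi>_def by (rule C1_on_continuous_derivative[OF \<phi>C continuous_on_X_field])
  have dX\<phi>: "((\<lambda>s. \<phi> (p + s *\<^sub>R X_field j p)) has_real_derivative X\<phi> j p) (at 0)" for j p
  proof -
    have L: "linear (frechet_derivative \<phi> (at p))"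
      using C1_onD(1)[OF \<phi>C] has_derivative_linear by blast
    have "((\<lambda>s. p + s *\<^sub>R X_field j p) has_derivative (\<lambda>s. s *\<^sub>R X_field j p)) (at 0)"
      by (auto intro!: derivative_eq_intros)
    then have "((\<lambda>s. \<phi> (p + s *\<^sub>R X_field j p)) has_derivative (\<lambda>s. frechet_derivative \<phi> (at p) (s *\<^sub>R X_field j p))) (at 0)"
      by (rule has_derivative_compose) (use C1_onD(1)[OF \<phi>C, of p] in simp)
    then show ?thesis
      unfolding has_field_derivative_def X\<phi>_def
      by (rule has_derivative_eq_rhs) (auto simp: linear_cmul[OF L] mult.commute)
  qed
  have \<zeta>c: "continuous_on UNIV (\<zeta> j)" "compactly_supported_in UNIV (\<zeta> j)" "X_differentiable j (\<zeta> j)"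
      "continuous_on UNIV (X_deriv j (\<zeta> j))" for j
    using \<zeta> unfolding horizontal_test_fields_def by auto
  have \<zeta>n: "sqrt (\<Sum>j\<in>UNIV. (\<zeta> j p)\<^sup>2) \<le> 1" for p
    using \<zeta> unfolding horizontal_test_fields_def by blast
  have X\<zeta>: "((\<lambda>s. \<zeta> j (p + s *\<^sub>R X_field j p)) has_real_derivative X_deriv j (\<zeta> j) p) (at 0)" for j p
    unfolding X_deriv_def DERIV_deriv_iff_real_differentiable
    using \<zeta>c(3)[of j] unfolding X_differentiable_def by (rule spec)
  \<comment> \<open>Integration by parts: the frame flow preserves Lebesgue measure, so the
    derivative of the product along it has integral zero. The product inherits the bounded support
    of \<open>\<zeta> j\<close>.\<close>
  have parts: "integrable lborel (\<lambda>p. \<phi> p * X_deriv j (\<zeta> j) p) \<and> integrable lborel (\<lambda>p. X\<phi> j p * \<zeta> j p)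
      \<and> (\<integral>p. \<phi> p * X_deriv j (\<zeta> j) p \<partial>lborel) = - (\<integral>p. X\<phi> j p * \<zeta> j p \<partial>lborel)" for j
  proof -
    obtain r where r: "\<And>p. r < norm p \<Longrightarrow> \<zeta> j p = 0"
      using compactly_supported_imp_bounded_support[OF \<zeta>c(2)[of j]] by blast
    have D: "((\<lambda>s. \<phi> (p + s *\<^sub>R X_field j p) * \<zeta> j (p + s *\<^sub>R X_field j p)) has_real_derivative
        X\<phi> j p * \<zeta> j p + \<phi> p * X_deriv j (\<zeta> j) p) (at 0)" for p
      using DERIV_mult[OF dX\<phi> X\<zeta>] by (simp add: mult.commute)
    have c: "continuous_on UNIV (\<lambda>p. \<phi> p * \<zeta> j p)" "continuous_on UNIV (\<lambda>p. X\<phi> j p * \<zeta> j p + \<phi> p * X_deriv j (\<zeta> j) p)"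
      "continuous_on UNIV (\<lambda>p. X\<phi> j p * \<zeta> j p)"
      by (intro continuous_intros \<phi>c \<zeta>c X\<phi>c)+
    have s: "\<phi> p * \<zeta> j p = 0" if "r < norm p" for p using r[OF that] by simp
    note flow = integral_derivative_along_flow[OF continuous_on_X_field X_field_translate lborel_distr_X_flow c(1,2) D s]
    have i1: "integrable lborel (\<lambda>p. X\<phi> j p * \<zeta> j p)"
      by (rule integrable_continuous_bounded_support[OF c(3), of r]) (simp add: r)
    have i2: "integrable lborel (\<lambda>p. \<phi> p * X_deriv j (\<zeta> j) p)"
      using Bochner_Integration.integrable_diff[OF flow(1) i1] by simp
    have "(\<integral>p. X\<phi> j p * \<zeta> j p + \<phi> p * X_deriv j (\<zeta> j) p \<partial>lborel) = 0" by (rule flow(2))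
    then show ?thesis using i1 i2 by simp
  qed
  \<comment> \<open>Cauchy-Schwarz for the horizontal gradient of the smoothed indicator. Each of
    its two terms is a derivative of \<open>m\<close> times a vector of length |z| / (2 sqrt (1 -
    |z|^2)), with the other factor of \<open>q\<close> at most 1.\<close>
  have bound: "- (\<Sum>j\<in>UNIV. X\<phi> j p * \<zeta> j p) \<le> indicator ?B p * (norm (fst p) / (2 * sqrt (1 - (norm (fst p))\<^sup>2))
      * (m' (u_opt (fst p) - snd p) + m' (u_opt (fst p) + snd p)))" for p
  proof (cases "norm (fst p) < 1")
    case False
    have "((\<lambda>_. 0) has_derivative (\<lambda>_. 0)) (at p)" by (rule has_derivative_const)
    then have "(\<phi> has_derivative (\<lambda>_. 0)) (at p)"
    proof (rule has_derivative_transform_within_open)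
      show "open (- (cball 0 \<rho> \<times> UNIV) :: 'n heis set)" by (intro open_Compl closed_Times) auto
      show "p \<in> - (cball 0 \<rho> \<times> UNIV)" using False \<rho>(1) by (auto simp: mem_Times_iff)
      show "0 = \<phi> y" if "y \<in> - (cball 0 \<rho> \<times> UNIV)" for y
      proof (cases "norm (fst y) < 1")
        case True
        then have "u_opt (fst y) \<le> \<epsilon>" using that by (intro less_imp_le[OF \<rho>(2)]) (auto simp: mem_Times_iff)
        with q0[OF True] show ?thesis by (simp add: \<phi>q)
      qed (simp add: \<phi>q mem_Times_iff)
    qed
    then have "frechet_derivative \<phi> (at p) = (\<lambda>_. 0)" using frechet_derivative_at by metis
    then show ?thesis using False by (simp add: X\<phi>_def mem_Times_iff indicator_def)
  next
    case True
    define z t where "z = fst p" and "t = snd p"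
    have p: "p = (z, t)" by (simp add: z_def t_def)
    have z: "norm z < 1" using True by (simp add: z_def)
    define a where "a = norm z / (2 * sqrt (1 - (norm z)\<^sup>2))"
    have du: "((\<lambda>p. u_opt (fst p)) has_derivative (\<lambda>h. - (a * (z \<bullet> fst h)))) (at (z, t))"
      using has_derivative_compose[OF bounded_linear_imp_has_derivative[OF lin(1)], of u_opt _ "(z, t)"]
        u_opt_has_derivative[OF z] by (simp add: a_def)
    have ds: "(snd has_derivative snd) (at (z, t))" by (rule bounded_linear_imp_has_derivative[OF lin(2)])
    let ?\<alpha> = "m' (u_opt z - t)" and ?\<beta> = "m' (u_opt z + t)"
    have d1: "((\<lambda>p. m (u_opt (fst p) - snd p)) has_derivative (\<lambda>h. ?\<alpha> * (- (a * (z \<bullet> fst h)) - snd h))) (at (z, t))"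
      using has_derivative_compose[OF has_derivative_diff[OF du ds], of m] dm[of "u_opt z - t", unfolded has_field_derivative_def]
      by simp
    have d2: "((\<lambda>p. m (u_opt (fst p) + snd p)) has_derivative (\<lambda>h. ?\<beta> * (- (a * (z \<bullet> fst h)) + snd h))) (at (z, t))"
      using has_derivative_compose[OF has_derivative_add[OF du ds], of m] dm[of "u_opt z + t", unfolded has_field_derivative_def]
      by simp
    have "(q has_derivative (\<lambda>h. m (u_opt z - t) * (?\<beta> * (- (a * (z \<bullet> fst h)) + snd h))
        + ?\<alpha> * (- (a * (z \<bullet> fst h)) - snd h) * m (u_opt z + t))) (at (z, t))"
      unfolding q_def[abs_def] using has_derivative_mult[OF d1 d2] by simp
    then have "(\<phi> has_derivative (\<lambda>h. m (u_opt z - t) * (?\<beta> * (- (a * (z \<bullet> fst h)) + snd h))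
        + ?\<alpha> * (- (a * (z \<bullet> fst h)) - snd h) * m (u_opt z + t))) (at (z, t))"
      by (rule has_derivative_transform_within_open[OF _ B_open]) (use z in \<open>auto simp: \<phi>q\<close>)
    note fd = frechet_derivative_at[OF this, symmetric]
    have X: "X\<phi> j p = m (u_opt z - t) * (?\<beta> * ((- a *\<^sub>R z + (1 / 2) *\<^sub>R rot z) \<bullet> frame j))
        + ?\<alpha> * ((- a *\<^sub>R z + (- 1 / 2) *\<^sub>R rot z) \<bullet> frame j) * m (u_opt z + t)" for j
      unfolding X\<phi>_def p fd by (simp add: X_field_eq inner_add_left inner_diff_left)
    define Z where "Z = (\<Sum>j\<in>UNIV. \<zeta> j p *\<^sub>R (frame j :: 'n hplane))"
    have Z: "norm Z \<le> 1" unfolding Z_def norm_frame_sum by (rule \<zeta>n)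
    \<comment> \<open>The squares of the two orthogonal coefficients add up to 1 / (4 (1 - |z|^2)).
      The sign of \<open>b\<close> distinguishes the lower graph from the upper one.\<close>
    have W: "norm (- a *\<^sub>R z + b *\<^sub>R rot z) = norm z / (2 * sqrt (1 - (norm z)\<^sup>2))" if b: "b\<^sup>2 = 1 / 4" for b
    proof -
      have s: "(norm z)\<^sup>2 < 1" using z by (simp add: abs_square_less_1)
      have "(- a)\<^sup>2 + b\<^sup>2 = (norm z)\<^sup>2 / (4 * (1 - (norm z)\<^sup>2)) + 1 / 4"
        using s b by (simp add: a_def power_divide power_mult_distrib)
      also have "\<dots> = 1 / (4 * (1 - (norm z)\<^sup>2))" using s by (simp add: field_simps)
      finally have "sqrt ((- a)\<^sup>2 + b\<^sup>2) = 1 / (2 * sqrt (1 - (norm z)\<^sup>2))"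
        using s by (intro real_sqrt_unique) (simp_all only: power_divide power_mult_distrib, auto)
      then show ?thesis using rot.norm_combination[of "- a" z b] by simp
    qed
    have CS: "- (V \<bullet> Z) \<le> norm V" for V
      using norm_cauchy_schwarz[of "- V" Z] mult_left_mono[OF Z, of "norm V"] by simp
    have "- (\<Sum>j\<in>UNIV. X\<phi> j p * \<zeta> j p) = m (u_opt z - t) * ?\<beta> * - ((- a *\<^sub>R z + (1 / 2) *\<^sub>R rot z) \<bullet> Z)
        + ?\<alpha> * m (u_opt z + t) * - ((- a *\<^sub>R z + (- 1 / 2) *\<^sub>R rot z) \<bullet> Z)"
      unfolding X Z_def inner_sum_right sum_negf[symmetric] sum_distrib_left sum.distrib[symmetric]
      by (intro sum.cong refl) (simp add: algebra_simps)
    also have "\<dots> \<le> m (u_opt z - t) * ?\<beta> * (norm z / (2 * sqrt (1 - (norm z)\<^sup>2)))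
        + ?\<alpha> * m (u_opt z + t) * (norm z / (2 * sqrt (1 - (norm z)\<^sup>2)))"
      using CS[of "- a *\<^sub>R z + (1 / 2) *\<^sub>R rot z"] CS[of "- a *\<^sub>R z + (- 1 / 2) *\<^sub>R rot z"] m01
        W[of "1 / 2"] W[of "- 1 / 2"]
      by (intro add_mono mult_left_mono mult_nonneg_nonneg) (auto simp: power_divide)
    also have "\<dots> \<le> 1 * ?\<beta> * (norm z / (2 * sqrt (1 - (norm z)\<^sup>2))) + ?\<alpha> * 1 * (norm z / (2 * sqrt (1 - (norm z)\<^sup>2)))"
      using m01 z by (intro add_mono mult_right_mono mult_left_mono divide_nonneg_nonneg) (auto simp: abs_square_le_1)
    finally show ?thesis using z by (simp add: p algebra_simps add_divide_distrib)
  qed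
  \<comment> \<open>\<open>m'\<close> has integral 1, so each of the two layers has total weight 1
    on every fibre. This is what makes the bound independent of \<epsilon>.\<close>
  have fibre: "(\<integral>\<^sup>+t. ennreal (m' (c - t)) \<partial>lborel) = 1" "(\<integral>\<^sup>+t. ennreal (m' (c + t)) \<partial>lborel) = 1" for c
  proof -
    have meas[measurable]: "m' \<in> borel_measurable borel" by (rule borel_measurable_continuous_onI[OF m'c])
    have one: "m (2 * \<epsilon>) = 1" unfolding m_def by (rule S(7)) (use \<epsilon> in simp)
    have "(\<integral>\<^sup>+t. ennreal (m' (c - t)) \<partial>lborel) = (\<integral>\<^sup>+t. ennreal (m' (c - t)) * indicator {c - 2 * \<epsilon>..c - \<epsilon>} t \<partial>lborel)"
      by (intro nn_integral_cong) (auto simp: indicator_def m'0)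
    also have "\<dots> = ennreal (- m (c - (c - \<epsilon>)) - - m (c - (c - 2 * \<epsilon>)))"
    proof (rule nn_integral_FTC_Icc)
      show "((\<lambda>t. - m (c - t)) has_real_derivative m' (c - t)) (at t)" for t
        by (rule DERIV_cong[OF DERIV_minus[OF DERIV_chain2[OF dm]]]) (auto intro!: derivative_eq_intros)
    qed (use m01 \<epsilon> in auto)
    also have "\<dots> = 1" using m0[of \<epsilon>] one by simp
    finally show "(\<integral>\<^sup>+t. ennreal (m' (c - t)) \<partial>lborel) = 1" .
    have "(\<integral>\<^sup>+t. ennreal (m' (c + t)) \<partial>lborel) = (\<integral>\<^sup>+t. ennreal (m' (c + t)) * indicator {\<epsilon> - c..2 * \<epsilon> - c} t \<partial>lborel)"
      by (intro nn_integral_cong) (auto simp: indicator_def m'0)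
    also have "\<dots> = ennreal (m (c + (2 * \<epsilon> - c)) - m (c + (\<epsilon> - c)))"
    proof (rule nn_integral_FTC_Icc)
      show "((\<lambda>t. m (c + t)) has_real_derivative m' (c + t)) (at t)" for t
        by (rule DERIV_cong[OF DERIV_chain2[OF dm]]) (auto intro!: derivative_eq_intros)
    qed (use m01 \<epsilon> in auto)
    also have "\<dots> = 1" using m0[of \<epsilon>] one by simp
    finally show "(\<integral>\<^sup>+t. ennreal (m' (c + t)) \<partial>lborel) = 1" .
  qed
  define R where "R p = indicator ?B p * (norm (fst p) / (2 * sqrt (1 - (norm (fst p))\<^sup>2))
      * (m' (u_opt (fst p) - snd p) + m' (u_opt (fst p) + snd p)))" for p :: "'n heis"
  have Rc: "continuous_on ?B (\<lambda>p. norm (fst p) / (2 * sqrt (1 - (norm (fst p))\<^sup>2))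
      * (m' (u_opt (fst p) - snd p) + m' (u_opt (fst p) + snd p)))"
    by (intro continuous_intros continuous_on_compose2[OF m'c] continuous_on_compose2[OF u_opt_continuous])
      (auto simp: norm_sq_neq_1)
  have R_meas: "R \<in> borel_measurable borel"
    using borel_measurable_continuous_on_indicator[OF _ Rc] B_open by (simp add: R_def[abs_def])
  have R_nonneg: "0 \<le> R p" for p
    using m01 by (cases p) (auto simp: R_def indicator_def abs_square_le_1 intro!: mult_nonneg_nonneg divide_nonneg_nonneg add_nonneg_nonneg)
  have "(\<integral>\<^sup>+p. ennreal (R p) \<partial>lborel) = (\<integral>\<^sup>+z. \<integral>\<^sup>+t. ennreal (R (z, t)) \<partial>lborel \<partial>lborel)"
    unfolding lborel_prod[symmetric]
    by (rule lborel.nn_integral_fst[symmetric]) (use R_meas in \<open>simp add: lborel_prod\<close>)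
  also have "\<dots> = (\<integral>\<^sup>+z. indicator (ball 0 1) z * ennreal (norm z / sqrt (1 - (norm z)\<^sup>2)) \<partial>(lborel :: 'n hplane measure))"
  proof (intro nn_integral_cong)
    fix z :: "'n hplane"
    have meas[measurable]: "m' \<in> borel_measurable borel" by (rule borel_measurable_continuous_onI[OF m'c])
    show "(\<integral>\<^sup>+t. ennreal (R (z, t)) \<partial>lborel) = indicator (ball 0 1) z * ennreal (norm z / sqrt (1 - (norm z)\<^sup>2))"
    proof (cases "norm z < 1")
      case True
      let ?w = "norm z / (2 * sqrt (1 - (norm z)\<^sup>2))"
      have w: "0 \<le> ?w" using True by (intro divide_nonneg_nonneg) (auto simp: abs_square_le_1)
      have "(\<integral>\<^sup>+t. ennreal (R (z, t)) \<partial>lborel) = (\<integral>\<^sup>+t. ennreal ?w * (ennreal (m' (u_opt z - t)) + ennreal (m' (u_opt z + t))) \<partial>lborel)"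
      proof (intro nn_integral_cong)
        fix t
        have "R (z, t) = ?w * (m' (u_opt z - t) + m' (u_opt z + t))" using True by (simp add: R_def)
        then show "ennreal (R (z, t)) = ennreal ?w * (ennreal (m' (u_opt z - t)) + ennreal (m' (u_opt z + t)))"
          by (simp only: ennreal_mult[OF w add_nonneg_nonneg[OF m01(3) m01(3)]] ennreal_plus[OF m01(3) m01(3)])
      qed
      also have "\<dots> = ennreal ?w * ((\<integral>\<^sup>+t. ennreal (m' (u_opt z - t)) \<partial>lborel) + (\<integral>\<^sup>+t. ennreal (m' (u_opt z + t)) \<partial>lborel))"
        by (simp add: nn_integral_cmult nn_integral_add)
      also have "\<dots> = ennreal ?w * ennreal 2" by (simp add: fibre one_add_one)
      also have "\<dots> = ennreal (norm z / sqrt (1 - (norm z)\<^sup>2))"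
        using w by (subst ennreal_mult[symmetric]) (auto simp: field_simps)
      finally show ?thesis using True by simp
    qed (simp add: R_def)
  qed
  finally have R_int: "(\<integral>\<^sup>+p. ennreal (R p) \<partial>lborel) = ennreal A" using area by simp
  have R_bint: "has_bochner_integral lborel R A"
    by (rule has_bochner_integral_nn_integral) (use R_meas R_nonneg A R_int in auto)
  have "(\<integral>p. \<phi> p * (\<Sum>j\<in>UNIV. X_deriv j (\<zeta> j) p) \<partial>lborel) = (\<Sum>j\<in>UNIV. \<integral>p. \<phi> p * X_deriv j (\<zeta> j) p \<partial>lborel)"
    unfolding sum_distrib_left by (rule Bochner_Integration.integral_sum) (use parts in auto)
  also have "\<dots> = (\<integral>p. - (\<Sum>j\<in>UNIV. X\<phi> j p * \<zeta> j p) \<partial>lborel)"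
    using parts by (simp add: sum_negf Bochner_Integration.integral_sum)
  also have "\<dots> \<le> integral\<^sup>L lborel R"
    by (rule integral_mono) (use parts R_bint bound in \<open>auto simp: has_bochner_integral_iff R_def\<close>)
  also have "\<dots> = A" using R_bint by (simp add: has_bochner_integral_iff)
  finally show "(\<integral>p. \<phi> p * (\<Sum>j\<in>UNIV. X_deriv j (\<zeta> j) p) \<partial>lborel) \<le> A" .
qed

text \<open>The smoothed indicators converge everywhere to the indicator of \<open>E_opt\<close>:
  the strict inequalities make them eventually 1 at a point inside, and outside they are 0 for every
  \<open>k\<close>. The uniform bound passes to the limit by dominated convergence.\<close>

lemma H_perimeter_E_opt_le:
  assumes area: "(\<integral>\<^sup>+z. indicator (ball 0 1) z * ennreal (norm z / sqrt (1 - (norm z)\<^sup>2)) \<partial>(lborel :: 'n::finite hplane measure)) = ennreal A"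
    and A: "0 \<le> A"
  shows "H_perimeter (E_opt :: 'n heis set) UNIV \<le> ereal A"
  unfolding H_perimeter_def
proof (rule SUP_least)
  fix \<zeta> :: "'n + 'n \<Rightarrow> 'n heis \<Rightarrow> real" assume \<zeta>: "\<zeta> \<in> horizontal_test_fields UNIV"
  obtain S S' where S: "\<And>x. (S has_real_derivative S' x) (at x)" "continuous_on UNIV S'"
      "\<And>x. 0 \<le> S x" "\<And>x. S x \<le> 1" "\<And>x. 0 \<le> S' x" "\<And>x. x \<le> 0 \<Longrightarrow> S x = 0" "\<And>x. 1 \<le> x \<Longrightarrow> S x = 1"
      "\<And>x. x \<le> 0 \<or> 1 \<le> x \<Longrightarrow> S' x = 0"
    using obtain_smoothstep by metis
  define D where "D p = (\<Sum>j\<in>UNIV. X_deriv j (\<zeta> j) p)" for p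
  have \<zeta>c: "continuous_on UNIV (X_deriv j (\<zeta> j))" "compactly_supported_in UNIV (X_deriv j (\<zeta> j))" for j
    using \<zeta> unfolding horizontal_test_fields_def by auto
  have Dc: "continuous_on UNIV D" unfolding D_def by (intro continuous_intros \<zeta>c)
  have D_int: "integrable lborel D"
    unfolding D_def
  proof (rule Bochner_Integration.integrable_sum)
    fix j
    obtain r where "\<And>p. r < norm p \<Longrightarrow> X_deriv j (\<zeta> j) p = 0"
      using compactly_supported_imp_bounded_support[OF \<zeta>c(2)[of j]] by blast
    then show "integrable lborel (X_deriv j (\<zeta> j))"
      by (rule integrable_continuous_bounded_support[OF \<zeta>c(1)])
  qed
  have E: "(E_opt :: 'n heis set) \<in> sets borel" by (rule borel_open[OF opt.open_dom[unfolded dom_opt]])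
  define \<epsilon> where "\<epsilon> k = 1 / real (Suc k)" for k
  have \<epsilon>: "0 < \<epsilon> k" for k by (simp add: \<epsilon>_def)
  have \<epsilon>0: "\<epsilon> \<longlonglongrightarrow> 0" unfolding \<epsilon>_def by (rule LIMSEQ_Suc[OF lim_1_over_n])
  define \<phi> where "\<phi> k p = (if p \<in> ball 0 1 \<times> UNIV then
      S ((u_opt (fst p) - snd p) / \<epsilon> k - 1) * S ((u_opt (fst p) + snd p) / \<epsilon> k - 1) else 0)" for k and p :: "'n heis"
  note b = smoothed_perimeter_bound[OF \<zeta> area A \<epsilon> S, folded \<phi>_def D_def]
  have \<phi>01: "0 \<le> \<phi> k p" "\<phi> k p \<le> 1" for k p using S(3,4) by (auto simp: \<phi>_def mult_le_one)
  have S1: "\<forall>\<^sub>F k in sequentially. S (x / \<epsilon> k - 1) = 1" if "0 < x" for x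
  proof -
    have "\<forall>\<^sub>F k in sequentially. \<epsilon> k < x / 2" by (rule order_tendstoD[OF \<epsilon>0]) (use that in simp)
    then show ?thesis by eventually_elim (intro S(7), use \<epsilon> in \<open>simp add: field_simps\<close>)
  qed
  have S0: "S (x / \<epsilon> k - 1) = 0" if "x \<le> 0" for x k
    by (rule S(6)) (use that \<epsilon>[of k] in \<open>simp add: divide_nonpos_pos order.trans[of _ 0]\<close>)
  have \<phi>_lim: "(\<lambda>k. \<phi> k p) \<longlonglongrightarrow> indicator E_opt p" for p
  proof (cases "p \<in> E_opt")
    case True
    then have "norm (fst p) < 1" "0 < u_opt (fst p) - snd p" "0 < u_opt (fst p) + snd p" by (auto simp: E_opt_def)
    from S1[OF this(2)] S1[OF this(3)] have "\<forall>\<^sub>F k in sequentially. \<phi> k p = 1"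
      by eventually_elim (use \<open>norm (fst p) < 1\<close> in \<open>simp add: \<phi>_def mem_Times_iff\<close>)
    then show ?thesis using True by (simp add: tendsto_eventually)
  next
    case False
    then have "norm (fst p) < 1 \<Longrightarrow> u_opt (fst p) - snd p \<le> 0 \<or> u_opt (fst p) + snd p \<le> 0"
      by (auto simp: E_opt_def abs_less_iff case_prod_beta)
    then have "\<phi> k p = 0" for k using S0 by (auto simp: \<phi>_def mem_Times_iff)
    then show ?thesis using False by simp
  qed
  have "(\<lambda>k. \<integral>p. \<phi> k p * D p \<partial>lborel) \<longlonglongrightarrow> (\<integral>p. indicator E_opt p * D p \<partial>lborel)"
  proof (rule integral_dominated_convergence[where w = "\<lambda>p. norm (D p)"])
    have [measurable]: "D \<in> borel_measurable borel" by (rule borel_measurable_continuous_onI[OF Dc])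
    show "(\<lambda>p. indicator E_opt p * D p) \<in> borel_measurable lborel" using E by simp
    show "(\<lambda>p. \<phi> k p * D p) \<in> borel_measurable lborel" for k
      using borel_measurable_continuous_onI[OF b(2)[of k]] by simp
    show "AE p in lborel. norm (\<phi> k p * D p) \<le> norm (D p)" for k
      using \<phi>01 by (intro AE_I2) (simp add: abs_mult mult_left_le_one_le)
    show "AE p in lborel. (\<lambda>k. \<phi> k p * D p) \<longlonglongrightarrow> indicator E_opt p * D p"
      by (intro AE_I2 tendsto_intros \<phi>_lim)
  qed (use D_int in auto)
  then have "(\<integral>p. indicator E_opt p * D p \<partial>lborel) \<le> A"
    by (rule LIMSEQ_le_const2) (use b(1) in auto)
  moreover have "set_lebesgue_integral lebesgue E_opt D = (\<integral>p. indicator E_opt p * D p \<partial>lborel)"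
    by (rule set_lebesgue_integral_lborel[OF E borel_measurable_continuous_onI[OF Dc]])
  ultimately show "ereal (set_lebesgue_integral lebesgue E_opt (\<lambda>g. \<Sum>i\<in>UNIV. X_deriv i (\<zeta> i) g)) \<le> ereal A"
    by (simp add: D_def[abs_def])
qed

section \<open>Radial integrals\<close>

text \<open>Polar coordinates in the variable |z|^2, derived from ball volumes alone by comparing
  both measures on the half-lines \<open>{x<..}\<close>. The even dimension turns the power of the
  radius into an integral power of |z|^2.\<close>

lemma distr_norm_square_ball:
  defines "N \<equiv> DIM('a::euclidean_space)"
  assumes n: "N = 2 * n" "0 < n"
  shows "distr (density lborel (indicator (ball (0::'a) 1))) borel (\<lambda>z. z \<bullet> z)
    = density lborel (\<lambda>x. ennreal (n * unit_ball_vol N * x ^ (n - 1)) * indicator {0..1} x)" (is "?M = ?D")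
proof (rule measure_eqI_lessThan)
  let ?v = "unit_ball_vol N"
  have [measurable]: "(\<lambda>z::'a. z \<bullet> z) \<in> borel_measurable borel" by measurable
  have v: "0 \<le> ?v" by simp
  have M: "emeasure ?M {x<..} = emeasure lborel {z \<in> ball (0::'a) 1. x < z \<bullet> z}" for x
  proof -
    have "emeasure ?M {x<..} = emeasure (density lborel (indicator (ball (0::'a) 1))) ((\<lambda>z. z \<bullet> z) -` {x<..})"
      by (subst emeasure_distr) auto
    also have "\<dots> = (\<integral>\<^sup>+z. indicator (ball (0::'a) 1) z * indicator ((\<lambda>z. z \<bullet> z) -` {x<..}) z \<partial>lborel)"
      by (rule emeasure_density) (auto intro!: borel_measurable_indicator borel_open open_vimage continuous_intros)
    also have "\<dots> = (\<integral>\<^sup>+z. indicator {z \<in> ball (0::'a) 1. x < z \<bullet> z} z \<partial>lborel)"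
      by (intro nn_integral_cong) (auto simp: indicator_def)
    finally show ?thesis by (subst (asm) nn_integral_indicator) auto
  qed
  \<comment> \<open>\<open>y\<close> is \<open>x\<close> clamped to [0, 1], which treats all
    positions of \<open>x\<close> at once.\<close>
  have D: "emeasure ?D {x<..} = ennreal (?v * (1 - y ^ n))" if y: "y = min 1 (max 0 x)" for x y
  proof -
    have y01: "0 \<le> y" "y \<le> 1" using y by auto
    have "emeasure ?D {x<..} = (\<integral>\<^sup>+t. ennreal (n * ?v * t ^ (n - 1)) * indicator {0..1} t * indicator {x<..} t \<partial>lborel)"
      by (rule emeasure_density) auto
    also have "\<dots> = (\<integral>\<^sup>+t. ennreal (n * ?v * t ^ (n - 1)) * indicator {y..1} t \<partial>lborel)"
    proof (rule nn_integral_cong_AE)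
      have "AE t in lborel. t \<noteq> x \<and> t \<noteq> 1" by (simp add: AE_lborel_singleton)
      then show "AE t in lborel. ennreal (n * ?v * t ^ (n - 1)) * indicator {0..1} t * indicator {x<..} t
          = ennreal (n * ?v * t ^ (n - 1)) * indicator {y..1} t"
        by eventually_elim (auto simp: indicator_def y)
    qed
    also have "\<dots> = ennreal (?v * 1 ^ n - ?v * y ^ n)"
    proof (rule nn_integral_FTC_Icc)
      show "((\<lambda>t. ?v * t ^ n) has_real_derivative n * ?v * t ^ (n - 1)) (at t)" for t
        by (auto intro!: derivative_eq_intros)
    qed (use y01 in auto)
    finally show ?thesis by (simp add: algebra_simps)
  qed
  show "emeasure ?M {x<..} < \<infinity>" for x
  proof -
    have "emeasure ?M {x<..} \<le> emeasure lborel (ball (0::'a) 1)"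
      unfolding M by (rule emeasure_mono) auto
    also have "\<dots> < \<infinity>" by (rule emeasure_lborel_ball_finite)
    finally show ?thesis .
  qed
  show "emeasure ?M {x<..} = emeasure ?D {x<..}" for x
  proof -
    consider "x < 0" | "0 \<le> x" "x < 1" | "1 \<le> x" by linarith
    then show ?thesis
    proof cases
      case 1
      have "{z \<in> ball (0::'a) 1. x < z \<bullet> z} = ball 0 1"
      proof -
        have "x < z \<bullet> z" for z :: 'a using 1 inner_ge_zero[of z] by linarith
        then show ?thesis by auto
      qed
      then show ?thesis unfolding M D[OF refl, of x] using 1 n by (simp add: emeasure_ball N_def zero_power)
    next
      case 3
      have e: "{z \<in> ball (0::'a) 1. x < z \<bullet> z} = {}"
      proof -
        have "\<not> x < z \<bullet> z" if "norm z < 1" for z :: 'a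
          using that 3 abs_square_less_1[of "norm z"] by (simp add: power2_norm_eq_inner)
        then show ?thesis by auto
      qed
      show ?thesis unfolding M D[OF refl, of x] e using 3 by simp
    next
      case 2
      have eq: "{z \<in> ball (0::'a) 1. x < z \<bullet> z} = ball 0 1 - cball 0 (sqrt x)"
      proof -
        have "x < z \<bullet> z \<longleftrightarrow> \<not> norm z \<le> sqrt x" for z :: 'a
          by (simp only: not_le norm_eq_sqrt_inner real_sqrt_less_iff)
        then show ?thesis
          unfolding set_eq_iff by (simp only: mem_Collect_eq Diff_iff mem_cball_0 simp_thms)
      qed
      have sub: "cball 0 (sqrt x) \<subseteq> ball (0::'a) 1"
      proof
        fix z :: 'a assume "z \<in> cball 0 (sqrt x)"
        then have "norm z \<le> sqrt x" by simp
        also have "sqrt x < 1" using 2 by simp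
        finally show "z \<in> ball 0 1" by simp
      qed
      have x: "sqrt x ^ N = x ^ n" using 2 by (simp add: n(1) power_mult)
      have "emeasure ?M {x<..} = emeasure lborel (ball (0::'a) 1) - emeasure lborel (cball (0::'a) (sqrt x))"
        unfolding M eq by (rule emeasure_Diff[OF _ _ _ sub]) (use 2 in \<open>auto simp: emeasure_cball\<close>)
      also have "\<dots> = ennreal ?v - ennreal (?v * x ^ n)"
        using 2 x by (simp add: emeasure_ball emeasure_cball N_def[symmetric])
      also have "\<dots> = ennreal (?v - ?v * x ^ n)" by (rule ennreal_minus) (use 2 in simp)
      also have "?v - ?v * x ^ n = ?v * (1 - x ^ n)" by (simp add: algebra_simps)
      finally show ?thesis using 2 D[of x x] by simp
    qed
  qed
qed simp_all

lemma radial_integral: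
  fixes h :: "real \<Rightarrow> real"
  defines "N \<equiv> DIM('a::euclidean_space)"
  assumes n: "N = 2 * n" "0 < n"
    and meas: "(\<lambda>x. indicator {0..1} x * h x) \<in> borel_measurable borel"
    and nonneg: "\<And>x. 0 \<le> x \<Longrightarrow> x \<le> 1 \<Longrightarrow> 0 \<le> h x"
    and I: "((\<lambda>x. n * unit_ball_vol N * x ^ (n - 1) * h x) has_integral I) {0..1}"
  shows "(\<integral>\<^sup>+z. indicator (ball (0::'a) 1) z * ennreal (h (z \<bullet> z)) \<partial>lborel) = ennreal I"
    and "0 \<le> I"
    and "(\<lambda>z. indicator (ball (0::'a) 1) z * h (z \<bullet> z)) \<in> borel_measurable borel"
    and "(\<integral>z. indicator (ball (0::'a) 1) z * h (z \<bullet> z) \<partial>lborel) = I"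
proof -
  define H where "H x = indicator {0..1} x * h x" for x
  have [measurable]: "H \<in> borel_measurable borel" unfolding H_def by (rule meas)
  have zm[measurable]: "(\<lambda>z::'a. z \<bullet> z) \<in> borel_measurable borel" by measurable
  have zz: "z \<bullet> z \<le> 1" if "norm z < 1" for z :: 'a
    using that abs_square_less_1[of "norm z"] by (simp add: power2_norm_eq_inner)
  have eq: "indicator (ball (0::'a) 1) z * h (z \<bullet> z) = indicator (ball 0 1) z * H (z \<bullet> z)" for z
    using zz[of z] by (simp add: H_def indicator_def)
  show m: "(\<lambda>z. indicator (ball (0::'a) 1) z * h (z \<bullet> z)) \<in> borel_measurable borel"
    unfolding eq by (rule borel_measurable_times[OF borel_measurable_indicator[OF borel_open[OF open_ball]] measurable_compose[OF zm]]) simp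
  have "(\<integral>\<^sup>+z. indicator (ball (0::'a) 1) z * ennreal (h (z \<bullet> z)) \<partial>lborel)
    = (\<integral>\<^sup>+z. indicator (ball (0::'a) 1) z * ennreal (H (z \<bullet> z)) \<partial>lborel)"
    using zz by (intro nn_integral_cong) (auto simp: H_def indicator_def)
  also have "\<dots> = (\<integral>\<^sup>+z. ennreal (H (z \<bullet> z)) \<partial>density lborel (indicator (ball (0::'a) 1)))"
    by (rule nn_integral_density[symmetric]) (auto intro!: borel_measurable_indicator)
  also have "\<dots> = (\<integral>\<^sup>+x. ennreal (H x) \<partial>distr (density lborel (indicator (ball (0::'a) 1))) borel (\<lambda>z. z \<bullet> z))"
    by (rule nn_integral_distr[symmetric]) auto
  also have "\<dots> = (\<integral>\<^sup>+x. ennreal (n * unit_ball_vol N * x ^ (n - 1)) * indicator {0..1} x * ennreal (H x) \<partial>lborel)"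
    unfolding distr_norm_square_ball[where 'a = 'a, folded N_def, OF n] by (rule nn_integral_density) auto
  also have "\<dots> = (\<integral>\<^sup>+x. ennreal (n * unit_ball_vol N * x ^ (n - 1) * h x) * indicator {0..1} x \<partial>lborel)"
    by (intro nn_integral_cong) (auto simp: H_def indicator_def ennreal_mult nonneg)
  also have "\<dots> = ennreal I"
    by (rule nn_integral_has_integral_lebesgue'[OF _ I]) (use nonneg in auto)
  finally show nn: "(\<integral>\<^sup>+z. indicator (ball (0::'a) 1) z * ennreal (h (z \<bullet> z)) \<partial>lborel) = ennreal I" .
  show I0: "0 \<le> I" by (rule has_integral_nonneg[OF I]) (use nonneg in auto)
  have "has_bochner_integral lborel (\<lambda>z. indicator (ball (0::'a) 1) z * h (z \<bullet> z)) I"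
  proof (rule has_bochner_integral_nn_integral)
    show "AE z in lborel. 0 \<le> indicator (ball (0::'a) 1) z * h (z \<bullet> z)"
      using zz nonneg by (intro AE_I2) (auto simp: indicator_def)
    show "(\<integral>\<^sup>+z. ennreal (indicator (ball (0::'a) 1) z * h (z \<bullet> z)) \<partial>lborel) = ennreal I"
      unfolding nn[symmetric] by (intro nn_integral_cong) (auto simp: indicator_def)
  qed (use m I0 in auto)
  then show "(\<integral>z. indicator (ball (0::'a) 1) z * h (z \<bullet> z) \<partial>lborel) = I"
    by (simp add: has_bochner_integral_iff)
qed

text \<open>At the endpoints, \<open>powr\<close> and division by zero take conventional values, so
  the comparison with the Beta integrand is made on the open interval only.\<close>

lemma has_integral_power_sqrt_Beta:
  fixes n :: nat
  assumes n: "0 < n" and b: "0 < b"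
    and g: "\<And>x. 0 < x \<Longrightarrow> x < 1 \<Longrightarrow> g x = x powr (real n + 1 / 2 - 1) * (1 - x) powr (b - 1)"
  shows "(g has_integral Beta (real n + 1 / 2) b) {0..1}"
proof -
  have "((\<lambda>x. x powr (real n + 1 / 2 - 1) * (1 - x) powr (b - 1)) has_integral Beta (real n + 1 / 2) b) {0..1}"
    by (rule has_integral_Beta_real) (use b in auto)
  then show ?thesis
  proof (rule has_integral_spike_finite[of "{0, 1}", rotated 2])
    show "g x = x powr (real n + 1 / 2 - 1) * (1 - x) powr (b - 1)" if "x \<in> {0..1} - {0, 1}" for x
    proof (rule g)
      show "0 < x" "x < 1" using that by auto
    qed
  qed simp
qed

lemma powr_half_integer:
  assumes "0 < x"
  shows "x powr (real k + 1 / 2) = x ^ k * sqrt x"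
  using assms by (simp add: powr_add powr_realpow powr_half_sqrt)

section \<open>The radial integrals of the bubble\<close>

context
  fixes n :: nat and \<omega> :: real
  assumes n: "n = CARD('n::finite)" and \<omega>: "\<omega> = unit_ball_vol (real (2 * n))"
begin

lemma n_pos: "0 < n" using n by simp

lemma DIM_hplane: "DIM('n hplane) = 2 * n" by (simp add: n)

lemma powr_n: "0 < x \<Longrightarrow> x powr (real n + 1 / 2 - 1) = x ^ (n - 1) * sqrt x"
  using powr_half_integer[of x "n - 1"] n_pos by (simp add: of_nat_diff algebra_simps)
text \<open>The horizontal area of both graphs together; each of them contributes half of the
  integrand.\<close>

lemma bubble_area:
  "(\<integral>\<^sup>+z. indicator (ball 0 1) z * ennreal (norm z / sqrt (1 - (norm z)\<^sup>2)) \<partial>(lborel :: 'n hplane measure))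
    = ennreal (n * \<omega> * Beta (real n + 1 / 2) (1 / 2))"
  and bubble_area_nonneg: "0 \<le> n * \<omega> * Beta (real n + 1 / 2) (1 / 2)"
proof -
  define h where "h x = sqrt x / sqrt (1 - x)" for x :: real
  have "((\<lambda>x. x ^ (n - 1) * h x) has_integral Beta (real n + 1 / 2) (1 / 2)) {0..1}"
  proof (rule has_integral_power_sqrt_Beta[OF n_pos])
    fix x :: real assume x: "0 < x" "x < 1"
    have "(1 - x) powr (1 / 2 - 1) = (1 - x) powr - (1 / 2)" by simp
    also have "\<dots> = 1 / sqrt (1 - x)" using x unfolding powr_minus by (simp add: powr_half_sqrt inverse_eq_divide)
    finally show "x ^ (n - 1) * h x = x powr (real n + 1 / 2 - 1) * (1 - x) powr (1 / 2 - 1)"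
      unfolding powr_n[OF x(1)] by (simp add: h_def)
  qed simp
  from has_integral_mult_right[OF this, of "n * \<omega>"]
  have I: "((\<lambda>x. n * unit_ball_vol (2 * n) * x ^ (n - 1) * h x) has_integral (n * \<omega> * Beta (real n + 1 / 2) (1 / 2))) {0..1}"
    by (simp add: \<omega> mult.assoc)
  have m: "(\<lambda>x. indicator {0..1} x * h x) \<in> borel_measurable borel" unfolding h_def by measurable
  have h0: "0 \<le> h x" if "0 \<le> x" "x \<le> 1" for x using that by (simp add: h_def)
  note r = radial_integral[where 'a = "'n hplane", unfolded DIM_hplane, OF refl n_pos m h0 I]
  have "h (z \<bullet> z) = norm z / sqrt (1 - (norm z)\<^sup>2)" for z :: "'n hplane"
    by (simp add: h_def norm_eq_sqrt_inner)
  then show "(\<integral>\<^sup>+z. indicator (ball 0 1) z * ennreal (norm z / sqrt (1 - (norm z)\<^sup>2)) \<partial>(lborel :: 'n hplane measure))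
      = ennreal (n * \<omega> * Beta (real n + 1 / 2) (1 / 2))"
    using r(1) by simp
  show "0 \<le> n * \<omega> * Beta (real n + 1 / 2) (1 / 2)" by (rule r(2))
qed

lemma waist_integral:
  "(\<integral>z. indicator (ball 0 1) z * (norm z * sqrt (1 - (norm z)\<^sup>2)) \<partial>(lborel :: 'n hplane measure))
    = n * \<omega> * Beta (real n + 1 / 2) (3 / 2)"
proof -
  define h where "h x = sqrt x * sqrt (1 - x)" for x :: real
  have "((\<lambda>x. x ^ (n - 1) * h x) has_integral Beta (real n + 1 / 2) (3 / 2)) {0..1}"
  proof (rule has_integral_power_sqrt_Beta[OF n_pos])
    fix x :: real assume x: "0 < x" "x < 1"
    have "(1 - x) powr (3 / 2 - 1) = (1 - x) powr (1 / 2)" by simp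
    also have "\<dots> = sqrt (1 - x)" using x by (intro powr_half_sqrt) simp
    finally show "x ^ (n - 1) * h x = x powr (real n + 1 / 2 - 1) * (1 - x) powr (3 / 2 - 1)"
      unfolding powr_n[OF x(1)] by (simp add: h_def)
  qed simp
  from has_integral_mult_right[OF this, of "n * \<omega>"]
  have I: "((\<lambda>x. n * unit_ball_vol (2 * n) * x ^ (n - 1) * h x) has_integral (n * \<omega> * Beta (real n + 1 / 2) (3 / 2))) {0..1}"
    by (simp add: \<omega> mult.assoc)
  have m: "(\<lambda>x. indicator {0..1} x * h x) \<in> borel_measurable borel" unfolding h_def by measurable
  have h0: "0 \<le> h x" if "0 \<le> x" "x \<le> 1" for x using that by (simp add: h_def)
  note r = radial_integral[where 'a = "'n hplane", unfolded DIM_hplane, OF refl n_pos m h0 I]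
  have "h (z \<bullet> z) = norm z * sqrt (1 - (norm z)\<^sup>2)" for z :: "'n hplane"
    by (simp add: h_def norm_eq_sqrt_inner)
  then show ?thesis using r(4) by simp
qed

text \<open>Integration by parts in |z|^2: the function \<open>\<omega> * (x ^ n * h x)\<close>
  vanishes at both ends, at 1 because \<open>h 1 = 0\<close> and at 0 because \<open>n\<close> is
  positive, and the derivative of \<open>h\<close> leaves a Beta integrand.\<close>

lemma u_opt_integral:
  "(\<integral>z. indicator (ball 0 1) z * u_opt z \<partial>(lborel :: 'n hplane measure)) = \<omega> / 4 * Beta (real n + 3 / 2) (1 / 2)"
proof -
  define h where "h x = pi / 8 + sqrt x / 4 * sqrt (1 - x) - 1 / 4 * arcsin (sqrt x)" for x :: real
  have sq: "-1 \<le> sqrt x" if "0 \<le> x" for x :: real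
    using real_sqrt_ge_zero[OF that] by linarith
  have hc: "continuous_on {0..1} h"
  proof -
    have r: "\<forall>x\<in>{0..1}. -1 \<le> sqrt x \<and> sqrt x \<le> 1"
    proof
      fix x :: real assume "x \<in> {0..1}"
      then show "-1 \<le> sqrt x \<and> sqrt x \<le> 1" using sq[of x] by simp
    qed
    have "continuous_on {0..1} (\<lambda>x. arcsin (sqrt x))"
      by (rule continuous_on_arcsin[OF continuous_on_real_sqrt[OF continuous_on_id] r])
    then show ?thesis
      unfolding h_def by (intro continuous_on_diff continuous_on_add continuous_on_mult continuous_on_divide
          continuous_on_const continuous_on_real_sqrt continuous_on_id) auto
  qed
  have dh: "(h has_real_derivative - (sqrt x / sqrt (1 - x) / 4)) (at x)" if x: "0 < x" "x < 1" for x
  proof -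
    have q: "sqrt x > 0" "sqrt (1 - x) > 0" "sqrt x * sqrt x = x" "sqrt (1 - x) * sqrt (1 - x) = 1 - x" using x by auto
    have s: "-1 < sqrt x" "sqrt x < 1" "(sqrt x)\<^sup>2 = x" using x q(1) by (linarith, simp_all)
    have d1: "(sqrt has_real_derivative inverse (sqrt x) / 2) (at x)" using x by (rule_tac DERIV_real_sqrt) auto
    have d2: "((\<lambda>x. sqrt (1 - x)) has_real_derivative - (inverse (sqrt (1 - x)) / 2)) (at x)"
      using x by (auto intro!: derivative_eq_intros)
    have d3: "((\<lambda>x. arcsin (sqrt x)) has_real_derivative inverse (sqrt (1 - x)) * (inverse (sqrt x) / 2)) (at x)"
      using DERIV_chain2[OF DERIV_arcsin[OF s(1,2)] d1] s(3) by simp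
    have "(h has_real_derivative (0 + (inverse (sqrt x) / 2 / 4 * sqrt (1 - x) + - (inverse (sqrt (1 - x)) / 2) * (sqrt x / 4)))
        - 1 / 4 * (inverse (sqrt (1 - x)) * (inverse (sqrt x) / 2))) (at x)"
      unfolding h_def by (rule DERIV_diff[OF DERIV_add[OF DERIV_const DERIV_mult[OF DERIV_cdivide[OF d1] d2]] DERIV_cmult[OF d3]])
    moreover have "(0 + (inverse (sqrt x) / 2 / 4 * sqrt (1 - x) + - (inverse (sqrt (1 - x)) / 2) * (sqrt x / 4)))
        - 1 / 4 * (inverse (sqrt (1 - x)) * (inverse (sqrt x) / 2)) = - (sqrt x / sqrt (1 - x) / 4)"
    proof -
      have "(0 + (inverse s / 2 / 4 * c + - (inverse c / 2) * (s / 4))) - 1 / 4 * (inverse c * (inverse s / 2)) = - (s / c / 4)"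
        if "s > 0" "c > 0" "s * s + c * c = 1" for s c :: real
      proof -
        have "(0 + (inverse s / 2 / 4 * c + - (inverse c / 2) * (s / 4))) - 1 / 4 * (inverse c * (inverse s / 2))
            = (c * c - s * s - 1) / (8 * s * c)"
          using that(1,2) by (simp add: field_simps)
        also have "c * c - s * s - 1 = - 2 * (s * s)" using that(3) by linarith
        finally show ?thesis using that(1,2) by (simp add: field_simps)
      qed
      from this[of "sqrt x" "sqrt (1 - x)"] show ?thesis using q by simp
    qed
    ultimately show ?thesis by simp
  qed
  have B: "((\<lambda>x. x ^ n * (sqrt x / sqrt (1 - x))) has_integral Beta (real n + 3 / 2) (1 / 2)) {0..1}"
  proof -
    have "((\<lambda>x. x ^ n * (sqrt x / sqrt (1 - x))) has_integral Beta (real (Suc n) + 1 / 2) (1 / 2)) {0..1}"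
    proof (rule has_integral_power_sqrt_Beta)
      fix x :: real assume x: "0 < x" "x < 1"
      have "(1 - x) powr (1 / 2 - 1) = (1 - x) powr - (1 / 2)" by simp
      also have "\<dots> = 1 / sqrt (1 - x)" using x unfolding powr_minus by (simp add: powr_half_sqrt inverse_eq_divide)
      finally show "x ^ n * (sqrt x / sqrt (1 - x)) = x powr (real (Suc n) + 1 / 2 - 1) * (1 - x) powr (1 / 2 - 1)"
        using x powr_half_integer[of x n] by (simp add: add.commute)
    qed auto
    then show ?thesis by (simp add: add.commute add.left_commute)
  qed
  have "((\<lambda>x. \<omega> * (n * x ^ (n - 1) * h x + x ^ n * - (sqrt x / sqrt (1 - x) / 4))) has_integral (\<omega> * (1 ^ n * h 1) - \<omega> * (0 ^ n * h 0))) {0..1}"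
  proof (rule fundamental_theorem_of_calculus_interior[where f = "\<lambda>x. \<omega> * (x ^ n * h x)"])
    show "((\<lambda>x. \<omega> * (x ^ n * h x)) has_vector_derivative
        \<omega> * (n * x ^ (n - 1) * h x + x ^ n * - (sqrt x / sqrt (1 - x) / 4))) (at x)" if "x \<in> {0<..<1}" for x :: real
      unfolding has_real_derivative_iff_has_vector_derivative[symmetric]
    proof -
      have "0 < x" "x < 1" using that by auto
      from DERIV_cmult[OF DERIV_mult[OF DERIV_pow[of n] dh[OF this]], of \<omega>]
      show "((\<lambda>x. \<omega> * (x ^ n * h x)) has_real_derivative
        \<omega> * (n * x ^ (n - 1) * h x + x ^ n * - (sqrt x / sqrt (1 - x) / 4))) (at x)"
        by (simp only: mult.commute[of "x ^ n"] One_nat_def)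
    qed
    show "continuous_on {0..1} (\<lambda>x. \<omega> * (x ^ n * h x))" by (intro continuous_intros hc)
  qed simp
  moreover have "\<omega> * (1 ^ n * h 1) - \<omega> * (0 ^ n * h 0) = 0" using n_pos by (simp add: h_def zero_power)
  ultimately have J: "((\<lambda>x. \<omega> * (n * x ^ (n - 1) * h x + x ^ n * - (sqrt x / sqrt (1 - x) / 4))) has_integral 0) {0..1}"
    by (simp only:)
  have "((\<lambda>x. \<omega> * (n * x ^ (n - 1) * h x + x ^ n * - (sqrt x / sqrt (1 - x) / 4)) + \<omega> / 4 * (x ^ n * (sqrt x / sqrt (1 - x))))
      has_integral (0 + \<omega> / 4 * Beta (real n + 3 / 2) (1 / 2))) {0..1}"
    by (intro has_integral_add J has_integral_mult_right B)
  then have I: "((\<lambda>x. n * unit_ball_vol (2 * n) * x ^ (n - 1) * h x) has_integral (\<omega> / 4 * Beta (real n + 3 / 2) (1 / 2))) {0..1}"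
    by (simp add: \<omega> algebra_simps)
  have m: "(\<lambda>x. indicator {0..1} x * h x) \<in> borel_measurable borel"
    using borel_measurable_continuous_on_indicator[OF _ hc] by simp
  have hu: "h (z \<bullet> z) = u_opt z" for z :: "'n hplane"
    by (simp add: h_def u_opt_def norm_eq_sqrt_inner)
  have h0: "0 \<le> h x" if "0 \<le> x" "x \<le> 1" for x
  proof -
    have "arcsin (sqrt x) \<le> arcsin 1" by (rule arcsin_le_arcsin) (use that sq in auto)
    moreover have "0 \<le> sqrt x / 4 * sqrt (1 - x)" using that by simp
    ultimately show ?thesis by (simp add: h_def)
  qed
  note r = radial_integral[where 'a = "'n hplane", unfolded DIM_hplane, OF refl n_pos m h0 I]
  then show ?thesis using r(4) by (simp add: hu)
qed

lemma E_opt_volume: "measure lborel (E_opt :: 'n heis set) = \<omega> / 2 * Beta (real n + 3 / 2) (1 / 2)"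
  using opt.measure_dom[where 'n = 'n] by (simp add: dom_opt u_opt_integral)

end

section \<open>The isoperimetric constant\<close>

lemma Gamma_real_plus1: "0 < x \<Longrightarrow> Gamma (x + 1) = x * Gamma (x :: real)"
  by (rule Gamma_plus1) (use nonpos_Ints_nonpos in force)

text \<open>\<open>V\<close> is the volume of the bubble, \<open>c\<close> the additive constant of
  the calibration bound and \<open>A\<close> the horizontal area of the two graphs of the
  bubble.\<close>

context
  fixes n :: nat and \<omega> Q V c A :: real
  assumes n_pos: "0 < n" and \<omega>: "\<omega> = unit_ball_vol (real (2 * n))" and Q: "Q = 2 * real n + 2"
    and V: "V = \<omega> / 2 * Beta (real n + 3 / 2) (1 / 2)"
    and c: "c = n * \<omega> * Beta (real n + 1 / 2) (3 / 2)"
    and A: "A = n * \<omega> * Beta (real n + 1 / 2) (1 / 2)"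
begin

lemma Beta_values:
  "Beta (real n + 1 / 2) (1 / 2) = Gamma (real n + 1 / 2) * Gamma (1 / 2) / Gamma (real n + 1)"
  "Beta (real n + 1 / 2) (3 / 2) = Gamma (real n + 1 / 2) * (Gamma (1 / 2) / 2) / ((real n + 1) * Gamma (real n + 1))"
  "Beta (real n + 3 / 2) (1 / 2) = Gamma (real n + 3 / 2) * Gamma (1 / 2) / ((real n + 1) * Gamma (real n + 1))"
  "Gamma (real n + 3 / 2) = (real n + 1 / 2) * Gamma (real n + 1 / 2)"
proof -
  have g1: "Gamma (3 / 2 :: real) = Gamma (1 / 2) / 2" using Gamma_real_plus1[of "1 / 2"] by simp
  have g2: "Gamma (real n + 2) = (real n + 1) * Gamma (real n + 1)"
    using Gamma_real_plus1[of "real n + 1"] by (simp add: add.assoc)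
  have g3: "real n + 1 / 2 + 1 = real n + 3 / 2" by simp
  have e: "real n + 1 / 2 + 1 / 2 = real n + 1" "real n + 1 / 2 + 3 / 2 = real n + 2" "real n + 3 / 2 + 1 / 2 = real n + 2"
    by simp_all
  show "Beta (real n + 1 / 2) (1 / 2) = Gamma (real n + 1 / 2) * Gamma (1 / 2) / Gamma (real n + 1)"
    unfolding Beta_def e ..
  show "Beta (real n + 1 / 2) (3 / 2) = Gamma (real n + 1 / 2) * (Gamma (1 / 2) / 2) / ((real n + 1) * Gamma (real n + 1))"
    unfolding Beta_def e g1 g2 ..
  show "Beta (real n + 3 / 2) (1 / 2) = Gamma (real n + 3 / 2) * Gamma (1 / 2) / ((real n + 1) * Gamma (real n + 1))"
    unfolding Beta_def e g2 ..
  show "Gamma (real n + 3 / 2) = (real n + 1 / 2) * Gamma (real n + 1 / 2)"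
    using Gamma_real_plus1[of "real n + 1 / 2"] unfolding g3 by simp
qed

text \<open>All Beta values reduce to the same Gamma values \<open>g\<close>, \<open>h\<close> and
  \<open>k\<close>, so only rational factors have to be compared. Together the first two identities
  give (Q - 2) V + c = (Q - 1) c + c = A: at the bubble, the calibration bound equals the
  area.\<close>

lemma area_eq: "A = Q * c" and waist_eq: "c = (Q - 2) * V / (Q - 1)" and volume_pos: "0 < V"
proof -
  define g h k where "g = Gamma (real n + 1 / 2)" and "h = Gamma (1 / 2 :: real)" and "k = Gamma (real n + 1)"
  define M H where "M = real n + 1" and "H = real n + 1 / 2"
  have pos: "0 < g" "0 < h" "0 < k" "0 < \<omega>" "0 < real n" "0 < M" "0 < H"
    using n_pos by (auto simp: g_def h_def k_def \<omega> M_def H_def intro!: Gamma_real_pos add_pos_pos)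
  have Q': "Q = 2 * M" "Q - 1 = 2 * H" "Q - 2 = 2 * n" by (auto simp: Q M_def H_def)
  have c': "c = n * \<omega> * (g * (h / 2) / (M * k))" unfolding c Beta_values g_def h_def k_def M_def ..
  have A': "A = n * \<omega> * (g * h / k)" unfolding A Beta_values g_def h_def k_def ..
  have V': "V = \<omega> / 2 * (H * g * h / (M * k))" unfolding V Beta_values g_def h_def k_def M_def H_def ..
  show "A = Q * c" unfolding A' c' Q'(1) using pos by (simp add: field_simps)
  show "0 < V" unfolding V' using pos by (intro mult_pos_pos divide_pos_pos) auto
  have "(Q - 1) * c = (Q - 2) * V" unfolding V' c' Q'(2,3) using pos by (simp add: field_simps)
  moreover have "Q - 1 > 0" using n_pos by (simp add: Q)
  ultimately show "c = (Q - 2) * V / (Q - 1)" by (simp add: field_simps)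
qed

text \<open>The only place where the closed form of the constant is unfolded. It rests on V =
  pi^((Q-1)/2) Gamma((Q+1)/2) / (Q Gamma(Q/2)^2), obtained from the volume pi^n / n! of the unit
  ball. The right-hand side is the factor that Young's inequality produces.\<close>

lemma isop_const_volume: "isop_const Q * V powr (1 / Q) = (Q - 1) / (Q * (Q - 2))"
proof -
  define k G p where "k = Gamma (Q / 2)" and "G = Gamma ((Q + 1) / 2)" and "p = pi powr ((Q - 1) / 2)"
  have Q0: "Q > 2" using n_pos by (simp add: Q)
  have e: "Q / 2 = real n + 1" "(Q + 1) / 2 = real n + 3 / 2" "(Q - 1) / 2 = real n + 1 / 2" by (auto simp: Q field_simps)
  have pos: "0 < k" "0 < G" "0 < p" "0 < Q" "0 < Q - 2"
    using Q0 by (auto simp: k_def G_def p_def intro!: Gamma_real_pos)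
  have om: "\<omega> = pi powr real n / Gamma (real n + 1)" by (simp add: \<omega> unit_ball_vol_def)
  have hp: "Gamma (1 / 2 :: real) = pi powr (1 / 2)" by (simp add: Gamma_one_half_real powr_half_sqrt)
  have pp: "pi powr (real n + 1 / 2) = pi powr real n * pi powr (1 / 2)" by (rule powr_add)
  have "V = p * G / (Q * k\<^sup>2)"
    unfolding V Beta_values(3) om hp k_def G_def p_def e pp using pos
    by (simp add: k_def e Q field_simps power2_eq_square)
  then have "V powr (1 / Q) = p powr (1 / Q) * G powr (1 / Q) / (Q powr (1 / Q) * (k\<^sup>2) powr (1 / Q))"
    using pos by (simp add: powr_mult powr_divide)
  also have "p powr (1 / Q) = pi powr ((Q - 1) / (2 * Q))" by (simp add: p_def powr_powr)
  also have "(k\<^sup>2) powr (1 / Q) = k powr (2 / Q)"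
  proof -
    have "k\<^sup>2 = k powr 2" using pos by simp
    then show ?thesis by (simp only: powr_powr) simp
  qed
  finally have Vq: "V powr (1 / Q) = pi powr ((Q - 1) / (2 * Q)) * G powr (1 / Q) / (Q powr (1 / Q) * k powr (2 / Q))" .
  have "(Q - 1) / Q = 1 - 1 / Q" using pos by (simp add: diff_divide_distrib)
  then have Qq: "Q powr ((Q - 1) / Q) = Q / Q powr (1 / Q)" using pos by (simp add: powr_diff)
  have ne: "pi powr ((Q - 1) / (2 * Q)) \<noteq> 0" "G powr (1 / Q) \<noteq> 0" "Q powr (1 / Q) \<noteq> 0" "k powr (2 / Q) \<noteq> 0" "Q \<noteq> 0" "Q - 2 \<noteq> 0"
    using pos by auto
  have alg: "((Q - 1) * x) / (Q / y * (Q - 2) * z * w) * (w * z / (y * x)) = (Q - 1) / (Q * (Q - 2))"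
    if "x \<noteq> 0" "y \<noteq> 0" "z \<noteq> 0" "w \<noteq> 0" for x y z w :: real
    using that ne(5,6) by (simp add: divide_simps)
  show ?thesis
    unfolding isop_const_def Vq Qq k_def[symmetric] G_def[symmetric] by (rule alg[OF ne(4,3,2,1)])
qed

lemma isop_const_pos: "0 < isop_const Q"
proof -
  have "Q > 2" using n_pos by (simp add: Q)
  then have "0 < isop_const Q * V powr (1 / Q)" unfolding isop_const_volume by simp
  then show ?thesis using volume_pos by (simp add: zero_less_mult_iff)
qed

text \<open>Young's inequality with the exponents Q / (Q - 1) and Q, for powers of \<open>W\<close>
  and \<open>V\<close>. By \<open>waist_eq\<close>, the term \<open>1 / Q * V\<close> is the same
  multiple of \<open>c\<close> as \<open>(Q - 1) / Q * W\<close> is of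
  \<open>2 * n * W\<close>.\<close>

lemma volume_isop_bound:
  fixes W :: real
  assumes W: "0 \<le> W"
  shows "W powr ((Q - 1) / Q) \<le> isop_const Q * (2 * n * W + c)"
proof (cases "W = 0")
  case True
  have "0 \<le> c" unfolding waist_eq using volume_pos by (simp add: Q)
  then show ?thesis using True isop_const_pos by simp
next
  case False
  have Q0: "Q > 2" using n_pos by (simp add: Q)
  have a: "0 < V powr (1 / Q)" using volume_pos by simp
  have "W powr ((Q - 1) / Q) * V powr (1 / Q) \<le> (Q - 1) / Q * W + 1 / Q * V"
    by (rule Youngs_inequality_0) (use Q0 W False volume_pos in \<open>auto simp: field_simps\<close>)
  also have "\<dots> = (Q - 1) / (Q * (Q - 2)) * (2 * n * W + c)"
  proof -
    have "2 * real n = Q - 2" by (simp add: Q)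
    then show ?thesis unfolding waist_eq using Q0 by (simp add: divide_simps) (simp add: algebra_simps)
  qed
  also have "\<dots> = isop_const Q * (2 * n * W + c) * V powr (1 / Q)"
    unfolding isop_const_volume[symmetric] by simp
  finally show ?thesis using a by simp
qed

lemma volume_isop_equality: "V powr ((Q - 1) / Q) = isop_const Q * A"
proof -
  have Q0: "Q > 2" using n_pos by (simp add: Q)
  have a: "0 < V powr (1 / Q)" using volume_pos by simp
  have "V powr ((Q - 1) / Q) * V powr (1 / Q) = V powr ((Q - 1) / Q + 1 / Q)" by (simp only: powr_add)
  also have "(Q - 1) / Q + 1 / Q = 1" using Q0 by (simp add: field_simps)
  also have "V powr 1 = (Q - 1) / (Q * (Q - 2)) * A"
    using Q0 volume_pos by (simp add: area_eq waist_eq)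
  also have "\<dots> = isop_const Q * A * V powr (1 / Q)"
    unfolding isop_const_volume[symmetric] by simp
  finally show ?thesis using a by simp
qed

end

section \<open>Invariance under translations and dilations\<close>

text \<open>Composition with \<Psi> sends test fields to test fields, divides frame derivatives by
  \<open>l\<close> and multiplies integrals by \<open>d\<close>. Left translations and dilations are
  both instances; the opposite inequality comes from the inverse map.\<close>

lemma H_perimeter_pullback:
  fixes \<Phi> \<Psi> :: "'n::finite heis \<Rightarrow> 'n heis" and l d :: real
  assumes inv: "\<And>g. \<Psi> (\<Phi> g) = g" "\<And>g. \<Phi> (\<Psi> g) = g"
    and cont: "continuous_on UNIV \<Phi>" "continuous_on UNIV \<Psi>"
    and l: "0 < l" and d: "0 < d"
    and hom: "\<And>j g s. \<Psi> (g + s *\<^sub>R X_field j g) = \<Psi> g + (s / l) *\<^sub>R X_field j (\<Psi> g)"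
    and jac: "\<And>f :: 'n heis \<Rightarrow> real. f \<in> borel_measurable borel \<Longrightarrow> (\<integral>g. f (\<Psi> g) \<partial>lborel) = d * (\<integral>g. f g \<partial>lborel)"
    and E: "E \<in> sets borel"
  shows "\<Phi> ` E \<in> sets borel" "measure lborel (\<Phi> ` E) = d * measure lborel E"
    and "H_perimeter E UNIV \<le> ereal (l / d) * H_perimeter (\<Phi> ` E) UNIV"
proof -
  have img: "\<Phi> ` E = \<Psi> -` E"
  proof (intro set_eqI iffI)
    show "g \<in> \<Psi> -` E" if "g \<in> \<Phi> ` E" for g using that inv(1) by auto
    show "g \<in> \<Phi> ` E" if "g \<in> \<Psi> -` E" for g
      using imageI[of "\<Psi> g" E \<Phi>] that by (simp add: inv(2))
  qed
  have \<Psi>m: "\<Psi> \<in> borel_measurable borel" by (rule borel_measurable_continuous_onI[OF cont(2)])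
  show borel: "\<Phi> ` E \<in> sets borel" unfolding img using measurable_sets_borel[OF \<Psi>m E] .
  have ind: "indicator (\<Phi> ` E) g = (indicator E (\<Psi> g) :: real)" for g by (simp add: img indicator_def)
  have "measure lborel (\<Phi> ` E) = (\<integral>g. indicator (\<Phi> ` E) g \<partial>lborel)" by simp
  also have "\<dots> = d * (\<integral>g. indicator E g \<partial>lborel)"
    unfolding ind by (rule jac) (use E in simp)
  finally show "measure lborel (\<Phi> ` E) = d * measure lborel E" by simp
  show "H_perimeter E UNIV \<le> ereal (l / d) * H_perimeter (\<Phi> ` E) UNIV"
    unfolding H_perimeter_def[of E]
  proof (rule SUP_least)
    fix \<zeta> :: "'n + 'n \<Rightarrow> 'n heis \<Rightarrow> real" assume \<zeta>: "\<zeta> \<in> horizontal_test_fields UNIV"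
    have c: "continuous_on UNIV (\<zeta> i)" "compactly_supported_in UNIV (\<zeta> i)" for i
      using \<zeta> unfolding horizontal_test_fields_def by auto
    have X: "X_differentiable j (\<zeta> i)" "continuous_on UNIV (X_deriv j (\<zeta> i))" "compactly_supported_in UNIV (X_deriv j (\<zeta> i))" for i j
      using \<zeta> unfolding horizontal_test_fields_def by auto
    have nrm: "sqrt (\<Sum>i\<in>UNIV. (\<zeta> i g)\<^sup>2) \<le> 1" for g
      using \<zeta> unfolding horizontal_test_fields_def by blast
    have supp: "compactly_supported_in UNIV (\<lambda>g. f (\<Psi> g))" if "compactly_supported_in UNIV f" for f :: "'n heis \<Rightarrow> real"
    proof -
      have "compact (closure {x. f x \<noteq> 0})" using that by (simp add: compactly_supported_in_def)
      then have "compact (\<Phi> ` closure {x. f x \<noteq> 0})"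
        by (rule compact_continuous_image[OF continuous_on_subset[OF cont(1)], rotated]) simp
      from compact_imp_bounded[OF this]
      obtain r where r: "\<And>g. g \<in> \<Phi> ` closure {x. f x \<noteq> 0} \<Longrightarrow> norm g \<le> r"
        unfolding bounded_iff by blast
      show ?thesis
      proof (rule compactly_supported_in_UNIV[of r], rule ccontr)
        fix g assume "r < norm g" "f (\<Psi> g) \<noteq> 0"
        then have "\<Psi> g \<in> closure {x. f x \<noteq> 0}" by (intro closure_subset[THEN subsetD]) simp
        then have "\<Phi> (\<Psi> g) \<in> \<Phi> ` closure {x. f x \<noteq> 0}" by (rule imageI)
        with r[of g] \<open>r < norm g\<close> show False by (simp add: inv)
      qed
    qed
    define \<eta> where "\<eta> i g = \<zeta> i (\<Psi> g)" for i g
    have dX: "((\<lambda>s. \<eta> i (g + s *\<^sub>R X_field j g)) has_real_derivative X_deriv j (\<zeta> i) (\<Psi> g) / l) (at 0)" for i j g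
    proof -
      have "(\<lambda>s. \<zeta> i (\<Psi> g + s *\<^sub>R X_field j (\<Psi> g))) differentiable (at 0)"
        using X(1)[of j i] unfolding X_differentiable_def by (rule spec)
      then have D: "((\<lambda>s. \<zeta> i (\<Psi> g + s *\<^sub>R X_field j (\<Psi> g))) has_real_derivative X_deriv j (\<zeta> i) (\<Psi> g)) (at 0)"
        unfolding X_deriv_def by (simp add: DERIV_deriv_iff_real_differentiable)
      have "((\<lambda>s. \<zeta> i (\<Psi> g + (s / l) *\<^sub>R X_field j (\<Psi> g))) has_real_derivative X_deriv j (\<zeta> i) (\<Psi> g) * (1 / l)) (at 0)"
      proof (rule DERIV_chain2[where f = "\<lambda>s. \<zeta> i (\<Psi> g + s *\<^sub>R X_field j (\<Psi> g))" and g = "\<lambda>s. s / l"])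
        show "((\<lambda>s. \<zeta> i (\<Psi> g + s *\<^sub>R X_field j (\<Psi> g))) has_real_derivative X_deriv j (\<zeta> i) (\<Psi> g)) (at (0 / l))"
          using D by simp
        show "((\<lambda>s. s / l) has_real_derivative 1 / l) (at 0)" by (rule DERIV_cdivide[OF DERIV_ident])
      qed
      then show ?thesis by (simp add: \<eta>_def hom)
    qed
    have X\<eta>: "X_deriv j (\<eta> i) g = X_deriv j (\<zeta> i) (\<Psi> g) / l" for i j g
      unfolding X_deriv_def[of j "\<eta> i"] by (rule DERIV_imp_deriv[OF dX])
    have \<eta>: "\<eta> \<in> horizontal_test_fields UNIV"
      unfolding horizontal_test_fields_def
    proof (intro CollectI conjI allI ballI)
      fix i j :: "'n + 'n" and g :: "'n heis"
      show "continuous_on UNIV (\<eta> i)"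
        unfolding \<eta>_def by (rule continuous_on_compose2[OF c(1) cont(2)]) simp
      show "compactly_supported_in UNIV (\<eta> i)" unfolding \<eta>_def by (rule supp[OF c(2)])
      show "X_differentiable j (\<eta> i)"
        unfolding X_differentiable_def real_differentiable_def by (intro allI, rule exI, rule dX)
      show "continuous_on UNIV (X_deriv j (\<eta> i))"
        unfolding X\<eta>[abs_def] using l
        by (intro continuous_on_divide continuous_on_const continuous_on_compose2[OF X(2) cont(2)]) auto
      show "compactly_supported_in UNIV (X_deriv j (\<eta> i))"
      proof -
        obtain r where "\<And>g. r < norm g \<Longrightarrow> X_deriv j (\<zeta> i) (\<Psi> g) = 0"
          using compactly_supported_imp_bounded_support[OF supp[OF X(3)[of j i]]] by blast
        then show ?thesis by (intro compactly_supported_in_UNIV[of r]) (simp add: X\<eta>)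
      qed
      show "sqrt (\<Sum>i\<in>UNIV. (\<eta> i g)\<^sup>2) \<le> 1" unfolding \<eta>_def by (rule nrm)
    qed
    define D where "D g = (\<Sum>i\<in>UNIV. X_deriv i (\<zeta> i) g)" for g
    have Dm: "D \<in> borel_measurable borel"
      unfolding D_def by (intro borel_measurable_continuous_onI continuous_intros X(2))
    have D\<Psi>: "(\<lambda>g. \<Sum>i\<in>UNIV. X_deriv i (\<eta> i) g) = (\<lambda>g. D (\<Psi> g) / l)"
      by (simp add: D_def X\<eta> sum_divide_distrib)
    have D\<Psi>m: "(\<lambda>g. D (\<Psi> g) / l) \<in> borel_measurable borel"
      using measurable_compose[OF \<Psi>m Dm] by simp
    have "set_lebesgue_integral lebesgue (\<Phi> ` E) (\<lambda>g. \<Sum>i\<in>UNIV. X_deriv i (\<eta> i) g)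
      = (\<integral>g. indicator (\<Phi> ` E) g * (D (\<Psi> g) / l) \<partial>lborel)"
      unfolding D\<Psi> by (rule set_lebesgue_integral_lborel[OF borel D\<Psi>m])
    also have "\<dots> = d * (\<integral>g. indicator E g * (D g / l) \<partial>lborel)"
      unfolding ind by (rule jac) (use E Dm in simp)
    also have "\<dots> = d / l * set_lebesgue_integral lebesgue E D"
      by (simp add: set_lebesgue_integral_lborel[OF E Dm])
    finally have eq: "set_lebesgue_integral lebesgue E D
      = l / d * set_lebesgue_integral lebesgue (\<Phi> ` E) (\<lambda>g. \<Sum>i\<in>UNIV. X_deriv i (\<eta> i) g)"
      using l d by simp
    have "ereal (set_lebesgue_integral lebesgue (\<Phi> ` E) (\<lambda>g. \<Sum>i\<in>UNIV. X_deriv i (\<eta> i) g)) \<le> H_perimeter (\<Phi> ` E) UNIV"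
      unfolding H_perimeter_def by (rule SUP_upper[OF \<eta>])
    then have "ereal (l / d) * ereal (set_lebesgue_integral lebesgue (\<Phi> ` E) (\<lambda>g. \<Sum>i\<in>UNIV. X_deriv i (\<eta> i) g))
        \<le> ereal (l / d) * H_perimeter (\<Phi> ` E) UNIV"
      by (rule ereal_mult_left_mono) (use l d in simp)
    then have "ereal (set_lebesgue_integral lebesgue E D) \<le> ereal (l / d) * H_perimeter (\<Phi> ` E) UNIV"
      unfolding eq by simp
    then show "ereal (set_lebesgue_integral lebesgue E (\<lambda>g. \<Sum>i\<in>UNIV. X_deriv i (\<zeta> i) g))
        \<le> ereal (l / d) * H_perimeter (\<Phi> ` E) UNIV"
      by (simp add: D_def[abs_def])
  qed
qed

section \<open>Left translations\<close>

definition heis_inv :: "'n::finite heis \<Rightarrow> 'n heis" where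
  "heis_inv g = (- fst g, - snd g)"

lemma rot_uminus: "rot (- z) = - rot z" by (simp add: rot_def)

lemma heis_mult_inv: "heis_mult (heis_inv g) (heis_mult g h) = h" "heis_mult g (heis_mult (heis_inv g) h) = h"
  by (simp_all add: heis_mult_eq heis_inv_def prod_eq_iff rot_uminus inner_add_right inner_diff_right rot.J_orth)

lemma continuous_on_heis_mult: "continuous_on UNIV (heis_mult g)"
  unfolding heis_mult_eq[abs_def] by (intro continuous_intros) auto

text \<open>The group law is affine in its second argument, so a left translation carries frame
  lines to frame lines at the same speed. This is the left invariance of the frame.\<close>

lemma heis_mult_X_field:
  "heis_mult h (g + s *\<^sub>R X_field j g) = heis_mult h g + s *\<^sub>R X_field j (heis_mult h g)"
  by (simp add: heis_mult_eq X_field_eq prod_eq_iff rot.J_add inner_add_left inner_add_right algebra_simps add_divide_distrib)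

text \<open>A left translation is a shear in the sense of \<open>lborel_distr_shear\<close>. The
  factor 1 gives the equation the form of the Jacobian hypothesis of
  \<open>H_perimeter_pullback\<close>.\<close>

lemma integral_heis_mult:
  fixes f :: "'n::finite heis \<Rightarrow> real"
  assumes f: "f \<in> borel_measurable borel"
  shows "(\<integral>g. f (heis_mult h g) \<partial>lborel) = 1 * (\<integral>g. f g \<partial>lborel)"
proof -
  have m: "heis_mult h \<in> borel_measurable borel" by (rule borel_measurable_continuous_onI[OF continuous_on_heis_mult])
  have "(\<lambda>z. snd h + rot (fst h) \<bullet> z / 2) \<in> borel_measurable borel"
    by (intro borel_measurable_continuous_onI continuous_intros) auto
  from lborel_distr_shear[OF this, of "fst h"]
  have "distr lborel borel (\<lambda>p. (fst p + fst h, snd p + (snd h + rot (fst h) \<bullet> fst p / 2))) = lborel" .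
  moreover have "(\<lambda>p. (fst p + fst h, snd p + (snd h + rot (fst h) \<bullet> fst p / 2))) = heis_mult h"
    by (simp add: fun_eq_iff heis_mult_eq ac_simps)
  ultimately have "distr lborel borel (heis_mult h) = lborel" by simp
  then have "(\<integral>g. f g \<partial>lborel) = (\<integral>g. f g \<partial>distr lborel borel (heis_mult h))" by simp
  also have "\<dots> = (\<integral>g. f (heis_mult h g) \<partial>lborel)" by (rule integral_distr) (use m f in auto)
  finally show ?thesis by simp
qed

section \<open>Dilations\<close>

lemma heis_dil_eq: "heis_dil l g = (l *\<^sub>R fst g, l\<^sup>2 * snd g)"
  by (simp add: heis_dil_def case_prod_beta)

lemma heis_dil_heis_dil: "heis_dil a (heis_dil b g) = heis_dil (a * b) g"
  by (simp add: heis_dil_eq power_mult_distrib)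

lemma heis_dil_1: "heis_dil 1 g = g" by (simp add: heis_dil_eq)

lemma heis_dil_mult: "heis_dil l (heis_mult g h) = heis_mult (heis_dil l g) (heis_dil l h)"
  by (simp add: heis_dil_eq heis_mult_eq rot.J_scaleR algebra_simps power2_eq_square)

lemma continuous_on_heis_dil: "continuous_on UNIV (heis_dil l)"
  unfolding heis_dil_eq[abs_def] by (intro continuous_intros)

lemma heis_dil_X_field:
  "l \<noteq> 0 \<Longrightarrow> heis_dil l (g + s *\<^sub>R X_field j g) = heis_dil l g + (s * l) *\<^sub>R X_field j (heis_dil l g)"
  by (simp add: heis_dil_eq X_field_eq prod_eq_iff rot.J_scaleR algebra_simps power2_eq_square)

lemma integral_heis_dil:
  fixes f :: "'n::finite heis \<Rightarrow> real"
  assumes f: "f \<in> borel_measurable borel" and l: "0 < l"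
  shows "(\<integral>g. f (heis_dil (1 / l) g) \<partial>lborel) = l ^ (2 * CARD('n) + 2) * (\<integral>g. f g \<partial>lborel)"
proof -
  \<comment> \<open>The diagonal entries of the dilation in the standard basis; the vertical basis
    vector is recognised by its zero horizontal part. Their product is the power of \<open>l\<close>
    whose exponent is the homogeneous dimension Q.\<close>
  define c :: "'n heis \<Rightarrow> real" where "c b = (if fst b = 0 then l\<^sup>2 else l)" for b
  have T: "0 + (\<Sum>j\<in>Basis. (c j * (x \<bullet> j)) *\<^sub>R j) = heis_dil l x" for x
  proof (rule euclidean_eqI)
    fix b :: "'n heis" assume b: "b \<in> Basis"
    have "(0 + (\<Sum>j\<in>Basis. (c j * (x \<bullet> j)) *\<^sub>R j)) \<bullet> b = c b * (x \<bullet> b)" using b by simp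
    also have "\<dots> = heis_dil l x \<bullet> b"
      using b by (auto simp: c_def heis_dil_eq Basis_prod_def inner_prod_def)
    finally show "(0 + (\<Sum>j\<in>Basis. (c j * (x \<bullet> j)) *\<^sub>R j)) \<bullet> b = heis_dil l x \<bullet> b" .
  qed
  have P: "(\<Prod>j\<in>Basis. \<bar>c j\<bar>) = l ^ (2 * CARD('n) + 2)"
  proof -
    let ?B1 = "(\<lambda>u. (u, 0)) ` (Basis :: 'n hplane set) :: 'n heis set" and ?B2 = "{(0, 1)} :: 'n heis set"
    have "(\<Prod>j\<in>Basis. \<bar>c j\<bar>) = (\<Prod>j\<in>?B1 \<union> ?B2. \<bar>c j\<bar>)" by (simp add: Basis_prod_def)
    also have "\<dots> = (\<Prod>j\<in>?B1. \<bar>c j\<bar>) * (\<Prod>j\<in>?B2. \<bar>c j\<bar>)" by (rule prod.union_disjoint) auto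
    also have "(\<Prod>j\<in>?B1. \<bar>c j\<bar>) = (\<Prod>u\<in>(Basis :: 'n hplane set). \<bar>c (u, 0)\<bar>)"
      by (subst prod.reindex) (auto simp: inj_on_def)
    also have "\<dots> = (\<Prod>u\<in>(Basis :: 'n hplane set). l)"
      using l by (intro prod.cong refl) (auto simp: c_def)
    also have "\<dots> = l ^ (2 * CARD('n))" by (simp flip: mult_2)
    also have "(\<Prod>j\<in>?B2. \<bar>c j\<bar>) = l\<^sup>2" by (simp add: c_def)
    finally show ?thesis by (simp add: power_add power2_eq_square)
  qed
  have m: "heis_dil a \<in> borel_measurable borel" for a :: real
    by (rule borel_measurable_continuous_onI[OF continuous_on_heis_dil])
  have fm: "(\<lambda>g. f (heis_dil (1 / l) g)) \<in> borel_measurable borel" by (rule measurable_compose[OF m f])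
  have leb: "(lborel :: 'n heis measure) = density (distr lborel borel (heis_dil l)) (\<lambda>_. ennreal (l ^ (2 * CARD('n) + 2)))"
    using lborel_affine_euclidean[of c 0] l unfolding T P by (simp add: c_def)
  have "(\<integral>g. f (heis_dil (1 / l) g) \<partial>lborel)
    = (\<integral>g. f (heis_dil (1 / l) g) \<partial>density (distr lborel borel (heis_dil l)) (\<lambda>_. ennreal (l ^ (2 * CARD('n) + 2))))"
    using leb by simp
  also have "\<dots> = (\<integral>g. l ^ (2 * CARD('n) + 2) *\<^sub>R f (heis_dil (1 / l) g) \<partial>distr lborel borel (heis_dil l))"
    by (rule integral_density) (use fm l in auto)
  also have "\<dots> = (\<integral>g. l ^ (2 * CARD('n) + 2) *\<^sub>R f (heis_dil (1 / l) (heis_dil l g)) \<partial>lborel)"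
    by (rule integral_distr) (use m fm in auto)
  finally show ?thesis using l by (simp add: heis_dil_heis_dil heis_dil_1)
qed

lemma H_perimeter_heis_mult:
  fixes E :: "'n::finite heis set"
  assumes E: "E \<in> sets borel"
  shows "heis_mult g ` E \<in> sets borel" "measure lborel (heis_mult g ` E) = measure lborel E"
    and "H_perimeter (heis_mult g ` E) UNIV = H_perimeter E UNIV"
proof -
  have *: "heis_mult g ` F \<in> sets borel \<and> measure lborel (heis_mult g ` F) = 1 * measure lborel F
      \<and> H_perimeter F UNIV \<le> ereal (1 / 1) * H_perimeter (heis_mult g ` F) UNIV"
    if "F \<in> sets borel" for g and F :: "'n heis set"
    by (intro conjI; rule H_perimeter_pullback[where \<Psi> = "heis_mult (heis_inv g)" and l = 1 and d = 1])
      (use that in \<open>auto simp: heis_mult_inv continuous_on_heis_mult heis_mult_X_field integral_heis_mult\<close>)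
  show b: "heis_mult g ` E \<in> sets borel" and "measure lborel (heis_mult g ` E) = measure lborel E"
    using *[OF E, of g] by simp_all
  have "heis_mult (heis_inv g) ` heis_mult g ` E = E" by (simp add: image_image heis_mult_inv)
  then show "H_perimeter (heis_mult g ` E) UNIV = H_perimeter E UNIV"
    using *[OF E, of g] *[OF b, of "heis_inv g"] by (intro antisym) (simp_all add: one_ereal_def[symmetric])
qed

text \<open>Homogeneity of degree Q - 1: integrals scale by l^Q and frame derivatives by 1 / l. The
  two inequalities come from the dilations with factors \<open>l\<close> and
  \<open>1 / l\<close>.\<close>

lemma H_perimeter_heis_dil:
  fixes E :: "'n::finite heis set"
  assumes E: "E \<in> sets borel" and l: "0 < l"
  shows "heis_dil l ` E \<in> sets borel" "measure lborel (heis_dil l ` E) = l ^ (2 * CARD('n) + 2) * measure lborel E"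
    and "H_perimeter (heis_dil l ` E) UNIV = ereal (l ^ (2 * CARD('n) + 1)) * H_perimeter E UNIV"
proof -
  have *: "heis_dil l ` F \<in> sets borel \<and> measure lborel (heis_dil l ` F) = l ^ (2 * CARD('n) + 2) * measure lborel F
      \<and> H_perimeter F UNIV \<le> ereal (l / l ^ (2 * CARD('n) + 2)) * H_perimeter (heis_dil l ` F) UNIV"
    if F: "F \<in> sets borel" and l: "0 < l" for F :: "'n heis set" and l :: real
  proof -
    have i: "heis_dil (1 / l) (heis_dil l g) = g" "heis_dil l (heis_dil (1 / l) g) = g" for g :: "'n heis"
      using l by (simp_all add: heis_dil_heis_dil heis_dil_1)
    have h: "heis_dil (1 / l) (g + s *\<^sub>R X_field j g) = heis_dil (1 / l) g + (s / l) *\<^sub>R X_field j (heis_dil (1 / l) g)"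
      for j s and g :: "'n heis"
      using heis_dil_X_field[of "1 / l" g s j] l by simp
    note H = H_perimeter_pullback[of "heis_dil (1 / l)" "heis_dil l" l "l ^ (2 * CARD('n) + 2)" F,
        OF i continuous_on_heis_dil continuous_on_heis_dil l zero_less_power[OF l] h integral_heis_dil[OF _ l] F]
    show ?thesis by (intro conjI H)
  qed
  define K where "K = l ^ (2 * CARD('n) + 1)"
  have K: "0 < K" using l by (simp add: K_def)
  have k1: "l / l ^ (2 * CARD('n) + 2) = 1 / K" using l by (simp add: K_def)
  have k2: "(1 / l) / (1 / l) ^ (2 * CARD('n) + 2) = K" using l by (simp add: K_def power_divide)
  show b: "heis_dil l ` E \<in> sets borel" and "measure lborel (heis_dil l ` E) = l ^ (2 * CARD('n) + 2) * measure lborel E"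
    using *[OF E l] by simp_all
  have round_trip: "heis_dil (1 / l) ` heis_dil l ` E = E"
    using l by (simp add: image_image heis_dil_heis_dil heis_dil_1)
  have up: "H_perimeter (heis_dil l ` E) UNIV \<le> ereal K * H_perimeter E UNIV"
    using *[OF b, of "1 / l"] l unfolding k2 round_trip by simp
  have lo: "H_perimeter E UNIV \<le> ereal (1 / K) * H_perimeter (heis_dil l ` E) UNIV"
    using *[OF E l] unfolding k1 by simp
  have "ereal K * H_perimeter E UNIV \<le> ereal K * (ereal (1 / K) * H_perimeter (heis_dil l ` E) UNIV)"
    by (rule ereal_mult_left_mono[OF lo]) (use K in simp)
  also have "\<dots> = H_perimeter (heis_dil l ` E) UNIV"
    using K by (simp add: mult.assoc[symmetric] one_ereal_def[symmetric])
  finally show "H_perimeter (heis_dil l ` E) UNIV = ereal (l ^ (2 * CARD('n) + 1)) * H_perimeter E UNIV"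
    using up unfolding K_def by (rule antisym[rotated])
qed

section \<open>Reduction to unit radius\<close>

lemma C2_on_imp_C1_on: "C2_on S f \<Longrightarrow> C1_on S f"
proof -
  assume "C2_on S f"
  then obtain f' f'' where f': "\<And>x. x \<in> S \<Longrightarrow> (f has_derivative blinfun_apply (f' x)) (at x)"
    and f'': "\<And>x. x \<in> S \<Longrightarrow> (f' has_derivative blinfun_apply (f'' x)) (at x)"
    unfolding C2_on_def by blast
  have "continuous_on S f'"
  proof (intro continuous_at_imp_continuous_on ballI)
    show "isCont f' x" if "x \<in> S" for x by (rule has_derivative_continuous[OF f''[OF that]])
  qed
  then have "continuous_on S (\<lambda>x. blinfun_apply (f' x) h)" for h
    by (intro continuous_intros)
  with f' show "C1_on S f" by (rule C1_onI)
qed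

text \<open>Heights scale with the square of the radius, hence the factor
  \<open>1 / R\<^sup>2\<close> in \<open>s\<close>. Nonnegativity of both graph functions and the
  absence of common zeros in the ball give the positive thickness.\<close>

lemma isop_class_normalize:
  fixes E :: "'n::finite heis set"
  assumes "E \<in> isop_class"
  obtains R u v where "0 < R" "graph_domain u v" "E = heis_dil R ` graph_domain.dom u v"
proof -
  from assms[unfolded isop_class_def mem_Collect_eq, THEN conjunct2] show ?thesis
  proof (elim exE conjE, goal_cases)
    case (1 R u v)
    note R = 1(1) and nn = bspec[OF 1(2)] and C2 = 1(3,5) and ct = 1(4,6) and bd = bspec[OF 1(7)]
      and disj = 1(10) and E = 1(11)
    define s where "s f z = f (R *\<^sub>R z) * (1 / R\<^sup>2)" for f :: "'n hplane \<Rightarrow> real" and z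
    have lin: "bounded_linear (\<lambda>z :: 'n hplane. R *\<^sub>R z)" by (rule bounded_linear_scaleR_right)
    have sC: "C1_on (ball 0 1) (s f)" if "C2_on (ball 0 R) f" for f
      unfolding s_def
    proof (rule C1_on_mult[OF C1_on_compose_linear[OF C2_on_imp_C1_on[OF that] lin] C1_on_const])
      show "R *\<^sub>R z \<in> ball 0 R" if "z \<in> ball 0 1" for z :: "'n hplane" using that R by simp
    qed
    have sc: "continuous_on (cball 0 1) (s f)" if "continuous_on (cball 0 R) f" for f
      unfolding s_def
    proof (intro continuous_on_mult continuous_on_const continuous_on_compose2[OF that])
      show "continuous_on (cball 0 1) (\<lambda>z :: 'n hplane. R *\<^sub>R z)" by (intro continuous_intros)
      show "(*\<^sub>R) R ` cball (0 :: 'n hplane) 1 \<subseteq> cball 0 R"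
      proof (rule image_subsetI)
        fix z :: "'n hplane" assume "z \<in> cball 0 1"
        then show "R *\<^sub>R z \<in> cball 0 R" using R by simp
      qed
    qed
    have nz: "norm (R *\<^sub>R z) = R * norm z" for z :: "'n hplane" using R by simp
    have G: "graph_domain (s u) (s v)"
    proof
      fix z :: "'n hplane"
      show "s u z = 0" "s v z = 0" if "norm z = 1"
        using bd[of "R *\<^sub>R z"] that R by (auto simp: s_def)
      show "0 < s u z + s v z" if "norm z < 1"
      proof -
        have "R *\<^sub>R z \<in> ball 0 R" using that R by simp
        then have "0 < u (R *\<^sub>R z) + v (R *\<^sub>R z)" using disj nn[of "R *\<^sub>R z"] by fastforce
        then show ?thesis using R by (simp add: s_def add_divide_distrib[symmetric])
      qed
    qed (use sC C2 sc ct in auto)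
    have "E = heis_dil R ` graph_domain.dom (s u) (s v)"
    proof (intro set_eqI iffI)
      fix p assume "p \<in> heis_dil R ` graph_domain.dom (s u) (s v)"
      then obtain z t where p: "p = heis_dil R (z, t)" and zt: "norm z < 1" "- s v z < t" "t < s u z"
        unfolding graph_domain.dom_def[OF G] by auto
      have "- v (R *\<^sub>R z) < R\<^sup>2 * t" "R\<^sup>2 * t < u (R *\<^sub>R z)"
        using zt(2,3) R by (simp_all add: s_def field_simps)
      then show "p \<in> E" using zt(1) R by (simp add: E p heis_dil_eq)
    next
      fix p assume "p \<in> E"
      then obtain z t where p: "p = (z, t)" and zt: "norm z < R" "- v z < t" "t < u z" by (auto simp: E)
      have "((1 / R) *\<^sub>R z, t / R\<^sup>2) \<in> graph_domain.dom (s u) (s v)"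
      proof -
        have "- (v z / R\<^sup>2) < t / R\<^sup>2" "t / R\<^sup>2 < u z / R\<^sup>2"
          using zt(2,3) R divide_strict_right_mono[of "- v z" t "R\<^sup>2"] divide_strict_right_mono[of t "u z" "R\<^sup>2"] by auto
        then show ?thesis unfolding graph_domain.dom_def[OF G] using zt(1) R by (simp add: s_def)
      qed
      moreover have "p = heis_dil R ((1 / R) *\<^sub>R z, t / R\<^sup>2)" using R by (simp add: p heis_dil_eq)
      ultimately show "p \<in> heis_dil R ` graph_domain.dom (s u) (s v)" by blast
    qed
    with R G show thesis by (rule that)
  qed
qed

section \<open>The isoperimetric inequality\<close>

theorem theorem1p4:
  fixes E :: "'n::finite heis set" and Q :: real
  assumes "Q = 2 * real CARD('n) + 2"
    and "E \<in> isop_class_ext"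
  shows "ereal (measure lebesgue E powr ((Q - 1) / Q)) \<le> ereal (isop_const Q) * H_perimeter E UNIV
     \<and> (ereal (measure lebesgue E powr ((Q - 1) / Q)) = ereal (isop_const Q) * H_perimeter E UNIV
         \<longleftrightarrow> (\<exists>l g. l > 0 \<and> E = heis_mult g ` heis_dil l ` E_opt))"
proof -
  define n where "n = CARD('n)"
  define \<omega> where "\<omega> = unit_ball_vol (real (2 * n))"
  define V where "V = \<omega> / 2 * Beta (real n + 3 / 2) (1 / 2)"
  define c where "c = n * \<omega> * Beta (real n + 1 / 2) (3 / 2)"
  define A where "A = n * \<omega> * Beta (real n + 1 / 2) (1 / 2)"
  have Q: "Q = 2 * real n + 2" using assms(1) by (simp add: n_def)
  have npos: "0 < n" by (simp add: n_def)
  note const = npos \<omega>_def Q V_def c_def A_def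
  define C where "C = isop_const Q"
  have C: "0 < C" unfolding C_def by (rule isop_const_pos[OF const])
  have vol_opt: "measure lborel (E_opt :: 'n heis set) = V"
    using E_opt_volume[OF n_def \<omega>_def] by (simp add: V_def)
  have per_opt: "H_perimeter (E_opt :: 'n heis set) UNIV \<le> ereal A"
    unfolding A_def by (rule H_perimeter_E_opt_le[OF bubble_area[OF n_def \<omega>_def] bubble_area_nonneg[OF n_def \<omega>_def]])
  have opt_borel: "(E_opt :: 'n heis set) \<in> sets borel" by (rule borel_open[OF opt.open_dom[unfolded dom_opt]])
  \<comment> \<open>The volume side of the inequality has degree Q - 1 under dilations, the same as
    the perimeter, so the factor cancels in the end.\<close>
  have scaling: "(l ^ (2 * n + 2) * W) powr ((Q - 1) / Q) = l ^ (2 * n + 1) * W powr ((Q - 1) / Q)"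
    if "0 < l" "0 \<le> W" for l W :: real
  proof -
    have q: "Q = real (2 * n + 2)" "Q - 1 = real (2 * n + 1)" by (simp_all add: Q)
    have l1: "l powr Q = l ^ (2 * n + 2)" unfolding q(1) by (rule powr_realpow[OF that(1)])
    have l2: "l powr (Q - 1) = l ^ (2 * n + 1)" unfolding q(2) by (rule powr_realpow[OF that(1)])
    have "Q \<noteq> 0" by (simp add: Q)
    then have "(l powr Q) powr ((Q - 1) / Q) = l powr (Q - 1)" by (simp add: powr_powr)
    then have "(l ^ (2 * n + 2)) powr ((Q - 1) / Q) = l ^ (2 * n + 1)" by (simp only: l1 l2)
    moreover have "(l ^ (2 * n + 2) * W) powr ((Q - 1) / Q) = (l ^ (2 * n + 2)) powr ((Q - 1) / Q) * W powr ((Q - 1) / Q)"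
      by (rule powr_mult)
    ultimately show ?thesis by (simp only:)
  qed
  have image: "heis_mult g ` heis_dil l ` F \<in> sets borel"
      "measure lebesgue (heis_mult g ` heis_dil l ` F) powr ((Q - 1) / Q) = l ^ (2 * n + 1) * measure lborel F powr ((Q - 1) / Q)"
      "H_perimeter (heis_mult g ` heis_dil l ` F) UNIV = ereal (l ^ (2 * n + 1)) * H_perimeter F UNIV"
    if F: "F \<in> sets borel" and l: "0 < l" for F :: "'n heis set" and l g
  proof -
    note d = H_perimeter_heis_dil[OF F l]
    note m = H_perimeter_heis_mult[OF d(1), of g]
    show b: "heis_mult g ` heis_dil l ` F \<in> sets borel" by (rule m(1))
    have "measure lebesgue (heis_mult g ` heis_dil l ` F) = measure lborel (heis_mult g ` heis_dil l ` F)"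
      using b by (intro measure_completion) simp
    also have "\<dots> = l ^ (2 * n + 2) * measure lborel F" unfolding m(2) d(2) n_def ..
    finally show "measure lebesgue (heis_mult g ` heis_dil l ` F) powr ((Q - 1) / Q) = l ^ (2 * n + 1) * measure lborel F powr ((Q - 1) / Q)"
      using scaling[OF l, of "measure lborel F"] by simp
    show "H_perimeter (heis_mult g ` heis_dil l ` F) UNIV = ereal (l ^ (2 * n + 1)) * H_perimeter F UNIV"
      unfolding m(3) d(3) n_def ..
  qed
  obtain l g E0 where l: "0 < l" and E0: "E0 \<in> isop_class" and E': "E = heis_dil l ` heis_mult g ` E0"
    using assms(2) unfolding isop_class_ext_def by blast
  obtain R u v where R: "0 < R" and G: "graph_domain u v" and E0': "E0 = heis_dil R ` graph_domain.dom u v"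
    using E0 by (rule isop_class_normalize)
  interpret dom: graph_domain u v by (rule G)
  define \<mu> where "\<mu> = l * R"
  have \<mu>: "0 < \<mu>" using l R by (simp add: \<mu>_def)
  \<comment> \<open>A dilation passes through a left translation, moving its base point to
    \<open>heis_dil l g\<close>. This brings the two maps into the order used in the equality
    statement.\<close>
  have E: "E = heis_mult (heis_dil l g) ` heis_dil \<mu> ` dom.dom"
    unfolding E' E0' by (simp add: image_image heis_dil_mult heis_dil_heis_dil \<mu>_def)
  have dom_borel: "dom.dom \<in> sets borel" by (rule borel_open[OF dom.open_dom])
  define W where "W = measure lborel dom.dom"
  define P where "P = H_perimeter dom.dom UNIV"
  define K where "K = \<mu> ^ (2 * n + 1)"
  have K: "0 < K" using \<mu> by (simp add: K_def)
  note img = image[OF dom_borel \<mu>, of "heis_dil l g", folded E W_def P_def K_def]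
  have flux: "dom.upper.bubble_flux + dom.lower.bubble_flux = 2 * n * W + c"
    unfolding dom.upper.bubble_flux_def dom.lower.bubble_flux_def waist_integral[OF n_def \<omega>_def] W_def dom.measure_dom
      DIM_hplane[OF n_def \<omega>_def] c_def[symmetric]
    by (simp add: algebra_simps)
  have P: "ereal (2 * n * W + c) \<le> P" using dom.perimeter_lower_bound unfolding flux P_def .
  have W: "W powr ((Q - 1) / Q) \<le> C * (2 * n * W + c)"
    using volume_isop_bound[OF const, of W] by (simp add: C_def W_def)
  have ineq: "ereal (K * W powr ((Q - 1) / Q)) \<le> ereal C * (ereal K * P)"
  proof -
    have "K * W powr ((Q - 1) / Q) \<le> C * (K * (2 * n * W + c))"
      using mult_left_mono[OF W, of K] K by (simp add: mult.left_commute)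
    then have "ereal (K * W powr ((Q - 1) / Q)) \<le> ereal C * (ereal K * ereal (2 * n * W + c))" by simp
    also have "\<dots> \<le> ereal C * (ereal K * P)"
      by (intro ereal_mult_left_mono P) (use C K in auto)
    finally show ?thesis .
  qed
  have eqv: "ereal (K * W powr ((Q - 1) / Q)) = ereal C * (ereal K * P)
      \<longleftrightarrow> (\<exists>l g. l > 0 \<and> E = heis_mult g ` heis_dil l ` E_opt)"
  proof
    assume eq: "ereal (K * W powr ((Q - 1) / Q)) = ereal C * (ereal K * P)"
    \<comment> \<open>The calibration bound excludes - \<infinity>, and the assumed equality
      excludes \<infinity> because \<open>C\<close> and \<open>K\<close> are positive.\<close>
    obtain p where p: "P = ereal p"
      using eq P C K by (cases P) auto
    have "K * W powr ((Q - 1) / Q) = K * (C * p)" using eq by (simp add: p mult.left_commute)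
    then have "W powr ((Q - 1) / Q) = C * p" using K by simp
    \<comment> \<open>\<open>C * p\<close> equals the power of \<open>W\<close>, which is at most
      \<open>C * (2 * n * W + c)\<close>. With the lower bound for \<open>P\<close>, the perimeter
      is squeezed onto the calibration bound.\<close>
    then have "p \<le> 2 * n * W + c" using W C by simp
    with P have "P = ereal (2 * n * W + c)" by (simp add: p)
    then have "dom.dom = E_opt" by (intro dom.perimeter_minimal_imp_bubble) (simp add: flux P_def)
    then show "\<exists>l g. l > 0 \<and> E = heis_mult g ` heis_dil l ` E_opt" using \<mu> E by metis
  next
    assume "\<exists>l g. l > 0 \<and> E = heis_mult g ` heis_dil l ` E_opt"
    then obtain m h where m: "0 < m" and Em: "E = heis_mult h ` heis_dil m ` E_opt" by blast
    note o = image[OF opt_borel m, of h, folded Em, unfolded vol_opt]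
    have mK: "0 \<le> m ^ (2 * n + 1)" using m by simp
    \<comment> \<open>The representation by \<open>m\<close> and \<open>h\<close> may differ from
      the one by \<mu>, so only the volume and the perimeter of \<open>E\<close> itself are
      compared. As \<open>ineq\<close> is one half of the equality, an upper bound for the perimeter
      of \<open>E_opt\<close> suffices.\<close>
    have "ereal C * (ereal K * P) = ereal C * (ereal (m ^ (2 * n + 1)) * H_perimeter (E_opt :: 'n heis set) UNIV)"
      using img(3) o(3) by simp
    also have "\<dots> \<le> ereal C * (ereal (m ^ (2 * n + 1)) * ereal A)"
      by (intro ereal_mult_left_mono per_opt) (use C mK in auto)
    also have "\<dots> = ereal (m ^ (2 * n + 1) * V powr ((Q - 1) / Q))"
      unfolding volume_isop_equality[OF const] C_def by (simp add: mult.left_commute)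
    also have "\<dots> = ereal (K * W powr ((Q - 1) / Q))" using img(2) o(2) by simp
    finally show "ereal (K * W powr ((Q - 1) / Q)) = ereal C * (ereal K * P)" by (rule antisym[OF ineq])
  qed
  show ?thesis unfolding img C_def[symmetric] using ineq eqv by blast
qed

end
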